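(* Let $$\Sigma:=\big\|\widehat p_{0,h}^{\,\star}-K_h^\star\,p_0^\star\big\|^2 .$$ Assume that there exists a constant $C>0$ such that for all sufficiently large $\kappa>0$, $$\mu_0\big((\kappa,+\infty)\big)\le\frac C\kappa .$$ Then for any $\gamma>2\sqrt t$ there is a constant $C_{var}$ (which may depend on the parameters $\gamma$, $t$, $\mu_0$, $K$ of the problem, but not on $n$ or $h$) such that for any $h>0$, $$\mathbb{E}(\Sigma)\le\frac{C_{var}\,e^{\frac{2\gamma}{h}}}{n}.$$
   Context: Fix $t>0$; $\|\cdot\|$ is the $L^2(\mathbb{R})$ norm, and $g^\star(\xi)=\int_{\mathbb{R}}g(x)e^{ix\xi}dx$ is the Fourier transform. $\mathbb{C}_\gamma=\{z\in\mathbb{C}:\operatorname{Im}z>\gamma\}$. Let $\mu_0$ be a probability measure on $\mathbb{R}$ with density $p_0$ with respect to Lebesgue measure. For each $n\ge1$, let $d_1^n,\dots,d_n^n$ be i.i.d. with law $\mu_0$, with order statistics $\lambda_1^n(0)<\dots<\lambda_n^n(0)$, and let $X^n(0)=\mathrm{diag}(\lambda_1^n(0),\dots,\lambda_n^n(0))$. Let $H^n$ be a Hermitian Brownian motion independent of $X^n(0)$: $H^n(s)$ is $n\times n$ Hermitian with $(H^n)_{kl}=\frac1{\sqrt{2n}}(B_{k,l}+i\tilde B_{k,l})$ for $k<l$ and $(H^n)_{kk}=\frac1{\sqrt n}B_{k,k}$, where $B_{k,l},\tilde B_{k,l}$ are i.i.d. standard real Brownian motions. Let $X^n(t)=X^n(0)+H^n(t)$,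 with eigenvalues $\lambda_1^n(t),\dots,\lambda_n^n(t)$, and $\widehat G_{\mu^n_t}(z)=\frac1n\sum_{j=1}^n\frac1{z-\lambda_j^n(t)}$. For $z\in\mathbb{C}_{2\sqrt t}$, $\widehat w^n_{fp}(z)$ is the unique $w$ with $\operatorname{Im}w>\frac12\operatorname{Im}z$ such that $\frac1t(w-z)=\widehat G_{\mu^n_t}(w)$. Kernel: $K$ is a kernel whose Fourier transform $K^\star$ is bounded by a constant $C_K<\infty$ and supported in $[-1,1]$; for a bandwidth $h>0$, $K_h(\cdot)=\frac1hK(\cdot/h)$, so $K_h^\star(\xi)=K^\star(h\xi)$. Estimator: for $\gamma>2\sqrt t$ and $h>0$, $\widehat p_{0,h}$ is defined through its Fourier transform $$\widehat p_{0,h}^{\,\star}(\xi)=e^{\gamma|\xi|}\,K_h^\star(\xi)\,\frac1{\pi t}\,g_n^\star(\xi),\qquad g_n(x)=\gamma-\operatorname{Im}\widehat w^n_{fp}(x+i\gamma),\quad x\in\mathbb{R}.$$ *)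

theory Defs
  imports
    "HOL-Probability.Probability"
    "HOL-Computational_Algebra.Fundamental_Theorem_Algebra"
    "Jordan_Normal_Form.Char_Poly"
begin

text \<open>The convention is \<open>f\<^sup>\<star>(\<xi>) = \<integral> f(x) e\<^bsup>ix\<xi>\<^esup> dx\<close>, without normalisation.\<close>

definition fourier :: "(real \<Rightarrow> complex) \<Rightarrow> real \<Rightarrow> complex" where
  "fourier f \<xi> = (\<integral>x. f x * exp (\<i> * of_real (x * \<xi>)) \<partial>lborel)"

text \<open>
  Kernels whose transform is compactly supported need not be integrable (for instance
  \<open>sin x / (\<pi> x)\<close>, whose transform is the indicator of \<open>[-1,1]\<close>), so the transform of a kernel is
  meant in the \<open>L\<^sup>2\<close> sense: \<open>F\<close> is (a representative of) the \<open>L\<^sup>2\<close>-limit of the transforms of the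
  truncations of \<open>f\<close>. For \<open>f\<close> in \<open>L\<^sup>1 \<inter> L\<^sup>2\<close> this is \<^const>\<open>fourier\<close> up to a null set.
\<close>

definition square_integrable :: "(real \<Rightarrow> complex) \<Rightarrow> bool" where
  "square_integrable f \<longleftrightarrow>
     f \<in> borel_measurable borel \<and> integrable lborel (\<lambda>x. (cmod (f x))\<^sup>2)"

definition has_L2_fourier :: "(real \<Rightarrow> complex) \<Rightarrow> (real \<Rightarrow> complex) \<Rightarrow> bool" where
  "has_L2_fourier f F \<longleftrightarrow> square_integrable f \<and> square_integrable F \<and>
     ((\<lambda>R. \<integral>\<^sup>+\<xi>. ennreal ((cmod (F \<xi> - fourier (\<lambda>x. indicator {-R..R} x * f x) \<xi>))\<^sup>2) \<partial>lborel)
        \<longlongrightarrow> 0) at_top"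

definition rescaled_kernel :: "real \<Rightarrow> (real \<Rightarrow> real) \<Rightarrow> real \<Rightarrow> real" where
  "rescaled_kernel h K x = K (x / h) / h"

text \<open>This justifies writing \<open>\<lambda>\<xi>. Kstar (h * \<xi>)\<close> for the transform of \<^term>\<open>rescaled_kernel h K\<close> below.\<close>

lemma fourier_trunc_rescaled:
  assumes h: "h > 0"
  shows "fourier (\<lambda>x. indicator {-R..R} x * of_real (rescaled_kernel h K x)) \<xi>
       = fourier (\<lambda>x. indicator {-(R / h)..R / h} x * of_real (K x)) (h * \<xi>)"
proof -
  have "fourier (\<lambda>x. indicator {-R..R} x * of_real (rescaled_kernel h K x)) \<xi>
      = \<bar>h\<bar> *\<^sub>R (\<integral>x. indicator {-R..R} (0 + h * x) * of_real (rescaled_kernel h K (0 + h * x))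
            * exp (\<i> * of_real ((0 + h * x) * \<xi>)) \<partial>lborel)"
    unfolding fourier_def by (rule lborel_integral_real_affine) (use h in auto)
  also have "\<dots> = (\<integral>x. h *\<^sub>R (indicator {-R..R} (0 + h * x) * of_real (rescaled_kernel h K (0 + h * x))
            * exp (\<i> * of_real ((0 + h * x) * \<xi>))) \<partial>lborel)"
    using h by simp
  also have "\<dots> = fourier (\<lambda>x. indicator {-(R / h)..R / h} x * of_real (K x)) (h * \<xi>)"
    unfolding fourier_def
  proof (rule Bochner_Integration.integral_cong)
    fix x
    have "(0 + h * x \<in> {-R..R}) = (x \<in> {-(R / h)..R / h})"
      using h by (auto simp: field_simps)
    then have "indicator {-R..R} (0 + h * x) = (indicator {-(R / h)..R / h} x :: complex)"
      by (simp add: indicator_def)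
    then show "h *\<^sub>R (indicator {-R..R} (0 + h * x) * of_real (rescaled_kernel h K (0 + h * x))
          * exp (\<i> * of_real ((0 + h * x) * \<xi>)))
        = indicator {-(R / h)..R / h} x * of_real (K x) * exp (\<i> * of_real (x * (h * \<xi>)))"
      using h by (simp add: rescaled_kernel_def scaleR_conv_of_real mult_ac)
  qed simp
  finally show ?thesis .
qed

lemma borel_measurable_fourier:
  assumes [measurable]: "f \<in> borel_measurable borel"
  shows "fourier f \<in> borel_measurable borel"
  unfolding fourier_def by measurable

lemma has_L2_fourier_rescaled_kernel:
  assumes K: "has_L2_fourier (\<lambda>x. of_real (K x)) Kstar" and h: "h > 0"
  shows "has_L2_fourier (\<lambda>x. of_real (rescaled_kernel h K x)) (\<lambda>\<xi>. Kstar (h * \<xi>))"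
proof -
  have [measurable]: "(\<lambda>x. complex_of_real (K x)) \<in> borel_measurable borel"
      "Kstar \<in> borel_measurable borel"
    and i1: "integrable lborel (\<lambda>x. (cmod (of_real (K x)))\<^sup>2)"
    and i2: "integrable lborel (\<lambda>x. (cmod (Kstar x))\<^sup>2)"
    using K by (auto simp: has_L2_fourier_def square_integrable_def)
  define I where "I R = (\<integral>\<^sup>+\<xi>. ennreal ((cmod (Kstar \<xi>
      - fourier (\<lambda>x. indicator {-R..R} x * of_real (K x)) \<xi>))\<^sup>2) \<partial>lborel)" for R
  have lim: "(I \<longlongrightarrow> 0) at_top"
    using K unfolding has_L2_fourier_def I_def by blast
  have [measurable]: "(\<lambda>x. complex_of_real (rescaled_kernel h K x)) \<in> borel_measurable borel"
  proof -
    have "(\<lambda>x. complex_of_real (K (x / h)) / of_real h) \<in> borel_measurable borel"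
      by measurable
    then show ?thesis by (simp add: rescaled_kernel_def)
  qed
  have "integrable lborel (\<lambda>x. (cmod (of_real (K (0 + (1 / h) * x))))\<^sup>2)"
    using lborel_integrable_real_affine[OF i1, of "1 / h" 0] h by simp
  then have "integrable lborel (\<lambda>x. (cmod (of_real (K (0 + (1 / h) * x))))\<^sup>2 / h\<^sup>2)"
    by (rule integrable_divide)
  then have s1: "square_integrable (\<lambda>x. of_real (rescaled_kernel h K x))"
    by (simp add: square_integrable_def rescaled_kernel_def norm_divide power_divide)
  have "integrable lborel (\<lambda>x. (cmod (Kstar (0 + h * x)))\<^sup>2)"
    using lborel_integrable_real_affine[OF i2, of h 0] h by simp
  then have s2: "square_integrable (\<lambda>\<xi>. Kstar (h * \<xi>))"
    by (simp add: square_integrable_def)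
  have eq: "(\<integral>\<^sup>+\<xi>. ennreal ((cmod (Kstar (h * \<xi>)
        - fourier (\<lambda>x. indicator {-R..R} x * of_real (rescaled_kernel h K x)) \<xi>))\<^sup>2) \<partial>lborel)
      = ennreal (1 / h) * I (R / h)" for R
  proof -
    have [measurable]: "fourier (\<lambda>x. indicator {-(R/h)..R/h} x * of_real (K x)) \<in> borel_measurable borel"
      by (rule borel_measurable_fourier) measurable
    have "I (R / h) = ennreal h * (\<integral>\<^sup>+\<xi>. ennreal ((cmod (Kstar (0 + h * \<xi>)
        - fourier (\<lambda>x. indicator {-(R/h)..R/h} x * of_real (K x)) (0 + h * \<xi>)))\<^sup>2) \<partial>lborel)"
      unfolding I_def using h by (subst nn_integral_real_affine[where c = h and t = 0]) auto
    then show ?thesis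
      using h by (simp add: fourier_trunc_rescaled mult.assoc[symmetric] ennreal_mult[symmetric])
  qed
  have "((\<lambda>R. I (R / h)) \<longlongrightarrow> 0) at_top"
    using filterlim_compose[OF lim filterlim_tendsto_pos_mult_at_top[OF tendsto_const[of "1 / h"] _ filterlim_ident]] h
    by simp
  then have "((\<lambda>R. ennreal (1 / h) * I (R / h)) \<longlongrightarrow> ennreal (1 / h) * 0) at_top"
    by (intro ennreal_tendsto_cmult) simp_all
  then show ?thesis
    unfolding has_L2_fourier_def eq using s1 s2 by simp
qed

definition standard_brownian_motion :: "'a measure \<Rightarrow> (real \<Rightarrow> 'a \<Rightarrow> real) \<Rightarrow> bool" where
  "standard_brownian_motion M W \<longleftrightarrow>
     (\<forall>s\<ge>0. W s \<in> borel_measurable M) \<and>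
     (AE \<omega> in M. W 0 \<omega> = 0) \<and>
     (\<forall>s u. 0 \<le> s \<longrightarrow> s < u \<longrightarrow>
        distributed M lborel (\<lambda>\<omega>. W u \<omega> - W s \<omega>) (normal_density 0 (sqrt (u - s)))) \<and>
     (\<forall>m (r :: nat \<Rightarrow> real). 0 \<le> r 0 \<longrightarrow> (\<forall>i<m. r i < r (Suc i)) \<longrightarrow>
        prob_space.indep_vars M (\<lambda>_. borel) (\<lambda>i \<omega>. W (r (Suc i)) \<omega> - W (r i) \<omega>) {..<m}) \<and>
     (AE \<omega> in M. continuous_on {0..} (\<lambda>s. W s \<omega>))"

text \<open>Indices run over \<open>{0..<n}\<close> throughout.\<close>

definition order_statistic :: "nat \<Rightarrow> (nat \<Rightarrow> 'a \<Rightarrow> real) \<Rightarrow> 'a \<Rightarrow> nat \<Rightarrow> real" where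
  "order_statistic n d \<omega> k = sort (map (\<lambda>j. d j \<omega>) [0..<n]) ! k"

definition initial_matrix :: "nat \<Rightarrow> (nat \<Rightarrow> 'a \<Rightarrow> real) \<Rightarrow> 'a \<Rightarrow> complex mat" where
  "initial_matrix n d \<omega> = mat_diag n (\<lambda>k. of_real (order_statistic n d \<omega> k))"

definition hermitian_process ::
  "nat \<Rightarrow> (nat \<times> nat \<Rightarrow> real \<Rightarrow> 'a \<Rightarrow> real) \<Rightarrow> (nat \<times> nat \<Rightarrow> real \<Rightarrow> 'a \<Rightarrow> real) \<Rightarrow>
   real \<Rightarrow> 'a \<Rightarrow> complex mat" where
  "hermitian_process n B B' s \<omega> = Matrix.mat n n (\<lambda>(k, l).
     if k = l then of_real (B (k, k) s \<omega> / sqrt (real n))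
     else if k < l then Complex (B (k, l) s \<omega>) (B' (k, l) s \<omega>) / of_real (sqrt (2 * real n))
     else cnj (Complex (B (l, k) s \<omega>) (B' (l, k) s \<omega>)) / of_real (sqrt (2 * real n)))"

definition observed_matrix ::
  "nat \<Rightarrow> (nat \<Rightarrow> 'a \<Rightarrow> real) \<Rightarrow> (nat \<times> nat \<Rightarrow> real \<Rightarrow> 'a \<Rightarrow> real) \<Rightarrow>
   (nat \<times> nat \<Rightarrow> real \<Rightarrow> 'a \<Rightarrow> real) \<Rightarrow> real \<Rightarrow> 'a \<Rightarrow> complex mat" where
  "observed_matrix n d B B' s \<omega> = initial_matrix n d \<omega> + hermitian_process n B B' s \<omega>"

text \<open>
  The probabilistic assumptions for a fixed size \<open>n\<close>. Independence of processes is independence of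
  the corresponding random elements of the product spaces over the time (and matrix entry) indices;
  the last clause says that the \<open>\<sigma>\<close>-algebras generated by the initial matrix and by the whole
  Hermitian process are independent.
\<close>

definition matrix_model ::
  "'a measure \<Rightarrow> real measure \<Rightarrow> nat \<Rightarrow> (nat \<Rightarrow> 'a \<Rightarrow> real) \<Rightarrow>
   (nat \<times> nat \<Rightarrow> real \<Rightarrow> 'a \<Rightarrow> real) \<Rightarrow> (nat \<times> nat \<Rightarrow> real \<Rightarrow> 'a \<Rightarrow> real) \<Rightarrow> bool" where
  "matrix_model M \<mu> n d B B' \<longleftrightarrow>
     prob_space M \<and>
     prob_space.indep_vars M (\<lambda>_. borel) d {..<n} \<and>
     (\<forall>j<n. distr M borel (d j) = \<mu>) \<and>
     (\<forall>k l. k \<le> l \<longrightarrow> l < n \<longrightarrow> standard_brownian_motion M (B (k, l))) \<and>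
     (\<forall>k l. k < l \<longrightarrow> l < n \<longrightarrow> standard_brownian_motion M (B' (k, l))) \<and>
     prob_space.indep_vars M (\<lambda>_. PiM {0..} (\<lambda>_. borel))
       (\<lambda>i \<omega>. \<lambda>s\<in>{0..}. case_sum B B' i s \<omega>)
       ({(k, l). k \<le> l \<and> l < n} <+> {(k, l). k < l \<and> l < n}) \<and>
     prob_space.indep_set M
       (sets (vimage_algebra (space M)
         (\<lambda>\<omega>. \<lambda>kl\<in>{..<n} \<times> {..<n}. initial_matrix n d \<omega> $$ kl)
         (PiM ({..<n} \<times> {..<n}) (\<lambda>_. borel))))
       (sets (vimage_algebra (space M)
         (\<lambda>\<omega>. restrict (\<lambda>(kl, s). hermitian_process n B B' s \<omega> $$ kl) (({..<n} \<times> {..<n}) \<times> {0..}))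
         (PiM (({..<n} \<times> {..<n}) \<times> {0..}) (\<lambda>_. borel))))"

text \<open>\<^term>\<open>proots (char_poly A)\<close> is the multiset of eigenvalues of \<open>A\<close> with multiplicities.\<close>

definition spectral_cauchy_transform :: "complex mat \<Rightarrow> complex \<Rightarrow> complex" where
  "spectral_cauchy_transform A z =
     (\<Sum>a\<in>#proots (char_poly A). 1 / (z - a)) / of_nat (dim_row A)"

definition w_fp :: "real \<Rightarrow> complex mat \<Rightarrow> complex \<Rightarrow> complex" where
  "w_fp t A z = (THE w. Im w > Im z / 2 \<and>
     1 / of_real t * (w - z) = spectral_cauchy_transform A w)"

definition g_est :: "real \<Rightarrow> real \<Rightarrow> complex mat \<Rightarrow> real \<Rightarrow> real" where
  "g_est t \<gamma> A x = \<gamma> - Im (w_fp t A (Complex x \<gamma>))"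

definition estimator_fourier ::
  "real \<Rightarrow> real \<Rightarrow> (real \<Rightarrow> complex) \<Rightarrow> real \<Rightarrow> complex mat \<Rightarrow> real \<Rightarrow> complex" where
  "estimator_fourier t \<gamma> Kstar h A \<xi> =
     of_real (exp (\<gamma> * \<bar>\<xi>\<bar>)) * Kstar (h * \<xi>) * of_real (1 / (pi * t))
       * fourier (\<lambda>x. of_real (g_est t \<gamma> A x)) \<xi>"

definition variance_term ::
  "real \<Rightarrow> real \<Rightarrow> (real \<Rightarrow> real) \<Rightarrow> (real \<Rightarrow> complex) \<Rightarrow> real \<Rightarrow> complex mat \<Rightarrow> ennreal" where
  "variance_term t \<gamma> p\<^sub>0 Kstar h A =
     (\<integral>\<^sup>+\<xi>. ennreal ((cmod (estimator_fourier t \<gamma> Kstar h A \<xi>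
        - Kstar (h * \<xi>) * fourier (\<lambda>x. of_real (p\<^sub>0 x)) \<xi>))\<^sup>2) \<partial>lborel)"

end

theory Submission
  imports
    Defs
    "Jordan_Normal_Form.Schur_Decomposition"
    "HOL-Real_Asymp.Real_Asymp"
begin

text \<open>
  Write \<open>G\<close> for the Cauchy transform of \<open>\<mu>\<^sub>0\<close>, \<open>g(v)\<close> for the normalised trace of the resolvent
  \<open>(v - X)\<^sup>-\<^sup>1\<close> of the observed matrix \<open>X = A + H\<close> (\<open>A\<close> the initial matrix, \<open>H\<close> the noise), and put
  \<open>z = x + i\<gamma>\<close> and \<open>w = z + t G(z)\<close>. The point \<open>w\<close> is deterministic, and it is what the fixed point
  \<open>w\<^sub>f\<^sub>p(z)\<close> estimates. Since \<open>4 t < \<gamma>\<^sup>2\<close>, both points lie in \<open>Im v \<ge> \<gamma>/2\<close>, where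
  \<open>v \<mapsto> z + t g(v)\<close> is a contraction with constant \<open>4 t / \<gamma>\<^sup>2\<close>; hence \<open>|w\<^sub>f\<^sub>p - w|\<close> is at most a constant
  times \<open>|g(w) - G(z)|\<close>. So the problem is to compare \<open>g\<close> at the explicit point \<open>w\<close> with \<open>G\<close> at \<open>z\<close>; the
  limiting spectral measure, a free convolution, is hidden in the choice of \<open>w\<close>.

  Fourier side: \<open>- Im G(x + i\<gamma>)\<close> is \<open>p\<^sub>0\<close> convolved with the Cauchy kernel \<open>\<gamma>/(u\<^sup>2 + \<gamma>\<^sup>2)\<close>, whose transform is
  \<open>\<pi> exp(-\<gamma>|\<xi>|)\<close>. So the error of the estimator is the transform of \<open>Im (w - w\<^sub>f\<^sub>p)\<close> multiplied by
  \<open>exp(\<gamma>|\<xi>|) K\<^sup>\<star>(h\<xi>) / (\<pi> t)\<close>, which vanishes off \<open>|\<xi>| \<le> 1/h\<close>, and a Plancherel inequality on this band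
  gives the factor \<open>exp(2\<gamma>/h)\<close> and leaves \<open>\<integral> |g(w) - G(z)|\<^sup>2 dx\<close> (\<open>variance_term_le\<close>).

  Random matrix side: it remains to bound the expectation of that integral by a constant over \<open>n\<close>. Let
  \<open>R = (w - X)\<^sup>-\<^sup>1\<close>, \<open>Q = (z - A)\<^sup>-\<^sup>1\<close> and \<open>u = tr(QR)/n\<close>. The resolvent equation gives, for
  \<open>D = g(w) - G(z)\<close>,

    \<open>D = (tr Q / n - G(z)) + N + t D u\<close>   where   \<open>N = tr(QHR)/n - t g(w) u\<close>,

  and \<open>|t u| \<le> 1/2\<close>, so the last term is absorbed on the left. The first bracket is the centred average
  of \<open>n\<close> independent variables (\<open>iid_average_second_moment\<close>). In \<open>E|N|\<^sup>2\<close> one integrates by parts in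
  the Gaussian entries of the factor \<open>H\<close>: the derivative that falls on \<open>R\<close> cancels the subtracted term
  \<open>t g(w) u\<close>, and the derivative that falls on \<open>N\<close> itself leaves a quantity of order \<open>n\<^sup>-\<^sup>3\<close> times the squared
  Hilbert-Schmidt norm of \<open>R\<close> (\<open>noise_second_moment\<close>).

  Both contributions are integrable in \<open>x\<close> for the same reason: they are controlled by sums of Cauchy
  kernels. The squared Hilbert-Schmidt norm of \<open>R\<close> is the sum of \<open>1/|w - \<lambda>|\<^sup>2\<close> over the eigenvalues, at
  most four times the sum of \<open>1/|z - \<lambda>|\<^sup>2\<close>, and each summand has integral \<open>\<pi>/\<gamma>\<close> wherever \<open>\<lambda>\<close> lies. This
  works for every realisation of the matrix, and the sampling error is treated in the same way with
  \<open>\<mu>\<^sub>0\<close> in place of the eigenvalues.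
\<close>

section \<open>Fourier analysis on the line\<close>

lemma gaussian_characteristic:
  fixes s u :: real
  assumes "s > 0"
  shows "(\<integral>x. exp (\<i> * of_real (x * u)) \<partial>density lborel (normal_density 0 s)) = of_real (exp (- (s\<^sup>2 * u\<^sup>2) / 2))"
proof -
  have "(\<integral>x. exp (\<i> * of_real (x * u)) \<partial>density lborel (normal_density 0 s))
     = (\<integral>x. normal_density 0 s x *\<^sub>R exp (\<i> * of_real (x * u)) \<partial>lborel)"
    by (subst integral_density) auto
  also have "\<dots> = \<bar>s\<bar> *\<^sub>R (\<integral>x. normal_density 0 s (0 + s * x) *\<^sub>R exp (\<i> * of_real ((0 + s * x) * u)) \<partial>lborel)"
    by (rule lborel_integral_real_affine) (use assms in auto)
  also have "\<dots> = (\<integral>x. \<bar>s\<bar> *\<^sub>R (normal_density 0 s (0 + s * x) *\<^sub>R exp (\<i> * of_real ((0 + s * x) * u))) \<partial>lborel)"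
    by (rule integral_scaleR_right[symmetric])
  also have "\<dots> = (\<integral>x. std_normal_density x *\<^sub>R exp (\<i> * of_real ((s * u) * x)) \<partial>lborel)"
    by (rule Bochner_Integration.integral_cong)
      (use assms in \<open>auto simp: normal_density_def power_mult_distrib real_sqrt_mult mult_ac\<close>)
  also have "\<dots> = char std_normal_distribution (s * u)"
    unfolding char_def by (subst integral_density) auto
  also have "\<dots> = of_real (exp (- (s\<^sup>2 * u\<^sup>2) / 2))"
    by (simp add: char_std_normal_distribution power_mult_distrib)
  finally show ?thesis .
qed

lemma borel_measurable_cnj [measurable]: "cnj \<in> borel_measurable borel"
  by (intro borel_measurable_continuous_onI continuous_intros)

text \<open>
  Fubini's theorem in the form used for all Gaussian regularisations below: a probability measure on one
  side and an integrable function times a bounded kernel on the other.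
\<close>

lemma integral_swap_bounded_kernel:
  fixes f :: "real \<Rightarrow> complex" and k :: "real \<Rightarrow> real \<Rightarrow> complex"
  assumes N: "prob_space N" "sets N = sets borel"
    and f: "integrable lborel f"
    and k[measurable]: "case_prod k \<in> borel_measurable (borel \<Otimes>\<^sub>M borel)"
    and bound: "\<And>\<xi> x. cmod (k \<xi> x) \<le> C"
  shows "(\<integral>\<xi>. (\<integral>x. f x * k \<xi> x \<partial>lborel) \<partial>N) = (\<integral>x. f x * (\<integral>\<xi>. k \<xi> x \<partial>N) \<partial>lborel)"
proof -
  interpret N: prob_space N by fact
  interpret pair_sigma_finite N lborel ..
  note [measurable_cong] = N(2)
  have [measurable]: "f \<in> borel_measurable borel" using f by simp
  have C: "0 \<le> C" using bound[of 0 0] norm_ge_zero order_trans by blast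
  have int: "integrable (N \<Otimes>\<^sub>M lborel) (\<lambda>(\<xi>, x). f x * k \<xi> x)"
  proof (rule Fubini_integrable)
    show "(\<lambda>(\<xi>, x). f x * k \<xi> x) \<in> borel_measurable (N \<Otimes>\<^sub>M lborel)" by measurable
    have in1: "integrable lborel (\<lambda>x. f x * k \<xi> x)" for \<xi>
      by (rule Bochner_Integration.integrable_bound[OF integrable_mult_right[OF f, of "of_real C"]])
        (use bound C in \<open>auto simp: norm_mult mult.commute[of C] intro!: mult_left_mono\<close>)
    then show "AE \<xi> in N. integrable lborel (\<lambda>x. case (\<xi>, x) of (\<xi>, x) \<Rightarrow> f x * k \<xi> x)" by simp
    show "integrable N (\<lambda>\<xi>. \<integral>x. norm (case (\<xi>, x) of (\<xi>, x) \<Rightarrow> f x * k \<xi> x) \<partial>lborel)"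
    proof (rule N.integrable_const_bound[where B = "C * (\<integral>x. norm (f x) \<partial>lborel)"])
      have "(\<integral>x. norm (f x * k \<xi> x) \<partial>lborel) \<le> (\<integral>x. C * norm (f x) \<partial>lborel)" for \<xi>
        by (rule integral_mono)
          (use integrable_norm[OF in1] integrable_norm[OF f] bound in
            \<open>auto simp: norm_mult mult.commute[of C] intro!: mult_left_mono\<close>)
      then show "AE \<xi> in N. norm (\<integral>x. norm (case (\<xi>, x) of (\<xi>, x) \<Rightarrow> f x * k \<xi> x) \<partial>lborel) \<le> C * (\<integral>x. norm (f x) \<partial>lborel)"
        by (simp add: abs_of_nonneg)
    qed measurable
  qed
  have "(\<integral>\<xi>. (\<integral>x. f x * k \<xi> x \<partial>lborel) \<partial>N) = (\<integral>x. (\<integral>\<xi>. f x * k \<xi> x \<partial>N) \<partial>lborel)"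
    using Fubini_integral[OF int] by simp
  then show ?thesis by simp
qed

lemma integrable_fourier_integrand:
  assumes "integrable lborel f"
  shows "integrable lborel (\<lambda>x. f x * exp (\<i> * of_real (x * \<xi>)))"
  by (rule Bochner_Integration.integrable_bound[OF assms]) 
    (use borel_measurable_integrable[OF assms] in \<open>auto simp: norm_mult norm_exp_i_times\<close>)

lemma fourier_diff:
  assumes "integrable lborel f" "integrable lborel g"
  shows "fourier (\<lambda>x. f x - g x) \<xi> = fourier f \<xi> - fourier g \<xi>"
  unfolding fourier_def
  using integrable_fourier_integrand[OF assms(1)] integrable_fourier_integrand[OF assms(2)]
  by (simp add: left_diff_distrib)

lemma norm_fourier_le:
  assumes "integrable lborel f"
  shows "cmod (fourier f \<xi>) \<le> (\<integral>x. cmod (f x) \<partial>lborel)"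
proof -
  have "cmod (fourier f \<xi>) \<le> (\<integral>x. cmod (f x * exp (\<i> * of_real (x * \<xi>))) \<partial>lborel)"
    unfolding fourier_def by (rule integral_norm_bound)
  then show ?thesis by (simp add: norm_mult norm_exp_i_times)
qed

text \<open>
  Expanding the square and integrating the frequency out first turns the left-hand side into
  \<open>\<integral>\<integral> f(x) cnj (f(y)) exp(-s\<^sup>2 (x - y)\<^sup>2 / 2)\<close>; the bound is Schur's test,
  \<open>2 |f(x) f(y)| \<le> |f(x)|\<^sup>2 + |f(y)|\<^sup>2\<close>.
\<close>

lemma gaussian_weighted_energy:
  fixes f :: "real \<Rightarrow> complex"
  assumes s: "s > 0" and f: "integrable lborel f"
  shows "(\<integral>\<^sup>+\<xi>. ennreal ((cmod (fourier f \<xi>))\<^sup>2) \<partial>density lborel (normal_density 0 s))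
       \<le> ennreal (sqrt (2 * pi) / s) * (\<integral>\<^sup>+x. ennreal ((cmod (f x))\<^sup>2) \<partial>lborel)"
proof -
  let ?N = "density lborel (normal_density 0 s)"
  let ?F = "fourier f"
  have N: "prob_space ?N" using s by (rule prob_space_normal_density)
  interpret N: prob_space ?N by fact
  have sN: "sets ?N = sets borel" by simp
  have fm[measurable]: "f \<in> borel_measurable borel" using f by simp
  have Fm[measurable]: "?F \<in> borel_measurable borel" by (rule borel_measurable_fourier) fact
  define C where "C = (\<integral>x. cmod (f x) \<partial>lborel)"
  have FC: "cmod (?F \<xi>) \<le> C" for \<xi> unfolding C_def by (rule norm_fourier_le[OF f])
  have C0: "0 \<le> C" unfolding C_def by simp
  have cf: "integrable lborel (\<lambda>x. cnj (f x))" using f by simp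
  then have [measurable]: "(\<lambda>x. cnj (f x)) \<in> borel_measurable borel"
    using borel_measurable_integrable by fastforce
  define g :: "real \<Rightarrow> real" where "g v = exp (- (s\<^sup>2 * v\<^sup>2) / 2)" for v
  have gm[measurable]: "g \<in> borel_measurable borel" unfolding g_def by measurable
  have g0: "0 \<le> g v" for v by (simp add: g_def)
  have inner: "(\<integral>\<xi>. exp (\<i> * of_real (x * \<xi>)) * cnj (?F \<xi>) \<partial>?N) = (\<integral>y. cnj (f y) * of_real (g (x - y)) \<partial>lborel)" for x
  proof -
    have "(\<integral>\<xi>. exp (\<i> * of_real (x * \<xi>)) * cnj (?F \<xi>) \<partial>?N)
        = (\<integral>\<xi>. (\<integral>y. cnj (f y) * exp (\<i> * of_real (\<xi> * (x - y))) \<partial>lborel) \<partial>?N)"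
    proof (rule Bochner_Integration.integral_cong[OF refl])
      fix \<xi> :: real
      have "cnj (?F \<xi>) = (\<integral>y. cnj (f y * exp (\<i> * of_real (y * \<xi>))) \<partial>lborel)"
        unfolding fourier_def by (rule Bochner_Integration.integral_cnj[symmetric])
      also have "\<dots> = (\<integral>y. cnj (f y) * exp (- (\<i> * of_real (y * \<xi>))) \<partial>lborel)"
        by (simp only: complex_cnj_mult exp_cnj complex_cnj_i complex_cnj_complex_of_real mult_minus_left)
      finally have "cnj (?F \<xi>) = (\<integral>y. cnj (f y) * exp (- (\<i> * of_real (y * \<xi>))) \<partial>lborel)" .
      then have "exp (\<i> * of_real (x * \<xi>)) * cnj (?F \<xi>)
          = (\<integral>y. exp (\<i> * of_real (x * \<xi>)) * (cnj (f y) * exp (- (\<i> * of_real (y * \<xi>)))) \<partial>lborel)"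
        by (simp only: integral_mult_right_zero)
      also have "\<dots> = (\<integral>y. cnj (f y) * exp (\<i> * of_real (\<xi> * (x - y))) \<partial>lborel)"
      proof (rule Bochner_Integration.integral_cong[OF refl])
        fix y
        have "\<i> * of_real (\<xi> * (x - y)) = \<i> * of_real (x * \<xi>) + - (\<i> * complex_of_real (y * \<xi>))"
          by (simp add: algebra_simps)
        then show "exp (\<i> * of_real (x * \<xi>)) * (cnj (f y) * exp (- (\<i> * of_real (y * \<xi>))))
            = cnj (f y) * exp (\<i> * of_real (\<xi> * (x - y)))"
          by (simp only: exp_add mult_ac)
      qed
      finally show "exp (\<i> * of_real (x * \<xi>)) * cnj (?F \<xi>) = \<dots>" .
    qed
    also have "\<dots> = (\<integral>y. cnj (f y) * (\<integral>\<xi>. exp (\<i> * of_real (\<xi> * (x - y))) \<partial>?N) \<partial>lborel)"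
      by (rule integral_swap_bounded_kernel[OF N sN cf, where C = 1]) (simp_all add: norm_exp_i_times)
    also have "\<dots> = (\<integral>y. cnj (f y) * of_real (g (x - y)) \<partial>lborel)"
      by (simp only: gaussian_characteristic[OF s] g_def)
    finally show ?thesis .
  qed
  have cplx: "complex_of_real (\<integral>\<xi>. (cmod (?F \<xi>))\<^sup>2 \<partial>?N) = (\<integral>x. f x * (\<integral>y. cnj (f y) * of_real (g (x - y)) \<partial>lborel) \<partial>lborel)"
  proof -
    have "complex_of_real (\<integral>\<xi>. (cmod (?F \<xi>))\<^sup>2 \<partial>?N) = (\<integral>\<xi>. ?F \<xi> * cnj (?F \<xi>) \<partial>?N)"
      by (simp only: complex_norm_square[symmetric] integral_complex_of_real)
    also have "\<dots> = (\<integral>\<xi>. (\<integral>x. f x * (exp (\<i> * of_real (x * \<xi>)) * cnj (?F \<xi>)) \<partial>lborel) \<partial>?N)"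
      by (simp add: fourier_def flip: integral_mult_left_zero mult.assoc)
    also have "\<dots> = (\<integral>x. f x * (\<integral>\<xi>. exp (\<i> * of_real (x * \<xi>)) * cnj (?F \<xi>) \<partial>?N) \<partial>lborel)"
      by (rule integral_swap_bounded_kernel[OF N sN f, where C = C]) 
        (use FC in \<open>simp_all add: norm_mult norm_exp_i_times\<close>)
    finally show ?thesis by (simp only: inner)
  qed
  have gint: "(\<integral>\<^sup>+y. ennreal (g (x - y)) \<partial>lborel) = ennreal (sqrt (2 * pi) / s)"
     "(\<integral>\<^sup>+y. ennreal (g (y - x)) \<partial>lborel) = ennreal (sqrt (2 * pi) / s)" for x
  proof -
    have *: "ennreal (g (x - y)) = ennreal (sqrt (2 * pi) / s) * ennreal (normal_density x (1 / s) y)" for y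
      using s by (subst ennreal_mult[symmetric])
        (auto simp: g_def normal_density_def power_divide real_sqrt_divide real_sqrt_mult field_simps
           power2_commute)
    interpret P: prob_space "density lborel (normal_density x (1/s))"
      using s by (intro prob_space_normal_density) auto
    have "(\<integral>\<^sup>+y. ennreal (normal_density x (1 / s) y) \<partial>lborel) = 1"
      using P.emeasure_space_1 by (simp add: emeasure_density)
    then show "(\<integral>\<^sup>+y. ennreal (g (x - y)) \<partial>lborel) = ennreal (sqrt (2 * pi) / s)"
      unfolding * by (simp add: nn_integral_cmult)
    moreover have "g (y - x) = g (x - y)" for y by (simp add: g_def power2_commute)
    ultimately show "(\<integral>\<^sup>+y. ennreal (g (y - x)) \<partial>lborel) = ennreal (sqrt (2 * pi) / s)" by simp
  qed
  let ?I = "\<lambda>a. (\<integral>\<^sup>+x. ennreal ((cmod (f x))\<^sup>2) \<partial>lborel)"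
  have "(\<integral>\<^sup>+\<xi>. ennreal ((cmod (?F \<xi>))\<^sup>2) \<partial>?N) = ennreal (\<integral>\<xi>. (cmod (?F \<xi>))\<^sup>2 \<partial>?N)"
    by (rule nn_integral_eq_integral, rule N.integrable_const_bound[where B = "C\<^sup>2"])
      (use FC in \<open>auto intro!: power_mono\<close>)
  also have "\<dots> = ennreal (cmod (complex_of_real (\<integral>\<xi>. (cmod (?F \<xi>))\<^sup>2 \<partial>?N)))"
    by (simp add: abs_of_nonneg)
  also have "\<dots> \<le> (\<integral>\<^sup>+x. ennreal (cmod (f x * (\<integral>y. cnj (f y) * of_real (g (x - y)) \<partial>lborel))) \<partial>lborel)"
  proof (cases "integrable lborel (\<lambda>x. f x * (\<integral>y. cnj (f y) * of_real (g (x - y)) \<partial>lborel))")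
    case True
    then show ?thesis unfolding cplx by (rule integral_norm_bound_ennreal)
  next
    case False
    then show ?thesis unfolding cplx by (simp add: not_integrable_integral_eq)
  qed
  also have "\<dots> \<le> (\<integral>\<^sup>+x. (\<integral>\<^sup>+y. ennreal (cmod (f x) * cmod (f y) * g (x - y)) \<partial>lborel) \<partial>lborel)"
  proof (rule nn_integral_mono)
    fix x
    have int: "integrable lborel (\<lambda>y. cnj (f y) * of_real (g (x - y)))"
    proof (rule Bochner_Integration.integrable_bound[OF f])
      show "(\<lambda>y. cnj (f y) * of_real (g (x - y))) \<in> borel_measurable lborel" by measurable
    qed (auto simp: norm_mult g_def intro!: mult_left_le)
    have "ennreal (cmod (f x * (\<integral>y. cnj (f y) * of_real (g (x - y)) \<partial>lborel)))
       \<le> ennreal (cmod (f x)) * (\<integral>\<^sup>+y. ennreal (cmod (cnj (f y) * of_real (g (x - y)))) \<partial>lborel)"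
      by (simp only: norm_mult ennreal_mult'[OF norm_ge_zero])
        (intro mult_left_mono order_trans[OF integral_norm_bound_ennreal[OF int]], auto simp: norm_mult ennreal_mult')
    also have "\<dots> = (\<integral>\<^sup>+y. ennreal (cmod (f x) * cmod (f y) * g (x - y)) \<partial>lborel)"
      by (subst nn_integral_cmult[symmetric]) 
        (auto simp: norm_mult g0 ennreal_mult'[symmetric] mult.assoc)
    finally show "ennreal (cmod (f x * (\<integral>y. cnj (f y) * of_real (g (x - y)) \<partial>lborel))) \<le> \<dots>" .
  qed
  also have "\<dots> \<le> (\<integral>\<^sup>+x. (\<integral>\<^sup>+y. ennreal (1/2) * (ennreal ((cmod (f x))\<^sup>2) * ennreal (g (x - y)))
        + ennreal (1/2) * (ennreal ((cmod (f y))\<^sup>2) * ennreal (g (x - y))) \<partial>lborel) \<partial>lborel)"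
  proof (intro nn_integral_mono)
    fix x y
    have "2 * (cmod (f x) * cmod (f y)) \<le> (cmod (f x))\<^sup>2 + (cmod (f y))\<^sup>2"
      using sum_squares_bound[of "cmod (f x)" "cmod (f y)"] by simp
    then have "cmod (f x) * cmod (f y) * g (x - y) \<le> ((cmod (f x))\<^sup>2 + (cmod (f y))\<^sup>2) / 2 * g (x - y)"
      by (intro mult_right_mono) (auto simp: g0)
    then have "ennreal (cmod (f x) * cmod (f y) * g (x - y)) \<le> ennreal (1/2 * ((cmod (f x))\<^sup>2 * g (x - y)) + 1/2 * ((cmod (f y))\<^sup>2 * g (x - y)))"
      by (intro ennreal_leI) (simp add: field_simps)
    also have "\<dots> = ennreal (1/2) * (ennreal ((cmod (f x))\<^sup>2) * ennreal (g (x - y)))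
        + ennreal (1/2) * (ennreal ((cmod (f y))\<^sup>2) * ennreal (g (x - y)))"
      by (subst ennreal_plus) (auto simp: g0 ennreal_mult'[symmetric] simp del: ennreal_half)
    finally show "ennreal (cmod (f x) * cmod (f y) * g (x - y)) \<le> \<dots>" .
  qed
  also have "\<dots> = (\<integral>\<^sup>+x. (\<integral>\<^sup>+y. ennreal (1/2) * (ennreal ((cmod (f x))\<^sup>2) * ennreal (g (x - y))) \<partial>lborel) \<partial>lborel)
      + (\<integral>\<^sup>+x. (\<integral>\<^sup>+y. ennreal (1/2) * (ennreal ((cmod (f y))\<^sup>2) * ennreal (g (x - y))) \<partial>lborel) \<partial>lborel)"
    by (subst nn_integral_add[symmetric])
      (auto intro!: nn_integral_cong nn_integral_add lborel.borel_measurable_nn_integral)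
  also have "(\<integral>\<^sup>+x. (\<integral>\<^sup>+y. ennreal (1/2) * (ennreal ((cmod (f y))\<^sup>2) * ennreal (g (x - y))) \<partial>lborel) \<partial>lborel)
      = (\<integral>\<^sup>+y. (\<integral>\<^sup>+x. ennreal (1/2) * (ennreal ((cmod (f y))\<^sup>2) * ennreal (g (x - y))) \<partial>lborel) \<partial>lborel)"
    by (rule lborel_pair.Fubini') measurable
  also have "(\<integral>\<^sup>+y. (\<integral>\<^sup>+x. ennreal (1/2) * (ennreal ((cmod (f y))\<^sup>2) * ennreal (g (x - y))) \<partial>lborel) \<partial>lborel)
     = (ennreal (1/2) * ennreal (sqrt (2 * pi) / s)) * (\<integral>\<^sup>+x. ennreal ((cmod (f x))\<^sup>2) \<partial>lborel)"
    by (simp add: nn_integral_cmult nn_integral_multc gint del: ennreal_half) (simp only: mult_ac)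
  also have "(\<integral>\<^sup>+x. (\<integral>\<^sup>+y. ennreal (1/2) * (ennreal ((cmod (f x))\<^sup>2) * ennreal (g (x - y))) \<partial>lborel) \<partial>lborel)
     = (ennreal (1/2) * ennreal (sqrt (2 * pi) / s)) * (\<integral>\<^sup>+x. ennreal ((cmod (f x))\<^sup>2) \<partial>lborel)"
    by (simp add: nn_integral_cmult nn_integral_multc gint del: ennreal_half) (simp only: mult_ac)
  also have "ennreal (1/2) * ennreal (sqrt (2 * pi) / s) * (\<integral>\<^sup>+x. ennreal ((cmod (f x))\<^sup>2) \<partial>lborel) 
     + ennreal (1/2) * ennreal (sqrt (2 * pi) / s) * (\<integral>\<^sup>+x. ennreal ((cmod (f x))\<^sup>2) \<partial>lborel)
     = ennreal (sqrt (2 * pi) / s) * (\<integral>\<^sup>+x. ennreal ((cmod (f x))\<^sup>2) \<partial>lborel)"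
    by (subst distrib_right[symmetric], subst distrib_right[symmetric], subst ennreal_plus[symmetric])
      auto
  finally show ?thesis .
qed

text \<open>
  On the band \<open>[-s, s]\<close> the indicator is dominated by a multiple of the centred Gaussian density of standard
  deviation \<open>s\<close>. The single regularisation at this scale replaces the usual limit, at the price of a factor
  \<open>exp(1/2)\<close> over Plancherel's constant \<open>2\<pi>\<close>.
\<close>

lemma band_limited_plancherel:
  fixes f :: "real \<Rightarrow> complex"
  assumes s: "s > 0" and f: "integrable lborel f"
  shows "(\<integral>\<^sup>+\<xi>. indicator {-s..s} \<xi> * ennreal ((cmod (fourier f \<xi>))\<^sup>2) \<partial>lborel)
       \<le> ennreal (2 * pi * exp (1/2)) * (\<integral>\<^sup>+x. ennreal ((cmod (f x))\<^sup>2) \<partial>lborel)"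
proof -
  have [measurable]: "f \<in> borel_measurable borel" using f by simp
  have [measurable]: "fourier f \<in> borel_measurable borel" by (rule borel_measurable_fourier) fact
  define c where "c = s * sqrt (2 * pi) * exp (1/2)"
  have c0: "0 \<le> c" using s by (simp add: c_def)
  have ind: "indicator {-s..s} \<xi> \<le> ennreal c * ennreal (normal_density 0 s \<xi>)" for \<xi>
  proof (cases "\<xi> \<in> {-s..s}")
    case True
    then have "\<xi>\<^sup>2 \<le> s\<^sup>2" by (auto simp: abs_le_square_iff[symmetric])
    then have "\<xi>\<^sup>2 / (2 * s\<^sup>2) \<le> 1/2" using s by (simp add: field_simps)
    then have "1 \<le> exp (1/2 - \<xi>\<^sup>2 / (2 * s\<^sup>2))" by simp
    also have "\<dots> = c * normal_density 0 s \<xi>"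
      using s by (simp add: c_def normal_density_def real_sqrt_mult exp_add[symmetric])
    finally show ?thesis using True c0 by (simp add: ennreal_mult'[symmetric])
  qed simp
  have "(\<integral>\<^sup>+\<xi>. indicator {-s..s} \<xi> * ennreal ((cmod (fourier f \<xi>))\<^sup>2) \<partial>lborel)
      \<le> (\<integral>\<^sup>+\<xi>. ennreal c * (ennreal (normal_density 0 s \<xi>) * ennreal ((cmod (fourier f \<xi>))\<^sup>2)) \<partial>lborel)"
    by (intro nn_integral_mono) (use ind in \<open>auto simp: mult.assoc[symmetric] intro!: mult_right_mono\<close>)
  also have "\<dots> = ennreal c * (\<integral>\<^sup>+\<xi>. ennreal ((cmod (fourier f \<xi>))\<^sup>2) \<partial>density lborel (normal_density 0 s))"
    by (subst nn_integral_cmult) (auto simp: nn_integral_density)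
  also have "\<dots> \<le> ennreal c * (ennreal (sqrt (2 * pi) / s) * (\<integral>\<^sup>+x. ennreal ((cmod (f x))\<^sup>2) \<partial>lborel))"
    by (intro mult_left_mono gaussian_weighted_energy s f) auto
  also have "ennreal c * (ennreal (sqrt (2 * pi) / s) * (\<integral>\<^sup>+x. ennreal ((cmod (f x))\<^sup>2) \<partial>lborel))
     = ennreal (2 * pi * exp (1/2)) * (\<integral>\<^sup>+x. ennreal ((cmod (f x))\<^sup>2) \<partial>lborel)"
  proof -
    have "c * (sqrt (2 * pi) / s) = (sqrt (2 * pi) * sqrt (2 * pi)) * exp (1/2)"
      using s by (simp add: c_def)
    also have "\<dots> = 2 * pi * exp (1/2)" by simp
    finally show ?thesis using c0 by (subst mult.assoc[symmetric], subst ennreal_mult'[symmetric]) auto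
  qed
  finally show ?thesis .
qed

lemma exponential_half_line:
  fixes c :: complex
  assumes c: "Re c > 0"
  shows "has_bochner_integral lborel (\<lambda>x. indicator {0<..} x *\<^sub>R exp (- c * of_real x)) (1 / c)"
proof -
  have c0: "c \<noteq> 0" using c by auto
  have int: "set_integrable lborel {0<..} (\<lambda>x. exp (- c * of_real x))"
    using integrable_I0i_exp_mscale[OF c] unfolding set_integrable_def
    by (rule Bochner_Integration.integrable_bound) (auto simp: norm_exp_eq_Re mult_ac)
  have "(LBINT x=0..\<infinity>. exp (- c * of_real x)) = 0 - (- (1 / c))"
  proof (rule interval_integral_FTC_integrable[where F = "\<lambda>x. - exp (- c * of_real x) / c"])
    show "((\<lambda>x. - exp (- c * of_real x) / c) has_vector_derivative exp (- c * of_real x)) (at x)" for x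
      by (rule has_vector_derivative_real_field[where f = "\<lambda>z. - exp (- c * z) / c"]) (use c0 in \<open>auto intro!: derivative_eq_intros\<close>)
    show "isCont (\<lambda>x. exp (- c * of_real x)) x" for x by (intro continuous_intros)
    show "set_integrable lborel (einterval 0 \<infinity>) (\<lambda>x. exp (- c * of_real x))"
      using int by (simp add: zero_ereal_def)
    have "isCont (\<lambda>x. - exp (- c * of_real x) / c) 0" using c0 by (intro continuous_intros) auto
    then have "((\<lambda>x::real. - exp (- c * of_real x) / c) \<longlongrightarrow> - (1 / c)) (at_right 0)"
      by (simp add: isCont_def filterlim_at_split)
    then show "(((\<lambda>x. - exp (- c * of_real x) / c) \<circ> real_of_ereal) \<longlongrightarrow> - (1 / c)) (at_right 0)"
      unfolding zero_ereal_def by (subst ereal_tendsto_simps) (simp add: zero_ereal_def)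
    have "((\<lambda>x. exp (- (Re c * x))) \<longlongrightarrow> 0) at_top" using c by real_asymp
    then have "((\<lambda>x::real. norm (exp (- c * of_real x))) \<longlongrightarrow> 0) at_top"
      by (simp add: norm_exp_eq_Re)
    then have "((\<lambda>x::real. exp (- c * of_real x)) \<longlongrightarrow> 0) at_top"
      by (rule tendsto_norm_zero_cancel)
    then have "((\<lambda>x::real. - exp (- c * of_real x) / c) \<longlongrightarrow> - 0 / c) at_top"
      using c0 by (intro tendsto_divide tendsto_minus tendsto_const) auto
    then show "(((\<lambda>x. - exp (- c * of_real x) / c) \<circ> real_of_ereal) \<longlongrightarrow> 0) (at_left \<infinity>)"
      by (subst ereal_tendsto_simps) simp
  qed simp
  then have "(LBINT x:{0<..}. exp (- c * of_real x)) = 1 / c"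
    by (simp add: interval_lebesgue_integral_0_infty)
  then show ?thesis
    using int by (simp add: has_bochner_integral_iff set_integrable_def set_lebesgue_integral_def)
qed

text \<open>
  Two half-line exponential integrals, one of them reflected; they agree with the integrand except at the
  single point \<open>0\<close>.
\<close>

lemma fourier_laplace_density:
  fixes \<gamma> u :: real
  assumes g: "\<gamma> > 0"
  shows "has_bochner_integral lborel (\<lambda>x. complex_of_real (exp (- \<gamma> * \<bar>x\<bar>)) * exp (\<i> * of_real (x * u)))
     (of_real (2 * (\<gamma> / (u\<^sup>2 + \<gamma>\<^sup>2))))"
proof -
  define f where "f c x = indicator {0<..} x *\<^sub>R exp (- c * complex_of_real x)" for c x
  let ?a = "Complex \<gamma> (- u)" and ?b = "Complex \<gamma> u"
  have 1: "has_bochner_integral lborel (f ?a) (1 / ?a)"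
    unfolding f_def by (rule exponential_half_line) (use g in simp)
  have "has_bochner_integral lborel (f ?b) (1 / ?b)"
    unfolding f_def by (rule exponential_half_line) (use g in simp)
  then have "has_bochner_integral lborel (\<lambda>x. f ?b (0 + (-1) * x)) ((1 / ?b) /\<^sub>R \<bar>-1\<bar>)"
    by (subst lborel_has_bochner_integral_real_affine_iff[symmetric]) simp_all
  then have "has_bochner_integral lborel (\<lambda>x. f ?a x + f ?b (0 + (-1) * x)) (1 / ?a + (1 / ?b) /\<^sub>R \<bar>-1\<bar>)"
    by (rule has_bochner_integral_add[OF 1])
  moreover have "1 / ?a + (1 / ?b) /\<^sub>R \<bar>-1\<bar> = of_real (2 * (\<gamma> / (u\<^sup>2 + \<gamma>\<^sup>2)))"
    using g by (simp add: complex_eq_iff Re_divide Im_divide power2_eq_square add.commute field_simps)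
  moreover have "AE x in lborel. f ?a x + f ?b (0 + (-1) * x)
      = complex_of_real (exp (- \<gamma> * \<bar>x\<bar>)) * exp (\<i> * of_real (x * u))"
  proof -
    have e: "complex_of_real (exp r) * exp (\<i> * of_real q) = exp (Complex r q)" for r q
      by (simp add: exp_of_real[symmetric] exp_add[symmetric] Complex_eq)
    have "f ?a x + f ?b (0 + (-1) * x) = complex_of_real (exp (- \<gamma> * \<bar>x\<bar>)) * exp (\<i> * of_real (x * u))" if "x \<noteq> 0" for x
    proof -
      have "- (Complex \<gamma> (- u) * complex_of_real x) = Complex (- (\<gamma> * x)) (x * u)"
        "Complex \<gamma> u * complex_of_real x = Complex (\<gamma> * x) (x * u)"
        by (simp_all add: complex_eq_iff)
      then show ?thesis using that unfolding e f_def by (cases "x > 0") simp_all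
    qed
    then show ?thesis
      using AE_lborel_singleton[of 0] by auto
  qed
  ultimately show ?thesis
    by (subst has_bochner_integral_cong_AE[symmetric]) (auto simp: f_def)
qed

lemma cauchy_kernel_integrable:
  fixes \<gamma> :: real
  assumes g: "\<gamma> > 0"
  shows "integrable lborel (\<lambda>u. \<gamma> / ((u - y)\<^sup>2 + \<gamma>\<^sup>2))"
    and "(\<integral>u. \<gamma> / ((u - y)\<^sup>2 + \<gamma>\<^sup>2) \<partial>lborel) = pi"
proof -
  have "has_bochner_integral lborel (\<lambda>u::real. inverse (1 + u\<^sup>2)) pi"
    using integrable_inverse_1_plus_square LBINT_inverse_1_plus_square
    by (simp add: has_bochner_integral_iff set_integrable_def set_lebesgue_integral_def interval_lebesgue_integral_def)
  then have "has_bochner_integral lborel (\<lambda>u. inverse (1 + (- (y / \<gamma>) + (1 / \<gamma>) * u)\<^sup>2)) (pi /\<^sub>R \<bar>1 / \<gamma>\<bar>)"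
    using g by (subst lborel_has_bochner_integral_real_affine_iff[symmetric]) simp_all
  then have "has_bochner_integral lborel (\<lambda>u. (1 / \<gamma>) * inverse (1 + (- (y / \<gamma>) + (1 / \<gamma>) * u)\<^sup>2)) ((1 / \<gamma>) * (pi /\<^sub>R \<bar>1 / \<gamma>\<bar>))"
    using g by (intro has_bochner_integral_mult_right) auto
  moreover have "(1 / \<gamma>) * inverse (1 + (- (y / \<gamma>) + (1 / \<gamma>) * u)\<^sup>2) = \<gamma> / ((u - y)\<^sup>2 + \<gamma>\<^sup>2)" for u
  proof -
    have "1 + (- (y / \<gamma>) + (1 / \<gamma>) * u)\<^sup>2 = ((u - y)\<^sup>2 + \<gamma>\<^sup>2) / \<gamma>\<^sup>2"
      using g by (simp add: power2_eq_square field_simps)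
    then show ?thesis using g by (simp add: power2_eq_square)
  qed
  ultimately have "has_bochner_integral lborel (\<lambda>u. \<gamma> / ((u - y)\<^sup>2 + \<gamma>\<^sup>2)) pi"
    using g by simp
  then show "integrable lborel (\<lambda>u. \<gamma> / ((u - y)\<^sup>2 + \<gamma>\<^sup>2))" "(\<integral>u. \<gamma> / ((u - y)\<^sup>2 + \<gamma>\<^sup>2) \<partial>lborel) = pi"
    by (auto simp: has_bochner_integral_iff)
qed

text \<open>
  Fourier inversion for the Laplace density, done by hand: damp the integral by a Gaussian of width \<open>1/s\<close>,
  insert the Laplace integral for the Cauchy kernel, exchange the integrals, and let \<open>s\<close> tend to \<open>0\<close> on
  both sides.
\<close>

lemma fourier_cauchy_kernel:
  fixes \<gamma> \<xi> :: real
  assumes g: "\<gamma> > 0"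
  shows "fourier (\<lambda>u. of_real (\<gamma> / (u\<^sup>2 + \<gamma>\<^sup>2))) \<xi> = of_real (pi * exp (- \<gamma> * \<bar>\<xi>\<bar>))"
proof -
  define c where "c u = \<gamma> / (u\<^sup>2 + \<gamma>\<^sup>2)" for u
  define s where "s k = 1 / (real k + 1)" for k
  have s0: "s k > 0" for k by (simp add: s_def)
  have slim: "s \<longlonglongrightarrow> 0" unfolding s_def by real_asymp
  have ci: "integrable lborel c" using cauchy_kernel_integrable(1)[OF g, of 0] by (simp add: c_def[abs_def])
  then have [measurable]: "c \<in> borel_measurable borel" by simp
  have c0: "0 \<le> c u" for u using g by (simp add: c_def)
  define A where "A k = (\<integral>u. 2 * (of_real (c u) * exp (\<i> * of_real (u * \<xi>))) * of_real (exp (- ((s k)\<^sup>2 * u\<^sup>2) / 2)) \<partial>lborel)" for k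
  have lim1: "A \<longlonglongrightarrow> (\<integral>u. 2 * (of_real (c u) * exp (\<i> * of_real (u * \<xi>))) \<partial>lborel)"
    unfolding A_def
  proof (rule integral_dominated_convergence[where w = "\<lambda>u. 2 * c u"])
    have "(\<lambda>k. complex_of_real (exp (- ((s k)\<^sup>2 * u\<^sup>2) / 2))) \<longlonglongrightarrow> of_real (exp (- (0\<^sup>2 * u\<^sup>2) / 2))" for u
      by (intro tendsto_intros slim) auto
    then show "AE u in lborel. (\<lambda>k. 2 * (of_real (c u) * exp (\<i> * of_real (u * \<xi>))) * of_real (exp (- ((s k)\<^sup>2 * u\<^sup>2) / 2)))
       \<longlonglongrightarrow> 2 * (of_real (c u) * exp (\<i> * of_real (u * \<xi>)))"
      using tendsto_mult[OF tendsto_const] by (intro AE_I2) fastforce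
    show "AE u in lborel. cmod (2 * (of_real (c u) * exp (\<i> * of_real (u * \<xi>))) * of_real (exp (- ((s k)\<^sup>2 * u\<^sup>2) / 2))) \<le> 2 * c u" for k
      by (intro AE_I2) (auto simp: norm_mult norm_exp_i_times c0 intro!: mult_left_le)
  qed (use ci in auto)
  have A: "A k = (\<integral>v. std_normal_density v *\<^sub>R complex_of_real (2 * pi * exp (- \<gamma> * \<bar>- \<xi> + s k * v\<bar>)) \<partial>lborel)" for k
  proof -
    let ?N = "density lborel (normal_density 0 (1 / s k))"
    have N: "prob_space ?N" using s0[of k] by (intro prob_space_normal_density) auto
    have L: "integrable lborel (\<lambda>x. complex_of_real (exp (- \<gamma> * \<bar>x\<bar>)))"
      using fourier_laplace_density[OF g, of 0] by (simp add: has_bochner_integral_iff)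
    have "A k = (\<integral>u. normal_density 0 (1 / s k) u *\<^sub>R (of_real (sqrt (2 * pi) / s k) *
        ((\<integral>x. of_real (exp (- \<gamma> * \<bar>x\<bar>)) * exp (\<i> * of_real (x * u)) \<partial>lborel) * exp (\<i> * of_real (u * \<xi>)))) \<partial>lborel)"
      unfolding A_def
    proof (rule Bochner_Integration.integral_cong[OF refl])
      fix u
      have e: "exp (- ((s k)\<^sup>2 * u\<^sup>2) / 2) = normal_density 0 (1 / s k) u * (sqrt (2 * pi) / s k)"
        using s0[of k] by (simp add: normal_density_def power_divide real_sqrt_divide real_sqrt_mult field_simps)
      show "2 * (of_real (c u) * exp (\<i> * of_real (u * \<xi>))) * of_real (exp (- ((s k)\<^sup>2 * u\<^sup>2) / 2)) =
        normal_density 0 (1 / s k) u *\<^sub>R (of_real (sqrt (2 * pi) / s k) *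
        ((\<integral>x. of_real (exp (- \<gamma> * \<bar>x\<bar>)) * exp (\<i> * of_real (x * u)) \<partial>lborel) * exp (\<i> * of_real (u * \<xi>))))"
        unfolding e has_bochner_integral_integral_eq[OF fourier_laplace_density[OF g]]
        by (simp only: c_def scaleR_conv_of_real of_real_mult of_real_numeral mult_ac)
    qed
    also have "\<dots> = (\<integral>u. of_real (sqrt (2 * pi) / s k) *
        ((\<integral>x. of_real (exp (- \<gamma> * \<bar>x\<bar>)) * exp (\<i> * of_real (x * u)) \<partial>lborel) * exp (\<i> * of_real (u * \<xi>))) \<partial>?N)"
      by (rule integral_density[symmetric]) auto
    also have "\<dots> = of_real (sqrt (2 * pi) / s k) * (\<integral>u. (\<integral>x. of_real (exp (- \<gamma> * \<bar>x\<bar>)) * exp (\<i> * of_real (u * (x + \<xi>))) \<partial>lborel) \<partial>?N)"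
      by (subst integral_mult_right_zero, subst integral_mult_left_zero[symmetric])
         (simp add: ring_distribs exp_add mult_ac)
    also have "(\<integral>u. (\<integral>x. of_real (exp (- \<gamma> * \<bar>x\<bar>)) * exp (\<i> * of_real (u * (x + \<xi>))) \<partial>lborel) \<partial>?N)
       = (\<integral>x. of_real (exp (- \<gamma> * \<bar>x\<bar>)) * (\<integral>u. exp (\<i> * of_real (u * (x + \<xi>))) \<partial>?N) \<partial>lborel)"
      by (rule integral_swap_bounded_kernel[OF N _ L, where C = 1]) (simp_all add: norm_exp_i_times)
    also have "\<dots> = (\<integral>x. of_real (exp (- \<gamma> * \<bar>x\<bar>)) * of_real (exp (- ((1 / s k)\<^sup>2 * (x + \<xi>)\<^sup>2) / 2)) \<partial>lborel)"
      by (subst gaussian_characteristic) (use s0[of k] in auto)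
    also have "of_real (sqrt (2 * pi) / s k) * \<dots> 
       = (\<integral>x. of_real (sqrt (2 * pi) / s k) * (of_real (exp (- \<gamma> * \<bar>x\<bar>)) * of_real (exp (- ((1 / s k)\<^sup>2 * (x + \<xi>)\<^sup>2) / 2))) \<partial>lborel)"
      by (rule integral_mult_right_zero[symmetric])
    also have "\<dots> = \<bar>s k\<bar> *\<^sub>R (\<integral>v. of_real (sqrt (2 * pi) / s k) * (of_real (exp (- \<gamma> * \<bar>- \<xi> + s k * v\<bar>)) *
         of_real (exp (- ((1 / s k)\<^sup>2 * ((- \<xi> + s k * v) + \<xi>)\<^sup>2) / 2))) \<partial>lborel)"
      by (rule lborel_integral_real_affine) (use s0[of k] in auto)
    also have "\<dots> = (\<integral>v. \<bar>s k\<bar> *\<^sub>R (of_real (sqrt (2 * pi) / s k) * (of_real (exp (- \<gamma> * \<bar>- \<xi> + s k * v\<bar>)) *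
         of_real (exp (- ((1 / s k)\<^sup>2 * ((- \<xi> + s k * v) + \<xi>)\<^sup>2) / 2)))) \<partial>lborel)"
      by (rule integral_scaleR_right[symmetric])
    also have "\<dots> = (\<integral>v. std_normal_density v *\<^sub>R complex_of_real (2 * pi * exp (- \<gamma> * \<bar>- \<xi> + s k * v\<bar>)) \<partial>lborel)"
    proof (rule Bochner_Integration.integral_cong[OF refl])
      fix v
      have "sqrt (2 * pi) * exp (- (v\<^sup>2) / 2) = std_normal_density v * (sqrt (2 * pi) * sqrt (2 * pi))"
        by (simp add: std_normal_density_def del: real_sqrt_mult_self)
      then have *: "sqrt (2 * pi) * exp (- (v\<^sup>2) / 2) = std_normal_density v * (2 * pi)" by simp
      have "\<bar>s k\<bar> *\<^sub>R (of_real (sqrt (2 * pi) / s k) * (of_real (exp (- \<gamma> * \<bar>- \<xi> + s k * v\<bar>)) *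
         of_real (exp (- ((1 / s k)\<^sup>2 * ((- \<xi> + s k * v) + \<xi>)\<^sup>2) / 2))))
         = complex_of_real ((sqrt (2 * pi) * exp (- (v\<^sup>2) / 2)) * exp (- \<gamma> * \<bar>- \<xi> + s k * v\<bar>))"
        using s0[of k] by (simp add: scaleR_conv_of_real power_mult_distrib power_divide)
      also have "\<dots> = std_normal_density v *\<^sub>R complex_of_real (2 * pi * exp (- \<gamma> * \<bar>- \<xi> + s k * v\<bar>))"
        unfolding * by (simp add: scaleR_conv_of_real)
      finally show "\<bar>s k\<bar> *\<^sub>R (of_real (sqrt (2 * pi) / s k) * (of_real (exp (- \<gamma> * \<bar>- \<xi> + s k * v\<bar>)) *
         of_real (exp (- ((1 / s k)\<^sup>2 * ((- \<xi> + s k * v) + \<xi>)\<^sup>2) / 2)))) = \<dots>" .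
    qed
    finally show ?thesis .
  qed
  have lim2: "A \<longlonglongrightarrow> (\<integral>v. std_normal_density v *\<^sub>R complex_of_real (2 * pi * exp (- \<gamma> * \<bar>- \<xi> + 0 * v\<bar>)) \<partial>lborel)"
    unfolding A
  proof (rule integral_dominated_convergence[where w = "\<lambda>v. std_normal_density v * (2 * pi)"])
    show "AE v in lborel. (\<lambda>k. std_normal_density v *\<^sub>R complex_of_real (2 * pi * exp (- \<gamma> * \<bar>- \<xi> + s k * v\<bar>)))
       \<longlonglongrightarrow> std_normal_density v *\<^sub>R complex_of_real (2 * pi * exp (- \<gamma> * \<bar>- \<xi> + 0 * v\<bar>))"
      by (intro AE_I2 tendsto_intros slim)
    show "AE v in lborel. norm (std_normal_density v *\<^sub>R complex_of_real (2 * pi * exp (- \<gamma> * \<bar>- \<xi> + s k * v\<bar>))) \<le> std_normal_density v * (2 * pi)" for k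
      using g by (intro AE_I2) (auto simp: norm_mult std_normal_density_def intro!: divide_right_mono mult_left_mono mult_left_le)
  qed (auto intro: integrable_mult_left)
  have "2 * fourier (\<lambda>u. of_real (c u)) \<xi> = (\<integral>u. 2 * (of_real (c u) * exp (\<i> * of_real (u * \<xi>))) \<partial>lborel)"
    unfolding fourier_def by (rule integral_mult_right_zero[symmetric])
  also have "\<dots> = complex_of_real (2 * pi * exp (- \<gamma> * \<bar>\<xi>\<bar>))"
    using LIMSEQ_unique[OF lim1 lim2] by simp
  finally show ?thesis by (simp add: c_def)
qed

text \<open>
  The convolution theorem for the Cauchy kernel. The factor \<open>exp(-\<gamma>|\<xi>|)\<close> is what the estimator
  compensates by \<open>exp(\<gamma>|\<xi>|)\<close>.
\<close>

lemma fourier_poisson_smoothing: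
  fixes p :: "real \<Rightarrow> real"
  assumes g: "\<gamma> > 0" and p: "integrable lborel p"
  shows "integrable lborel (\<lambda>x. \<integral>y. \<gamma> / ((x - y)\<^sup>2 + \<gamma>\<^sup>2) * p y \<partial>lborel)"
    and "fourier (\<lambda>x. of_real (\<integral>y. \<gamma> / ((x - y)\<^sup>2 + \<gamma>\<^sup>2) * p y \<partial>lborel)) \<xi>
        = of_real (pi * exp (- \<gamma> * \<bar>\<xi>\<bar>)) * fourier (\<lambda>x. of_real (p x)) \<xi>"
proof -
  let ?c = "\<lambda>x y. \<gamma> / ((x - y)\<^sup>2 + \<gamma>\<^sup>2)"
  have c0: "0 \<le> ?c x y" for x y using g by simp
  have [measurable]: "p \<in> borel_measurable borel" using p by simp
  have int: "integrable (lborel \<Otimes>\<^sub>M lborel) (\<lambda>(y, x). complex_of_real (?c x y * p y) * exp (\<i> * of_real (x * \<eta>)))" for \<eta>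
  proof (rule lborel_pair.Fubini_integrable)
    show "(\<lambda>(y, x). complex_of_real (?c x y * p y) * exp (\<i> * of_real (x * \<eta>))) \<in> borel_measurable (lborel \<Otimes>\<^sub>M lborel)"
      by measurable
    have "norm (complex_of_real (?c x y * p y) * exp (\<i> * of_real (x * \<eta>))) = ?c x y * \<bar>p y\<bar>" for x y
      by (simp only: norm_mult norm_of_real norm_exp_i_times abs_mult abs_of_nonneg[OF c0] mult_1_right)
    then have "(\<integral>x. norm (complex_of_real (?c x y * p y) * exp (\<i> * of_real (x * \<eta>))) \<partial>lborel) = pi * \<bar>p y\<bar>" for y
      by (simp only: integral_mult_left_zero cauchy_kernel_integrable(2)[OF g, of y])
    then show "integrable lborel (\<lambda>y. \<integral>x. norm (case (y, x) of (y, x) \<Rightarrow> complex_of_real (?c x y * p y) * exp (\<i> * of_real (x * \<eta>))) \<partial>lborel)"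
      using p by simp
    have "integrable lborel (\<lambda>x. complex_of_real (?c x y * p y))" for y
      using cauchy_kernel_integrable(1)[OF g, of y] by (intro integrable_of_real integrable_mult_left) auto
    from integrable_fourier_integrand[OF this]
    show "AE y in lborel. integrable lborel (\<lambda>x. case (y, x) of (y, x) \<Rightarrow> complex_of_real (?c x y * p y) * exp (\<i> * of_real (x * \<eta>)))"
      by simp
  qed
  have "integrable lborel (\<lambda>x. \<integral>y. complex_of_real (?c x y * p y) * exp (\<i> * of_real (x * 0)) \<partial>lborel)"
    by (rule lborel_pair.integrable_snd[OF int])
  then have "integrable lborel (\<lambda>x. complex_of_real (\<integral>y. ?c x y * p y \<partial>lborel))"
    by (simp del: of_real_mult of_real_divide)
  then show "integrable lborel (\<lambda>x. \<integral>y. ?c x y * p y \<partial>lborel)"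
    by (simp only: complex_of_real_integrable_eq)
  have "fourier (\<lambda>x. of_real (\<integral>y. ?c x y * p y \<partial>lborel)) \<xi> = (\<integral>x. (\<integral>y. complex_of_real (?c x y * p y) * exp (\<i> * of_real (x * \<xi>)) \<partial>lborel) \<partial>lborel)"
    unfolding fourier_def integral_mult_left_zero by (simp del: of_real_mult of_real_divide)
  also have "\<dots> = (\<integral>y. (\<integral>x. complex_of_real (?c x y * p y) * exp (\<i> * of_real (x * \<xi>)) \<partial>lborel) \<partial>lborel)"
    by (rule lborel_pair.Fubini_integral[OF int])
  also have "\<dots> = (\<integral>y. of_real (pi * exp (- \<gamma> * \<bar>\<xi>\<bar>)) * (of_real (p y) * exp (\<i> * of_real (y * \<xi>))) \<partial>lborel)"
  proof (rule Bochner_Integration.integral_cong[OF refl])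
    fix y
    have "(\<integral>x. complex_of_real (?c x y * p y) * exp (\<i> * of_real (x * \<xi>)) \<partial>lborel)
       = \<bar>1\<bar> *\<^sub>R (\<integral>x. complex_of_real (?c (y + 1 * x) y * p y) * exp (\<i> * of_real ((y + 1 * x) * \<xi>)) \<partial>lborel)"
      by (rule lborel_integral_real_affine) simp
    also have "\<dots> = (\<integral>x. (of_real (p y) * exp (\<i> * of_real (y * \<xi>))) * (of_real (\<gamma> / (x\<^sup>2 + \<gamma>\<^sup>2)) * exp (\<i> * of_real (x * \<xi>))) \<partial>lborel)"
      by (simp add: ring_distribs exp_add mult_ac)
    also have "\<dots> = (of_real (p y) * exp (\<i> * of_real (y * \<xi>))) * of_real (pi * exp (- \<gamma> * \<bar>\<xi>\<bar>))"
      using fourier_cauchy_kernel[OF g, of \<xi>] unfolding fourier_def by (subst integral_mult_right_zero) simp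
    finally show "(\<integral>x. complex_of_real (?c x y * p y) * exp (\<i> * of_real (x * \<xi>)) \<partial>lborel) 
       = of_real (pi * exp (- \<gamma> * \<bar>\<xi>\<bar>)) * (of_real (p y) * exp (\<i> * of_real (y * \<xi>)))" by (simp add: mult_ac)
  qed
  finally show "fourier (\<lambda>x. of_real (\<integral>y. ?c x y * p y \<partial>lborel)) \<xi>
        = of_real (pi * exp (- \<gamma> * \<bar>\<xi>\<bar>)) * fourier (\<lambda>x. of_real (p x)) \<xi>"
    by (simp add: fourier_def)
qed

section \<open>Resolvents of Hermitian matrices\<close>

text \<open>
  Matrices are functions of two indices, of which only those below \<open>n\<close> matter. Products are then
  associative without side conditions, and entries can be differentiated and integrated like any other
  scalar function.
\<close>

type_synonym cmatrix = "nat \<Rightarrow> nat \<Rightarrow> complex"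

definition mmul :: "nat \<Rightarrow> cmatrix \<Rightarrow> cmatrix \<Rightarrow> cmatrix" where
  "mmul n A B i j = (\<Sum>k<n. A i k * B k j)"

definition id_matrix :: cmatrix where "id_matrix i j = (if i = j then 1 else 0)"

definition mat_trace :: "nat \<Rightarrow> cmatrix \<Rightarrow> complex" where "mat_trace n A = (\<Sum>i<n. A i i)"

definition hs_norm :: "nat \<Rightarrow> cmatrix \<Rightarrow> real" where
  "hs_norm n A = L2_set (\<lambda>(i, j). cmod (A i j)) ({..<n} \<times> {..<n})"

definition hermitian :: "nat \<Rightarrow> cmatrix \<Rightarrow> bool" where
  "hermitian n X \<longleftrightarrow> (\<forall>i<n. \<forall>j<n. X j i = cnj (X i j))"

definition pencil :: "cmatrix \<Rightarrow> complex \<Rightarrow> cmatrix" where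
  "pencil X w i j = w * id_matrix i j - X i j"

text \<open>
  Cramer's rule is taken as the definition because it makes the entries rational functions of \<open>w\<close> and of the
  entries of \<open>X\<close>, hence measurable.
\<close>

definition resolvent :: "nat \<Rightarrow> cmatrix \<Rightarrow> complex \<Rightarrow> cmatrix" where
  "resolvent n X w i j = 
     adj_mat (mat n n (\<lambda>(i, j). pencil X w i j)) $$ (i, j) / det (mat n n (\<lambda>(i, j). pencil X w i j))"

lemma mmul_assoc: "mmul n (mmul n A B) C = mmul n A (mmul n B C)"
proof (intro ext)
  fix i j
  have "mmul n (mmul n A B) C i j = (\<Sum>k<n. \<Sum>l<n. A i l * B l k * C k j)"
    by (simp add: mmul_def sum_distrib_right)
  also have "\<dots> = (\<Sum>l<n. \<Sum>k<n. A i l * B l k * C k j)" by (rule sum.swap)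
  also have "\<dots> = mmul n A (mmul n B C) i j"
    by (simp add: mmul_def sum_distrib_left mult.assoc)
  finally show "mmul n (mmul n A B) C i j = mmul n A (mmul n B C) i j" .
qed

lemma mmul_cong:
  assumes "\<And>k. k < n \<Longrightarrow> A i k = A' i k" "\<And>k. k < n \<Longrightarrow> B k j = B' k j"
  shows "mmul n A B i j = mmul n A' B' i j"
  unfolding mmul_def using assms by (intro sum.cong) auto

lemma mmul_idm: "i < n \<Longrightarrow> mmul n id_matrix A i j = A i j" "j < n \<Longrightarrow> mmul n A id_matrix i j = A i j"
  unfolding mmul_def id_matrix_def by (simp_all add: if_distrib if_distribR cong: if_cong)

lemma mmul_pencil:
  assumes "i < n"
  shows "mmul n (pencil X w) S i j = w * S i j - mmul n X S i j"
proof -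
  have "mmul n (pencil X w) S i j = w * mmul n id_matrix S i j - mmul n X S i j"
    by (simp add: mmul_def pencil_def left_diff_distrib sum_subtractf sum_distrib_left mult.assoc)
  then show ?thesis using assms by (simp add: mmul_idm)
qed

lemma hs_nonneg [simp]: "0 \<le> hs_norm n A"
  by (simp add: hs_norm_def)

lemma hs_square: "(hs_norm n A)\<^sup>2 = (\<Sum>i<n. \<Sum>j<n. (cmod (A i j))\<^sup>2)"
  unfolding hs_norm_def L2_set_def by (subst real_sqrt_pow2) (auto simp: sum.cartesian_product case_prod_unfold intro!: sum_nonneg)

lemma entry_le_hs: "i < n \<Longrightarrow> j < n \<Longrightarrow> cmod (A i j) \<le> hs_norm n A"
  unfolding hs_norm_def using member_le_L2_set[of "{..<n} \<times> {..<n}" "(i, j)" "\<lambda>(i, j). cmod (A i j)"] by simp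

lemma hs_add: "hs_norm n (\<lambda>i j. A i j + B i j) \<le> hs_norm n A + hs_norm n B"
proof -
  have "hs_norm n (\<lambda>i j. A i j + B i j) \<le> L2_set (\<lambda>p. (case p of (i, j) \<Rightarrow> cmod (A i j)) + (case p of (i, j) \<Rightarrow> cmod (B i j))) ({..<n} \<times> {..<n})"
    unfolding hs_norm_def by (intro L2_set_mono) (auto intro: norm_triangle_ineq)
  also have "\<dots> \<le> hs_norm n A + hs_norm n B"
    unfolding hs_norm_def by (rule L2_set_triangle_ineq)
  finally show ?thesis .
qed

lemma hs_scale: "hs_norm n (\<lambda>i j. c * A i j) = cmod c * hs_norm n A"
proof -
  have "hs_norm n (\<lambda>i j. c * A i j) = L2_set (\<lambda>p. cmod c * (case p of (i, j) \<Rightarrow> cmod (A i j))) ({..<n} \<times> {..<n})"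
    unfolding hs_norm_def by (intro L2_set_cong) (auto simp: norm_mult)
  then show ?thesis by (simp add: hs_norm_def L2_set_right_distrib)
qed

lemma hs_idm: "hs_norm n id_matrix = sqrt (real n)"
proof -
  have "(hs_norm n id_matrix)\<^sup>2 = real n"
    by (simp add: hs_square id_matrix_def if_distrib if_distribR cong: if_cong)
  then show ?thesis by (metis hs_nonneg real_sqrt_unique)
qed

lemma hs_cauchy_schwarz: "cmod (\<Sum>i<n. \<Sum>j<n. A i j * B i j) \<le> hs_norm n A * hs_norm n B"
proof -
  have "cmod (\<Sum>i<n. \<Sum>j<n. A i j * B i j) \<le> (\<Sum>i<n. \<Sum>j<n. cmod (A i j) * cmod (B i j))"
    by (intro order_trans[OF norm_sum] sum_mono) (simp add: norm_mult)
  also have "\<dots> = (\<Sum>p\<in>{..<n} \<times> {..<n}. \<bar>case p of (i, j) \<Rightarrow> cmod (A i j)\<bar> * \<bar>case p of (i, j) \<Rightarrow> cmod (B i j)\<bar>)"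
    by (simp add: sum.cartesian_product case_prod_unfold)
  also have "\<dots> \<le> hs_norm n A * hs_norm n B"
    unfolding hs_norm_def by (rule L2_set_mult_ineq)
  finally show ?thesis .
qed

lemma hs_transpose: "hs_norm n (\<lambda>i j. A j i) = hs_norm n A"
proof -
  have "(hs_norm n (\<lambda>i j. A j i))\<^sup>2 = (hs_norm n A)\<^sup>2"
    unfolding hs_square by (rule sum.swap)
  then show ?thesis by simp
qed

lemma norm_tr_le: "cmod (mat_trace n A) \<le> sqrt (real n) * hs_norm n A"
proof -
  have "mat_trace n A = (\<Sum>i<n. \<Sum>j<n. id_matrix i j * A i j)"
    by (simp add: mat_trace_def id_matrix_def if_distrib if_distribR cong: if_cong)
  then show ?thesis using hs_cauchy_schwarz[where n = n and A = id_matrix and B = A] by (simp add: hs_idm)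
qed

text \<open>
  The quadratic form of a Hermitian matrix is real, so only \<open>w\<close> contributes to the imaginary part. All
  resolvent estimates come from this identity.
\<close>

lemma pencil_energy:
  assumes "hermitian n X" and S: "\<And>i j. i < n \<Longrightarrow> j < n \<Longrightarrow> mmul n (pencil X w) S i j = M i j"
  shows "Im (\<Sum>i<n. \<Sum>j<n. cnj (S i j) * M i j) = Im w * (hs_norm n S)\<^sup>2"
proof -
  \<comment> \<open>the quadratic form of \<open>X\<close> in column \<open>j\<close>, real because \<open>X\<close> is Hermitian\<close>
  define q where "q j = (\<Sum>i<n. \<Sum>k<n. cnj (S i j) * X i k * S k j)" for j
  have qq: "\<forall>j. cnj (q j) = q j"
  proof
    fix j
    have "cnj (q j) = (\<Sum>i<n. \<Sum>k<n. cnj (S k j) * X k i * S i j)"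
      unfolding q_def cnj_sum
    proof (rule sum.cong[OF refl], rule sum.cong[OF refl])
      fix i k assume i: "i \<in> {..<n}" and k: "k \<in> {..<n}"
      have c: "cnj (X i k) = X k i" using assms(1) i k unfolding hermitian_def lessThan_iff by metis
      have "cnj (cnj (S i j) * X i k * S k j) = S i j * X k i * cnj (S k j)"
        by (simp only: complex_cnj_mult complex_cnj_cnj c)
      then show "cnj (cnj (S i j) * X i k * S k j) = cnj (S k j) * X k i * S i j"
        by (simp only: mult_ac)
    qed
    also have "\<dots> = q j" unfolding q_def by (rule sum.swap)
    finally show "cnj (q j) = q j" .
  qed
  have q: "Im (q j) = 0" for j 
  proof -
    have "cnj (q j) = q j" using qq by blast
    then have "Im (cnj (q j)) = Im (q j)" by (rule arg_cong)
    then show ?thesis by simp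
  qed
  have "(\<Sum>i<n. cnj (S i j) * M i j) = w * (\<Sum>i<n. of_real ((cmod (S i j))\<^sup>2)) - q j" if j: "j < n" for j
  proof -
    have "cnj (S i j) * M i j = w * of_real ((cmod (S i j))\<^sup>2) - (\<Sum>k<n. cnj (S i j) * X i k * S k j)" if i: "i < n" for i
    proof -
      have "M i j = w * S i j - (\<Sum>k<n. X i k * S k j)"
        using S[OF i j, symmetric] i
        by (simp add: mmul_pencil) (simp add: mmul_def)
      then show ?thesis
        by (simp add: right_diff_distrib sum_distrib_left complex_norm_square mult_ac del: of_real_power)
    qed
    then show ?thesis by (simp add: sum_subtractf sum_distrib_left q_def)
  qed
  then have "(\<Sum>i<n. \<Sum>j<n. cnj (S i j) * M i j) = (\<Sum>j<n. w * (\<Sum>i<n. of_real ((cmod (S i j))\<^sup>2)) - q j)"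
    by (subst sum.swap) simp
  also have "Im \<dots> = (\<Sum>j<n. Im w * (\<Sum>i<n. (cmod (S i j))\<^sup>2))"
    by (simp add: q flip: of_real_sum of_real_power)
  also have "\<dots> = Im w * (hs_norm n S)\<^sup>2"
    unfolding hs_square sum_distrib_left[symmetric] by (subst sum.swap) rule
  finally show ?thesis .
qed

lemma pencil_lower_bound:
  assumes "hermitian n X" and S: "\<And>i j. i < n \<Longrightarrow> j < n \<Longrightarrow> mmul n (pencil X w) S i j = M i j"
  shows "\<bar>Im w\<bar> * hs_norm n S \<le> hs_norm n M"
proof (cases "hs_norm n S = 0")
  case False
  have "\<bar>Im w\<bar> * (hs_norm n S)\<^sup>2 = \<bar>Im (\<Sum>i<n. \<Sum>j<n. cnj (S i j) * M i j)\<bar>"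
    by (subst pencil_energy[OF assms]) (simp_all add: abs_mult)
  also have "\<dots> \<le> hs_norm n (\<lambda>i j. cnj (S i j)) * hs_norm n M"
    by (rule order_trans[OF abs_Im_le_cmod hs_cauchy_schwarz])
  also have "hs_norm n (\<lambda>i j. cnj (S i j)) = hs_norm n S" by (simp add: hs_norm_def)
  finally have "hs_norm n S * (\<bar>Im w\<bar> * hs_norm n S) \<le> hs_norm n S * hs_norm n M" by (simp add: power2_eq_square mult_ac)
  then show ?thesis using False by (simp add: order_less_le)
qed simp

text \<open>
  A kernel vector, repeated in all columns, would be a matrix \<open>S\<close> with \<open>(w - X) S = 0\<close>, against the
  lower bound just shown.
\<close>

lemma det_pencil_nonzero:
  assumes X: "hermitian n X" and w: "Im w \<noteq> 0"
  shows "det (mat n n (\<lambda>(i, j). pencil X w i j)) \<noteq> 0"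
proof
  let ?A = "mat n n (\<lambda>(i, j). pencil X w i j)"
  have A: "?A \<in> carrier_mat n n" by simp
  assume "det ?A = 0"
  then obtain v where v: "v \<in> carrier_vec n" "v \<noteq> 0\<^sub>v n" "?A *\<^sub>v v = 0\<^sub>v n"
    using det_0_iff_vec_prod_zero_field[OF A] by auto
  \<comment> \<open>all columns equal to the kernel vector\<close>
  define S where "S i j = (if i < n then vec_index v i else 0)" for i j :: nat
  have z: "mmul n (pencil X w) S i j = 0" if "i < n" "j < n" for i j
  proof -
    have "0 = vec_index (?A *\<^sub>v v) i" using v(3) that by simp
    also have "\<dots> = (\<Sum>k = 0..<n. pencil X w i k * vec_index v k)"
      using v(1) that by (simp add: scalar_prod_def)
    also have "\<dots> = mmul n (pencil X w) S i j"
      unfolding mmul_def S_def by (simp add: atLeast0LessThan)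
    finally show ?thesis by simp
  qed
  have "\<bar>Im w\<bar> * hs_norm n S \<le> hs_norm n (\<lambda>i j. 0)" by (rule pencil_lower_bound[OF X z])
  also have "hs_norm n (\<lambda>i j. 0) = 0" by (simp add: hs_norm_def L2_set_def)
  finally have "hs_norm n S = 0" using w hs_nonneg[of n S] by (simp add: mult_le_0_iff)
  then have "vec_index v i = 0" if "i < n" for i
    using entry_le_hs[of i n i S] that by (simp add: S_def)
  then have "v = 0\<^sub>v n" using v(1) by (intro eq_vecI) auto
  with v(2) show False by simp
qed

lemma resolvent_inverse:
  assumes X: "hermitian n X" and w: "Im w \<noteq> 0" and ij: "i < n" "j < n"
  shows "mmul n (pencil X w) (resolvent n X w) i j = id_matrix i j"
    and "mmul n (resolvent n X w) (pencil X w) i j = id_matrix i j"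
proof -
  let ?A = "mat n n (\<lambda>(i, j). pencil X w i j)"
  have A: "?A \<in> carrier_mat n n" by simp
  note adj = adj_mat[OF A]
  have d: "det ?A \<noteq> 0" by (rule det_pencil_nonzero[OF X w])
  have "(?A * adj_mat ?A) $$ (i, j) = det ?A * id_matrix i j"
    unfolding adj(2) using ij by (simp add: id_matrix_def)
  moreover have "(?A * adj_mat ?A) $$ (i, j) = (\<Sum>k<n. pencil X w i k * adj_mat ?A $$ (k, j))"
    using ij adj(1) by (simp add: scalar_prod_def atLeast0LessThan)
  ultimately show "mmul n (pencil X w) (resolvent n X w) i j = id_matrix i j"
    using d by (simp add: mmul_def resolvent_def flip: sum_divide_distrib)
  have "(adj_mat ?A * ?A) $$ (i, j) = det ?A * id_matrix i j"
    unfolding adj(3) using ij by (simp add: id_matrix_def)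
  moreover have "(adj_mat ?A * ?A) $$ (i, j) = (\<Sum>k<n. adj_mat ?A $$ (i, k) * pencil X w k j)"
    using ij adj(1) by (simp add: scalar_prod_def atLeast0LessThan)
  ultimately show "mmul n (resolvent n X w) (pencil X w) i j = id_matrix i j"
    using d by (simp add: mmul_def resolvent_def flip: sum_divide_distrib)
qed

lemma hs_resolvent_mmul_le:
  assumes X: "hermitian n X" and w: "Im w \<noteq> 0"
  shows "\<bar>Im w\<bar> * hs_norm n (mmul n (resolvent n X w) M) \<le> hs_norm n M"
proof (rule pencil_lower_bound[OF X])
  fix i j assume "i < n" "j < n"
  then have "mmul n (mmul n (pencil X w) (resolvent n X w)) M i j = mmul n id_matrix M i j"
    by (intro mmul_cong resolvent_inverse X w) auto
  then show "mmul n (pencil X w) (mmul n (resolvent n X w) M) i j = M i j"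
    using \<open>i < n\<close> by (simp add: mmul_assoc mmul_idm)
qed

lemma hs_resolvent_le:
  assumes X: "hermitian n X" and w: "Im w \<noteq> 0"
  shows "\<bar>Im w\<bar> * hs_norm n (resolvent n X w) \<le> sqrt (real n)"
  using pencil_lower_bound[OF X resolvent_inverse(1)[OF X w]] by (simp add: hs_idm)

text \<open>
  The case \<open>S = R\<close> of the energy identity. It turns the Hilbert-Schmidt norm of the resolvent into a trace,
  which the eigenvalues determine.
\<close>

lemma ward_identity:
  assumes X: "hermitian n X" and w: "Im w \<noteq> 0"
  shows "Im w * (hs_norm n (resolvent n X w))\<^sup>2 = - Im (mat_trace n (resolvent n X w))"
  by (subst pencil_energy[OF X resolvent_inverse(1)[OF X w], symmetric])
    (simp_all add: id_matrix_def mat_trace_def sum_negf if_distrib if_distribR cong: if_cong)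

lemma resolvent_identity:
  assumes X: "hermitian n X" "hermitian n Y" and w: "Im w \<noteq> 0" and ij: "i < n" "j < n"
  shows "resolvent n Y w i j - resolvent n X w i j
     = mmul n (resolvent n Y w) (mmul n (\<lambda>i j. Y i j - X i j) (resolvent n X w)) i j"
proof -
  let ?R = "resolvent n X w" and ?S = "resolvent n Y w"
  have "mmul n ?S (mmul n (\<lambda>i j. Y i j - X i j) ?R) i j
     = mmul n ?S (\<lambda>i j. mmul n (pencil X w) ?R i j - mmul n (pencil Y w) ?R i j) i j"
    by (rule mmul_cong) (auto simp: mmul_def pencil_def sum_subtractf[symmetric] algebra_simps intro!: sum.cong)
  also have "\<dots> = mmul n ?S (mmul n (pencil X w) ?R) i j - mmul n ?S (mmul n (pencil Y w) ?R) i j"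
    by (simp add: mmul_def right_diff_distrib sum_subtractf)
  also have "mmul n ?S (mmul n (pencil X w) ?R) i j = mmul n ?S id_matrix i j"
    by (intro mmul_cong resolvent_inverse X w ij refl)
  also have "mmul n ?S (mmul n (pencil Y w) ?R) i j = mmul n id_matrix ?R i j"
    unfolding mmul_assoc[symmetric] by (intro mmul_cong resolvent_inverse X w ij refl)
  finally show ?thesis using ij by (simp add: mmul_idm)
qed

text \<open>
  By the resolvent identity the increment between \<open>s\<close> and \<open>s'\<close> is exactly
  \<open>(s' - s) R(s') E R(s)\<close>. Since \<open>R(s')\<close> is bounded uniformly in \<open>s'\<close>, this first gives continuity, and then,
  dividing by \<open>s' - s\<close>, the derivative.
\<close>

lemma resolvent_has_derivative:
  fixes E :: cmatrix
  assumes X: "\<And>s::real. hermitian n (X s)"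
    and lin: "\<And>s s' i j. i < n \<Longrightarrow> j < n \<Longrightarrow> X s' i j - X s i j = of_real (s' - s) * E i j"
    and w: "Im w \<noteq> 0" and ij: "i < n" "j < n"
  shows "((\<lambda>s. resolvent n (X s) w i j) has_vector_derivative
     mmul n (resolvent n (X s) w) (mmul n E (resolvent n (X s) w)) i j) (at s)"
proof -
  let ?R = "\<lambda>s. resolvent n (X s) w"
  define G where "G s' i j = mmul n (?R s') (mmul n E (?R s)) i j" for s' i j
  have incr: "?R s' i j - ?R s i j = of_real (s' - s) * G s' i j" if "i < n" "j < n" for s' i j
  proof -
    have "?R s' i j - ?R s i j = mmul n (?R s') (mmul n (\<lambda>i j. X s' i j - X s i j) (?R s)) i j"
      by (rule resolvent_identity) (use X w that in auto)
    also have "\<dots> = mmul n (?R s') (\<lambda>i j. of_real (s' - s) * mmul n E (?R s) i j) i j"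
    proof (rule mmul_cong)
      fix k assume k: "k < n"
      show "mmul n (\<lambda>i j. X s' i j - X s i j) (?R s) k j = of_real (s' - s) * mmul n E (?R s) k j"
        unfolding mmul_def sum_distrib_left
      proof (rule sum.cong[OF refl])
        fix l assume "l \<in> {..<n}"
        then have "X s' k l - X s k l = of_real (s' - s) * E k l" using k by (intro lin) auto
        then show "(X s' k l - X s k l) * ?R s l j = of_real (s' - s) * (E k l * ?R s l j)"
          by (simp only: mult.assoc)
      qed
    qed simp
    also have "\<dots> = of_real (s' - s) * G s' i j"
      unfolding G_def mmul_def[of n "?R s'"] sum_distrib_left by (intro sum.cong refl) (simp only: mult.left_commute)
    finally show ?thesis .
  qed
  have bd: "cmod (?R s' i j) \<le> sqrt (real n) / \<bar>Im w\<bar>" if "i < n" "j < n" for s' i j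
  proof -
    have "hs_norm n (?R s') \<le> sqrt (real n) / \<bar>Im w\<bar>"
      using hs_resolvent_le[OF X w, of s'] w by (simp add: pos_le_divide_eq mult.commute)
    then show ?thesis using entry_le_hs[OF that, of "?R s'"] by linarith
  qed
  have cont: "((\<lambda>s'. ?R s' i j) \<longlongrightarrow> ?R s i j) (at s)" if ij: "i < n" "j < n" for i j
  proof -
    define C where "C = (\<Sum>k<n. sqrt (real n) / \<bar>Im w\<bar> * cmod (mmul n E (?R s) k j))"
    have G: "cmod (G s' i j) \<le> C" for s'
      unfolding G_def mmul_def[of n "?R s'"] C_def
      by (intro order_trans[OF norm_sum] sum_mono, unfold norm_mult, rule mult_right_mono[OF bd[OF ij(1)]]) auto
    have "((\<lambda>s'. ?R s' i j - ?R s i j) \<longlongrightarrow> 0) (at s)"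
    proof (rule Lim_null_comparison)
      show "\<forall>\<^sub>F s' in at s. cmod (?R s' i j - ?R s i j) \<le> \<bar>s' - s\<bar> * C"
        by (intro always_eventually allI) (simp add: incr[OF ij] norm_mult mult_left_mono G flip: of_real_diff)
      show "((\<lambda>s'. \<bar>s' - s\<bar> * C) \<longlongrightarrow> 0) (at s)" by (auto intro!: tendsto_eq_intros)
    qed
    then show ?thesis by (simp add: LIM_zero_iff)
  qed
  have "((\<lambda>s'. G s' i j) \<longlongrightarrow> G s i j) (at s)"
    unfolding G_def mmul_def[of n "?R _"] by (intro tendsto_intros cont ij) auto
  then have lim: "((\<lambda>s'. cmod (G s' i j - G s i j)) \<longlongrightarrow> 0) (at s)"
    by (simp add: LIM_zero_iff tendsto_norm_zero_iff)
  have "((\<lambda>s'. cmod (?R s' i j - ?R s i j - (s' - s) *\<^sub>R G s i j) / norm (s' - s)) \<longlongrightarrow> 0) (at s)"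
  proof (rule Lim_transform_eventually[OF lim])
    have "cmod (G s' i j - G s i j) = cmod (?R s' i j - ?R s i j - (s' - s) *\<^sub>R G s i j) / norm (s' - s)"
      if "s' \<noteq> s" for s'
    proof -
      have "?R s' i j - ?R s i j - (s' - s) *\<^sub>R G s i j = (s' - s) *\<^sub>R (G s' i j - G s i j)"
        unfolding incr[OF ij] scaleR_conv_of_real right_diff_distrib ..
      then show ?thesis using that by simp
    qed
    then show "\<forall>\<^sub>F s' in at s. cmod (G s' i j - G s i j) = cmod (?R s' i j - ?R s i j - (s' - s) *\<^sub>R G s i j) / norm (s' - s)"
      unfolding eventually_at_filter by (intro always_eventually allI impI)
  qed
  then show ?thesis
    unfolding G_def has_vector_derivative_def has_derivative_iff_norm
    by (intro conjI bounded_linear_scaleR_left)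
qed

text \<open>
  A right inverse of an upper triangular matrix is upper triangular: by induction from the last row
  upwards, each entry below the diagonal is killed by a nonzero diagonal entry.
\<close>

lemma upper_triangular_inverse_diagonal:
  assumes T: "\<And>i j. j < i \<Longrightarrow> i < n \<Longrightarrow> T i j = 0" and inv: "\<And>i j. i < n \<Longrightarrow> j < n \<Longrightarrow> mmul n T S i j = id_matrix i j"
    and i: "i < n"
  shows "T i i * S i i = 1"
proof -
  have d0: "T k k \<noteq> 0 \<and> (\<forall>j<k. S k j = 0)" if "k < n" for k
    using that
  proof (induction "n - k" arbitrary: k rule: less_induct)
    case less
    have *: "mmul n T S k j = T k k * S k j" if j: "j \<le> k" for j
    proof -
      have "mmul n T S k j = (\<Sum>l<n. if l = k then T k k * S k j else 0)"
        unfolding mmul_def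
      proof (rule sum.cong[OF refl])
        fix l assume "l \<in> {..<n}"
        then show "T k l * S l j = (if l = k then T k k * S k j else 0)"
          using less T[of l k] j by (cases l k rule: linorder_cases) auto
      qed
      then show ?thesis using less.prems by simp
    qed
    have "T k k * S k k = 1" using *[of k] inv[of k k] less.prems by (simp add: id_matrix_def)
    then have nz: "T k k \<noteq> 0" by auto
    have "S k j = 0" if j: "j < k" for j
      using *[of j] inv[of k j] less.prems j nz by (simp add: id_matrix_def)
    with nz show ?case by blast
  qed
  have "mmul n T S i i = (\<Sum>l<n. if l = i then T i i * S i i else 0)"
    unfolding mmul_def
  proof (rule sum.cong[OF refl])
    fix l assume "l \<in> {..<n}"
    then show "T i l * S l i = (if l = i then T i i * S i i else 0)"
      using d0[of l] T[of l i] i by (cases l i rule: linorder_cases) auto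
  qed
  then show ?thesis using inv[OF i i] i by (simp add: id_matrix_def)
qed

lemma tr_mmul_commute: "mat_trace n (mmul n A B) = mat_trace n (mmul n B A)"
  unfolding mat_trace_def mmul_def by (subst sum.swap) (simp add: mult.commute)

lemma proots_prod_linear: "proots (\<Prod>a\<leftarrow>as. [:- a, 1:]) = mset (as :: complex list)"
proof (induction as)
  case (Cons a as)
  have "(\<Prod>a\<leftarrow>as. [:- a, 1:]) \<noteq> (0 :: complex poly)" by (auto simp: prod_list_zero_iff)
  then have "proots ([:- a, 1:] * (\<Prod>a\<leftarrow>as. [:- a, 1:])) = proots [:- a, 1:] + proots (\<Prod>a\<leftarrow>as. [:- a, 1:])"
    by (intro proots_mult) auto
  then show ?case using Cons by (simp del: mult_pCons_left)
qed simp

text \<open>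
  Schur triangularisation \<open>X = P B P\<^sup>-\<^sup>1\<close> reduces the claim to triangular \<open>B\<close>: there the eigenvalues
  and the diagonal of the resolvent can both be read off.
\<close>

lemma spectral_cauchy_transform_resolvent:
  assumes X: "hermitian n X" and w: "Im w \<noteq> 0"
  shows "spectral_cauchy_transform (mat n n (\<lambda>(i, j). X i j)) w = mat_trace n (resolvent n X w) / of_nat n"
proof -
  let ?A = "mat n n (\<lambda>(i, j). X i j)" and ?R = "resolvent n X w"
  have A: "?A \<in> carrier_mat n n" by simp
  obtain as where as: "char_poly ?A = (\<Prod>a\<leftarrow>as. [:- a, 1:])" "length as = n"
    using char_poly_factorized[OF A] by auto
  obtain B where B: "B \<in> carrier_mat n n" "upper_triangular B" "similar_mat ?A B"
    using schur_decomposition_exists[OF A as(1)] by auto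
  obtain P Q where PQ: "similar_mat_wit ?A B P Q" using B(3) unfolding similar_mat_def by auto
  note sim = similar_mat_witD2[OF A PQ]
  define p q b where "p i j = P $$ (i, j)" and "q i j = Q $$ (i, j)" and "b i j = B $$ (i, j)" for i j
  have prod: "(C * D) $$ (i, j) = mmul n (\<lambda>i j. C $$ (i, j)) (\<lambda>i j. D $$ (i, j)) i j"
    if "C \<in> carrier_mat n n" "D \<in> carrier_mat n n" "i < n" "j < n" for C D :: "complex mat" and i j
    using that by (simp add: mmul_def scalar_prod_def atLeast0LessThan)
  have pq: "mmul n p q i j = id_matrix i j" and qp: "mmul n q p i j = id_matrix i j" if "i < n" "j < n" for i j
    using prod[OF sim(6,7) that] prod[OF sim(7,6) that] that unfolding sim(1,2)
    by (simp_all add: p_def[abs_def] q_def[abs_def] id_matrix_def)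
  have X_pbq: "X i j = mmul n p (mmul n b q) i j" if ij: "i < n" "j < n" for i j
  proof -
    have "X i j = (P * B * Q) $$ (i, j)" using sim(3) ij by (metis case_prod_conv index_mat(1))
    also have "\<dots> = mmul n (\<lambda>i j. (P * B) $$ (i, j)) q i j"
      using prod[OF mult_carrier_mat[OF sim(6,5)] sim(7) ij] by (simp add: q_def[abs_def])
    also have "\<dots> = mmul n (mmul n p b) q i j"
      by (rule mmul_cong) (use prod[OF sim(6,5)] ij in \<open>simp_all add: p_def[abs_def] b_def[abs_def]\<close>)
    finally show ?thesis by (simp add: mmul_assoc)
  qed
  have pencil_eq: "pencil X w i j = mmul n p (mmul n (pencil b w) q) i j" if ij: "i < n" "j < n" for i j
  proof -
    have "mmul n p (mmul n (pencil b w) q) i j = mmul n p (\<lambda>k j. w * q k j - mmul n b q k j) i j"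
      by (rule mmul_cong) (simp_all add: mmul_pencil)
    also have "\<dots> = w * mmul n p q i j - mmul n p (mmul n b q) i j"
      by (simp add: mmul_def[of n p] right_diff_distrib sum_subtractf sum_distrib_left mult.left_commute)
    finally show ?thesis using ij by (simp add: pq X_pbq pencil_def)
  qed
  \<comment> \<open>the resolvent in the triangularising basis\<close>
  define S where "S = mmul n q (mmul n ?R p)"
  have "mmul n (pencil b w) S i j = id_matrix i j" if ij: "i < n" "j < n" for i j
  proof -
    have "mmul n (pencil b w) S i j = mmul n (mmul n q p) (mmul n (pencil b w) S) i j"
      using ij by (subst mmul_cong[of n "mmul n q p" i id_matrix "mmul n (pencil b w) S" j "mmul n (pencil b w) S"])
         (simp_all add: qp mmul_idm)
    also have "\<dots> = mmul n q (mmul n (mmul n p (mmul n (pencil b w) q)) (mmul n ?R p)) i j"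
      by (simp add: S_def mmul_assoc)
    also have "\<dots> = mmul n q (mmul n (pencil X w) (mmul n ?R p)) i j"
      by (rule mmul_cong[OF refl], rule mmul_cong[OF _ refl]) (simp add: pencil_eq)
    also have "\<dots> = mmul n q (mmul n (mmul n (pencil X w) ?R) p) i j"
      by (simp add: mmul_assoc)
    also have "\<dots> = mmul n q (mmul n id_matrix p) i j"
      by (rule mmul_cong[OF refl], rule mmul_cong[OF _ refl], rule resolvent_inverse(1)[OF X w]) auto
    also have "\<dots> = mmul n q p i j"
      by (rule mmul_cong[OF refl]) (simp add: mmul_idm)
    finally show ?thesis using qp[OF ij] by simp
  qed
  note Sinv = this
  have tri: "pencil b w i j = 0" if "j < i" "i < n" for i j
    using B(1,2) that by (simp add: pencil_def id_matrix_def b_def upper_triangularD)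
  have diag: "S i i = 1 / (w - b i i)" if "i < n" for i
  proof -
    have "pencil b w i i * S i i = 1"
      by (rule upper_triangular_inverse_diagonal[OF tri Sinv that])
    then have e: "(w - b i i) * S i i = 1" by (simp add: pencil_def id_matrix_def)
    then have "w - b i i \<noteq> 0" by auto
    with e show ?thesis by (simp add: eq_divide_eq mult.commute)
  qed
  have "mat_trace n S = mat_trace n (mmul n (mmul n ?R p) q)" unfolding S_def by (rule tr_mmul_commute)
  also have "\<dots> = mat_trace n ?R"
    unfolding mat_trace_def
  proof (rule sum.cong[OF refl])
    fix i assume i: "i \<in> {..<n}"
    have "mmul n (mmul n ?R p) q i i = mmul n ?R (mmul n p q) i i" by (simp only: mmul_assoc)
    also have "\<dots> = mmul n ?R id_matrix i i" by (rule mmul_cong[OF refl], rule pq) (use i in auto)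
    finally show "mmul n (mmul n ?R p) q i i = ?R i i" using i by (simp add: mmul_idm)
  qed
  finally have trR: "mat_trace n ?R = (\<Sum>i<n. 1 / (w - b i i))"
    by (simp add: mat_trace_def diag)
  have "char_poly ?A = char_poly B" by (rule char_poly_similar) fact
  also have "\<dots> = (\<Prod>a\<leftarrow>diag_mat B. [:- a, 1:])" by (rule char_poly_upper_triangular[OF B(1,2)])
  finally have "proots (char_poly ?A) = mset (diag_mat B)"
    by (simp only: proots_prod_linear)
  then have "(\<Sum>a\<in>#proots (char_poly ?A). 1 / (w - a)) = (\<Sum>i\<in>#mset_set {0..<n}. 1 / (w - b i i))"
    using B(1) by (simp add: diag_mat_def b_def image_mset.compositionality o_def)
  then have "(\<Sum>a\<in>#proots (char_poly ?A). 1 / (w - a)) = (\<Sum>i<n. 1 / (w - b i i))"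
    by (simp add: sum_unfold_sum_mset atLeast0LessThan)
  then show ?thesis by (simp add: spectral_cauchy_transform_def trR)
qed

lemma hermitian_eigenvalue_real:
  assumes X: "hermitian n X" and a: "a \<in># proots (char_poly (mat n n (\<lambda>(i, j). X i j)))"
  shows "Im a = 0"
proof (rule ccontr)
  let ?A = "mat n n (\<lambda>(i, j). X i j)"
  assume "Im a \<noteq> 0"
  then have nz: "det (mat n n (\<lambda>(i, j). pencil X a i j)) \<noteq> 0" by (rule det_pencil_nonzero[OF X])
  have "poly (char_poly ?A) a = 0" using a by (cases "char_poly ?A = 0") auto
  then have "det (- char_matrix ?A a) = 0"
    by (subst char_poly_matrix[where n = n, symmetric]) auto
  moreover have "- char_matrix ?A a = mat n n (\<lambda>(i, j). pencil X a i j)"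
    by (rule eq_matI) (auto simp: char_matrix_def pencil_def id_matrix_def)
  ultimately show False using nz by simp
qed

lemma borel_measurable_det:
  fixes A :: "'a \<Rightarrow> complex mat"
  assumes c: "\<And>\<omega>. A \<omega> \<in> carrier_mat n n"
    and m: "\<And>i j. i < n \<Longrightarrow> j < n \<Longrightarrow> (\<lambda>\<omega>. A \<omega> $$ (i, j)) \<in> borel_measurable M"
  shows "(\<lambda>\<omega>. det (A \<omega>)) \<in> borel_measurable M"
proof -
  have "(\<lambda>\<omega>. \<Sum>p\<in>{p. p permutes {0..<n}}. signof p * (\<Prod>i = 0..<n. A \<omega> $$ (i, p i))) \<in> borel_measurable M"
  proof (intro borel_measurable_sum borel_measurable_times borel_measurable_const borel_measurable_prod)
    fix p i assume "p \<in> {p. p permutes {0..<n}}" "i \<in> {0..<n}"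
    then show "(\<lambda>\<omega>. A \<omega> $$ (i, p i)) \<in> borel_measurable M"
      using permutes_in_image[of p "{0..<n}" i] by (intro m) auto
  qed
  then show ?thesis by (subst det_def'[OF c])
qed

lemma borel_measurable_resolvent:
  assumes X: "\<And>i j. i < n \<Longrightarrow> j < n \<Longrightarrow> (\<lambda>\<omega>. X \<omega> i j) \<in> borel_measurable M"
    and w: "w \<in> borel_measurable M" and ij: "i < n" "j < n"
  shows "(\<lambda>\<omega>. resolvent n (X \<omega>) (w \<omega>) i j) \<in> borel_measurable M"
proof -
  let ?A = "\<lambda>\<omega>. mat n n (\<lambda>(i, j). pencil (X \<omega>) (w \<omega>) i j)"
  have p: "(\<lambda>\<omega>. pencil (X \<omega>) (w \<omega>) k l) \<in> borel_measurable M" if "k < n" "l < n" for k l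
    unfolding pencil_def by (intro borel_measurable_diff borel_measurable_times w X that) simp
  have d: "(\<lambda>\<omega>. det (?A \<omega>)) \<in> borel_measurable M"
    by (rule borel_measurable_det[where n = n]) (simp_all add: p)
  have "(\<lambda>\<omega>. det (mat_delete (?A \<omega>) j i)) \<in> borel_measurable M"
  proof (rule borel_measurable_det[where n = "n - 1"])
    show "mat_delete (?A \<omega>) j i \<in> carrier_mat (n - 1) (n - 1)" for \<omega> by (rule mat_delete_carrier) simp
    fix k l assume kl: "k < n - 1" "l < n - 1"
    have "(\<lambda>\<omega>. mat_delete (?A \<omega>) j i $$ (k, l)) = (\<lambda>\<omega>. pencil (X \<omega>) (w \<omega>) (if k < j then k else Suc k) (if l < i then l else Suc l))"
      using kl ij by (auto simp: mat_delete_def)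
    then show "(\<lambda>\<omega>. mat_delete (?A \<omega>) j i $$ (k, l)) \<in> borel_measurable M"
      using kl by (simp only:) (rule p, auto)
  qed
  then have "(\<lambda>\<omega>. ((-1) ^ (j + i) * det (mat_delete (?A \<omega>) j i)) / det (?A \<omega>)) \<in> borel_measurable M"
    by (intro borel_measurable_divide borel_measurable_times d) auto
  moreover have "resolvent n (X \<omega>) (w \<omega>) i j = ((-1) ^ (j + i) * det (mat_delete (?A \<omega>) j i)) / det (?A \<omega>)" for \<omega>
    unfolding resolvent_def adj_mat_def cofactor_def using ij by simp
  ultimately show ?thesis by simp
qed

section \<open>Gaussian integration by parts\<close>

text \<open>
  The derivative of \<open>\<phi> f\<close>, with \<open>\<phi>\<close> the Gaussian density, is \<open>\<phi> f' - (s/\<sigma>\<^sup>2) \<phi> f\<close> and has integral zero,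
  since \<open>\<phi> f\<close> vanishes at both ends.
\<close>

lemma stein_real:
  fixes f f' :: "real \<Rightarrow> complex"
  assumes \<sigma>: "\<sigma> > 0"
    and f: "\<And>s. (f has_vector_derivative f' s) (at s)" and cont: "\<And>s. isCont f' s"
    and bd: "\<And>s. cmod (f s) \<le> C" "\<And>s. cmod (f' s) \<le> C'"
  shows "(\<integral>s. of_real s * f s \<partial>density lborel (normal_density 0 \<sigma>))
       = of_real (\<sigma>\<^sup>2) * (\<integral>s. f' s \<partial>density lborel (normal_density 0 \<sigma>))"
proof -
  let ?\<phi> = "normal_density 0 \<sigma>"
  define F where "F s = ?\<phi> s *\<^sub>R f s" for s
  define F' where "F' s = ?\<phi> s *\<^sub>R f' s - (s / \<sigma>\<^sup>2 * ?\<phi> s) *\<^sub>R f s" for s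
  have fc: "isCont f s" for s using f by (rule has_vector_derivative_continuous)
  have [measurable]: "f \<in> borel_measurable borel" "f' \<in> borel_measurable borel"
    using fc cont by (auto intro!: borel_measurable_continuous_onI continuous_at_imp_continuous_on)
  have d\<phi>: "(?\<phi> has_real_derivative - (s / \<sigma>\<^sup>2 * ?\<phi> s)) (at s)" for s
    unfolding normal_density_def using \<sigma>
    by (auto intro!: derivative_eq_intros simp: field_simps power2_eq_square)
  have \<phi>c: "isCont ?\<phi> s" for s using d\<phi> by (rule DERIV_isCont)
  have int0: "integrable lborel (\<lambda>s. C' * ?\<phi> s)"
    using integrable_normal_moment[OF \<sigma>, of 0 0] by simp
  have int1: "integrable lborel (\<lambda>s. C * (?\<phi> s * s))"
    using integrable_normal_moment[OF \<sigma>, of 0 1] by simp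
  have \<phi>0: "0 \<le> ?\<phi> s" for s by simp
  have i1: "integrable lborel (\<lambda>s. ?\<phi> s *\<^sub>R f' s)"
    by (rule Bochner_Integration.integrable_bound[OF int0])
      (use order_trans[OF norm_ge_zero bd(2)] in \<open>auto simp: abs_mult mult.commute[of C'] intro!: mult_left_mono bd\<close>)
  have i2: "integrable lborel (\<lambda>s. (?\<phi> s * s) *\<^sub>R f s)"
    by (rule Bochner_Integration.integrable_bound[OF int1])
      (use order_trans[OF norm_ge_zero bd(1)] in \<open>auto simp: abs_mult mult.commute[of C] intro!: mult_left_mono bd\<close>)
  have F'_int: "integrable lborel F'"
    unfolding F'_def using i1 integrable_scaleR_right[OF i2, of "1 / \<sigma>\<^sup>2"] by (auto simp: mult_ac)
  have FC: "cmod (F s) \<le> ?\<phi> s * C" for s by (auto simp: F_def intro!: mult_left_mono bd)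
  have lim: "(?\<phi> \<longlongrightarrow> 0) at_top" "(?\<phi> \<longlongrightarrow> 0) at_bot"
    unfolding normal_density_def using \<sigma> by real_asymp+
  have "(LBINT s=-\<infinity>..\<infinity>. F' s) = 0 - 0"
  proof (rule interval_integral_FTC_integrable[where F = F])
    show "(F has_vector_derivative F' s) (at s)" for s
      unfolding F_def[abs_def] F'_def
      using has_vector_derivative_scaleR[OF d\<phi>[unfolded has_real_derivative_iff_has_vector_derivative[symmetric]] f]
      by (simp add: algebra_simps)
    show "isCont F' s" for s unfolding F'_def by (intro continuous_intros \<phi>c cont fc) (use \<sigma> in auto)
    show "set_integrable lborel (einterval (-\<infinity>) \<infinity>) F'" using F'_int by (simp add: set_integrable_def)
    have "(F \<longlongrightarrow> 0) at_top"
      by (rule Lim_null_comparison[OF always_eventually[OF allI[OF FC]]]) (use tendsto_mult_right[OF lim(1)] in auto)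
    then show "((F \<circ> real_of_ereal) \<longlongrightarrow> 0) (at_left \<infinity>)" by (simp add: ereal_tendsto_simps)
    have "(F \<longlongrightarrow> 0) at_bot"
      by (rule Lim_null_comparison[OF always_eventually[OF allI[OF FC]]]) (use tendsto_mult_right[OF lim(2)] in auto)
    then show "((F \<circ> real_of_ereal) \<longlongrightarrow> 0) (at_right (-\<infinity>))" by (simp add: ereal_tendsto_simps)
  qed simp
  then have "0 = (\<integral>s. F' s \<partial>lborel)"
    by (simp add: interval_lebesgue_integral_def set_lebesgue_integral_def)
  also have "\<dots> = (\<integral>s. ?\<phi> s *\<^sub>R f' s - (1 / \<sigma>\<^sup>2) *\<^sub>R ((?\<phi> s * s) *\<^sub>R f s) \<partial>lborel)"
    unfolding F'_def by (simp add: mult_ac)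
  also have "\<dots> = (\<integral>s. ?\<phi> s *\<^sub>R f' s \<partial>lborel) - (1 / \<sigma>\<^sup>2) *\<^sub>R (\<integral>s. (?\<phi> s * s) *\<^sub>R f s \<partial>lborel)"
    by (simp only: Bochner_Integration.integral_diff[OF i1 integrable_scaleR_right[OF i2]] integral_scaleR_right)
  finally have "(\<integral>s. (?\<phi> s * s) *\<^sub>R f s \<partial>lborel) = \<sigma>\<^sup>2 *\<^sub>R (\<integral>s. ?\<phi> s *\<^sub>R f' s \<partial>lborel)"
    using \<sigma> by simp
  moreover have "(\<integral>s. of_real s * f s \<partial>density lborel ?\<phi>) = (\<integral>s. (?\<phi> s * s) *\<^sub>R f s \<partial>lborel)"
    by (subst integral_density) (auto simp: scaleR_conv_of_real mult_ac)
  moreover have "(\<integral>s. f' s \<partial>density lborel ?\<phi>) = (\<integral>s. ?\<phi> s *\<^sub>R f' s \<partial>lborel)"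
    by (subst integral_density) auto
  ultimately show ?thesis by (simp add: scaleR_conv_of_real)
qed

text \<open>
  Apart from the Gaussian coordinates themselves, the functions of the noise that are integrated below are
  polynomials in resolvent entries and their conjugates. They all lie in this class, which is closed under the
  algebraic operations and consists of integrable functions.
\<close>

definition bounded_measurable :: "'b measure \<Rightarrow> ('b \<Rightarrow> complex) \<Rightarrow> bool" where
  "bounded_measurable P f \<longleftrightarrow> f \<in> borel_measurable P \<and> (\<exists>C. \<forall>\<xi>. cmod (f \<xi>) \<le> C)"

lemma bounded_measurable_const: "bounded_measurable P (\<lambda>_. c)"
  by (auto simp: bounded_measurable_def)

lemma bounded_measurable_add:
  assumes "bounded_measurable P f" "bounded_measurable P g"
  shows "bounded_measurable P (\<lambda>\<xi>. f \<xi> + g \<xi>)"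
proof -
  obtain C D where "\<And>\<xi>. cmod (f \<xi>) \<le> C" "\<And>\<xi>. cmod (g \<xi>) \<le> D"
    using assms by (auto simp: bounded_measurable_def)
  then have "cmod (f \<xi> + g \<xi>) \<le> C + D" for \<xi> by (meson norm_triangle_mono)
  then show ?thesis using assms by (auto simp: bounded_measurable_def)
qed

lemma bounded_measurable_mult:
  assumes "bounded_measurable P f" "bounded_measurable P g"
  shows "bounded_measurable P (\<lambda>\<xi>. f \<xi> * g \<xi>)"
proof -
  obtain C D where CD: "\<And>\<xi>. cmod (f \<xi>) \<le> C" "\<And>\<xi>. cmod (g \<xi>) \<le> D"
    using assms by (auto simp: bounded_measurable_def)
  have "cmod (f \<xi> * g \<xi>) \<le> C * D" for \<xi>
    unfolding norm_mult by (intro mult_mono CD) (auto intro: order_trans[OF norm_ge_zero CD(1)])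
  then show ?thesis using assms by (auto simp: bounded_measurable_def)
qed

lemma bounded_measurable_diff:
  assumes "bounded_measurable P f" "bounded_measurable P g"
  shows "bounded_measurable P (\<lambda>\<xi>. f \<xi> - g \<xi>)"
  using bounded_measurable_add[OF assms(1) bounded_measurable_mult[OF bounded_measurable_const[of P "-1"] assms(2)]]
  by simp

lemma bounded_measurable_cnj:
  assumes "bounded_measurable P f"
  shows "bounded_measurable P (\<lambda>\<xi>. cnj (f \<xi>))"
proof -
  have [measurable]: "f \<in> borel_measurable P" using assms by (simp add: bounded_measurable_def)
  have "(\<lambda>\<xi>. cnj (f \<xi>)) \<in> borel_measurable P" by measurable
  then show ?thesis using assms by (auto simp: bounded_measurable_def)
qed

lemma bounded_measurable_sum:
  "(\<And>i. i \<in> I \<Longrightarrow> bounded_measurable P (f i)) \<Longrightarrow> bounded_measurable P (\<lambda>\<xi>. \<Sum>i\<in>I. f i \<xi>)"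
  by (induction I rule: infinite_finite_induct)
    (auto intro: bounded_measurable_const bounded_measurable_add)

lemmas bounded_measurable_intros = bounded_measurable_const bounded_measurable_add bounded_measurable_mult
  bounded_measurable_diff bounded_measurable_cnj bounded_measurable_sum

lemma (in prob_space) bounded_measurable_integrable:
  "bounded_measurable M f \<Longrightarrow> integrable M f"
  unfolding bounded_measurable_def by (auto intro: integrable_const_bound)

abbreviation gaussian :: "real \<Rightarrow> real measure" where
  "gaussian \<sigma> \<equiv> density lborel (normal_density 0 \<sigma>)"

lemma gaussian_product_coordinate_integrable:
  assumes \<sigma>: "\<sigma> > 0" and J: "finite J" "\<alpha> \<in> J" and G: "bounded_measurable (Pi\<^sub>M J (\<lambda>_. gaussian \<sigma>)) G"
  shows "integrable (Pi\<^sub>M J (\<lambda>_. gaussian \<sigma>)) (\<lambda>\<xi>. of_real (\<xi> \<alpha>) * G \<xi>)"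
proof -
  let ?P = "Pi\<^sub>M J (\<lambda>_. gaussian \<sigma>)"
  interpret N: prob_space "gaussian \<sigma>" using \<sigma> by (rule prob_space_normal_density)
  interpret P: product_prob_space "\<lambda>_. gaussian \<sigma>" J by standard
  obtain C where C: "\<And>\<xi>. cmod (G \<xi>) \<le> C" using G by (auto simp: bounded_measurable_def)
  have m: "(\<lambda>\<xi>. \<xi> \<alpha>) \<in> measurable ?P (gaussian \<sigma>)" using J(2) by (rule measurable_component_singleton)
  have "integrable (gaussian \<sigma>) (\<lambda>s. s)"
    using integrable_normal_moment[OF \<sigma>, of 0 1] by (subst integrable_real_density) (auto simp: mult_ac)
  then have "integrable (distr ?P (gaussian \<sigma>) (\<lambda>\<xi>. \<xi> \<alpha>)) (\<lambda>s. s)"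
    using P.PiM_component[OF J(2)] by simp
  then have "integrable ?P (\<lambda>\<xi>. \<xi> \<alpha>)" by (rule integrable_distr[OF m])
  then have int: "integrable ?P (\<lambda>\<xi>. C * \<xi> \<alpha>)" by simp
  have Gm: "G \<in> borel_measurable ?P" using G by (simp add: bounded_measurable_def)
  have [measurable]: "(\<lambda>\<xi>. \<xi> \<alpha>) \<in> borel_measurable ?P" using m by simp
  show ?thesis
  proof (rule Bochner_Integration.integrable_bound[OF int])
    show "(\<lambda>\<xi>. of_real (\<xi> \<alpha>) * G \<xi>) \<in> borel_measurable ?P" using Gm by measurable
    show "AE \<xi> in ?P. norm (of_real (\<xi> \<alpha>) * G \<xi>) \<le> norm (C * \<xi> \<alpha>)"
      using order_trans[OF norm_ge_zero C]
      by (intro AE_I2) (auto simp: norm_mult abs_mult mult.commute[of C] intro!: mult_left_mono C)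
  qed
qed

text \<open>
  Integration by parts in one coordinate, with the other coordinates frozen by Fubini.
\<close>

lemma stein_product:
  fixes F F' :: "('i \<Rightarrow> real) \<Rightarrow> complex"
  assumes \<sigma>: "\<sigma> > 0" and J: "finite J" "\<alpha> \<in> J"
    and F: "bounded_measurable (Pi\<^sub>M J (\<lambda>_. gaussian \<sigma>)) F"
    and F': "bounded_measurable (Pi\<^sub>M J (\<lambda>_. gaussian \<sigma>)) F'"
    and deriv: "\<And>\<xi> s. ((\<lambda>s. F (\<xi>(\<alpha> := s))) has_vector_derivative F' (\<xi>(\<alpha> := s))) (at s)"
    and cont: "\<And>\<xi> s. isCont (\<lambda>s. F' (\<xi>(\<alpha> := s))) s"
  shows "(\<integral>\<xi>. of_real (\<xi> \<alpha>) * F \<xi> \<partial>Pi\<^sub>M J (\<lambda>_. gaussian \<sigma>)) = of_real (\<sigma>\<^sup>2) * (\<integral>\<xi>. F' \<xi> \<partial>Pi\<^sub>M J (\<lambda>_. gaussian \<sigma>))"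
proof -
  interpret N: prob_space "gaussian \<sigma>" using \<sigma> by (rule prob_space_normal_density)
  interpret P: product_prob_space "\<lambda>_. gaussian \<sigma>" J by standard
  define J' where "J' = J - {\<alpha>}"
  have J': "J = insert \<alpha> J'" "finite J'" "\<alpha> \<notin> J'" using J by (auto simp: J'_def)
  obtain C C' where C: "\<And>\<xi>. cmod (F \<xi>) \<le> C" "\<And>\<xi>. cmod (F' \<xi>) \<le> C'"
    using F F' by (auto simp: bounded_measurable_def)
  have F'_int: "integrable (Pi\<^sub>M J (\<lambda>_. gaussian \<sigma>)) F'"
    by (rule prob_space.bounded_measurable_integrable[OF _ F']) (rule P.P.prob_space_axioms)
  have "(\<integral>\<xi>. of_real (\<xi> \<alpha>) * F \<xi> \<partial>Pi\<^sub>M J (\<lambda>_. gaussian \<sigma>))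
     = (\<integral>x. (\<integral>y. of_real ((x(\<alpha> := y)) \<alpha>) * F (x(\<alpha> := y)) \<partial>gaussian \<sigma>) \<partial>Pi\<^sub>M J' (\<lambda>_. gaussian \<sigma>))"
    using gaussian_product_coordinate_integrable[OF \<sigma> J F] unfolding J'(1)
    by (rule P.product_integral_insert[OF J'(2,3)])
  also have "\<dots> = (\<integral>x. of_real (\<sigma>\<^sup>2) * (\<integral>y. F' (x(\<alpha> := y)) \<partial>gaussian \<sigma>) \<partial>Pi\<^sub>M J' (\<lambda>_. gaussian \<sigma>))"
  proof (rule Bochner_Integration.integral_cong[OF refl])
    fix x
    show "(\<integral>y. of_real ((x(\<alpha> := y)) \<alpha>) * F (x(\<alpha> := y)) \<partial>gaussian \<sigma>) = of_real (\<sigma>\<^sup>2) * (\<integral>y. F' (x(\<alpha> := y)) \<partial>gaussian \<sigma>)"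
      using stein_real[OF \<sigma> deriv cont C, of x] by simp
  qed
  also have "\<dots> = of_real (\<sigma>\<^sup>2) * (\<integral>x. (\<integral>y. F' (x(\<alpha> := y)) \<partial>gaussian \<sigma>) \<partial>Pi\<^sub>M J' (\<lambda>_. gaussian \<sigma>))"
    by (rule integral_mult_right_zero)
  also have "(\<integral>x. (\<integral>y. F' (x(\<alpha> := y)) \<partial>gaussian \<sigma>) \<partial>Pi\<^sub>M J' (\<lambda>_. gaussian \<sigma>)) = (\<integral>\<xi>. F' \<xi> \<partial>Pi\<^sub>M J (\<lambda>_. gaussian \<sigma>))"
    using F'_int unfolding J'(1) by (rule P.product_integral_insert[OF J'(2,3), symmetric])
  finally show ?thesis .
qed

section \<open>The Gaussian unitary ensemble in independent coordinates\<close>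

text \<open>
  The noise matrix is a linear combination of Hermitian basis matrices with independent real Gaussian
  coefficients. The left summand of the index type carries the real parts of the entries (and the diagonal),
  the right summand the imaginary parts above the diagonal.
\<close>

type_synonym gue_index = "(nat \<times> nat) + (nat \<times> nat)"

definition gue_indices :: "nat \<Rightarrow> gue_index set" where
  "gue_indices n = {(k, l). k \<le> l \<and> l < n} <+> {(k, l). k < l \<and> l < n}"

text \<open>
  Normalised so that coefficients of variance \<open>t\<close> give entries of variance \<open>t/n\<close>.
\<close>

definition gue_basis :: "nat \<Rightarrow> gue_index \<Rightarrow> cmatrix" where
  "gue_basis n \<alpha> i j = (case \<alpha> of
     Inl p \<Rightarrow> if p = (min i j, max i j) then 1 / of_real (sqrt (if i = j then real n else 2 * real n)) else 0
   | Inr p \<Rightarrow> if p = (min i j, max i j) then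
         (if i < j then \<i> else if j < i then - \<i> else 0) / of_real (sqrt (2 * real n)) else 0)"

definition gue :: "nat \<Rightarrow> (gue_index \<Rightarrow> real) \<Rightarrow> cmatrix" where
  "gue n \<xi> i j = (\<Sum>\<alpha>\<in>gue_indices n. of_real (\<xi> \<alpha>) * gue_basis n \<alpha> i j)"

lemma finite_gue_indices [simp]: "finite (gue_indices n)"
proof -
  have "{(k, l). k \<le> l \<and> l < n} \<subseteq> {..<n} \<times> {..<n}" "{(k, l). k < l \<and> l < n} \<subseteq> {..<n} \<times> {..<n}" by auto
  then have "finite {(k::nat, l). k \<le> l \<and> l < n}" "finite {(k::nat, l). k < l \<and> l < n}"
    by (auto intro: finite_subset)
  then show ?thesis unfolding gue_indices_def by (rule finite_Plus)
qed

lemma gue_basis_hermitian: "gue_basis n \<alpha> j i = cnj (gue_basis n \<alpha> i j)"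
  by (auto simp: gue_basis_def min.commute max.commute split: sum.split)

lemma gue_hermitian: "gue n \<xi> j i = cnj (gue n \<xi> i j)"
proof -
  have "gue n \<xi> j i = (\<Sum>\<alpha>\<in>gue_indices n. of_real (\<xi> \<alpha>) * cnj (gue_basis n \<alpha> i j))"
    unfolding gue_def by (subst gue_basis_hermitian) rule
  then show ?thesis by (simp add: gue_def)
qed

text \<open>
  At most two basis matrices have a nonzero entry at a given position, one for each part of that entry.
\<close>

lemma sum_gue_basis:
  assumes ij: "i < n" "j < n"
  defines "p \<equiv> (min i j, max i j)"
  shows "(\<Sum>\<alpha>\<in>gue_indices n. f \<alpha> * gue_basis n \<alpha> i j)
       = f (Inl p) * gue_basis n (Inl p) i j + f (Inr p) * gue_basis n (Inr p) i j"
proof -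
  let ?S = "{(k::nat, l). k \<le> l \<and> l < n}" and ?T = "{(k::nat, l). k < l \<and> l < n}"
  have fin: "finite ?S" "finite ?T"
    by (auto intro: finite_subset[of _ "{..<n} \<times> {..<n}"])
  have "(\<Sum>\<alpha>\<in>gue_indices n. f \<alpha> * gue_basis n \<alpha> i j)
    = (\<Sum>x\<in>?S. f (Inl x) * gue_basis n (Inl x) i j) + (\<Sum>x\<in>?T. f (Inr x) * gue_basis n (Inr x) i j)"
    unfolding gue_indices_def by (subst sum.Plus[OF fin]) (simp add: o_def)
  also have "(\<Sum>x\<in>?S. f (Inl x) * gue_basis n (Inl x) i j)
     = (\<Sum>x\<in>?S. if x = p then f (Inl p) * gue_basis n (Inl p) i j else 0)"
    by (rule sum.cong) (auto simp: gue_basis_def p_def)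
  also have "\<dots> = f (Inl p) * gue_basis n (Inl p) i j"
    using fin(1) ij by (subst sum.delta) (auto simp: p_def)
  also have "(\<Sum>x\<in>?T. f (Inr x) * gue_basis n (Inr x) i j)
     = (\<Sum>x\<in>?T. if x = p then f (Inr p) * gue_basis n (Inr p) i j else 0)"
    by (rule sum.cong) (auto simp: gue_basis_def p_def)
  also have "\<dots> = f (Inr p) * gue_basis n (Inr p) i j"
    using fin(2) ij by (subst sum.delta) (auto simp: p_def gue_basis_def)
  finally show ?thesis .
qed

text \<open>
  The real and imaginary parts contribute equally when \<open>(k, l) = (j, i)\<close> and cancel when
  \<open>(k, l) = (i, j)\<close> with \<open>i \<noteq> j\<close>. This is Wick's rule for the ensemble: summed over all
  coordinates, a derivative in the entry \<open>(i, j)\<close> only sees the entry \<open>(j, i)\<close>.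
\<close>

lemma gue_basis_completeness:
  assumes ij: "i < n" "j < n" and kl: "k < n" "l < n"
  shows "(\<Sum>\<alpha>\<in>gue_indices n. gue_basis n \<alpha> i j * gue_basis n \<alpha> k l) = (if i = l \<and> j = k then 1 / of_nat n else 0)"
proof -
  define p where "p = (min i j, max i j)"
  define q where "q = (min k l, max k l)"
  have *: "(\<Sum>\<alpha>\<in>gue_indices n. gue_basis n \<alpha> i j * gue_basis n \<alpha> k l) =
      gue_basis n (Inl p) i j * gue_basis n (Inl p) k l + gue_basis n (Inr p) i j * gue_basis n (Inr p) k l"
    using sum_gue_basis[OF ij, of "\<lambda>\<alpha>. gue_basis n \<alpha> k l"] by (simp add: p_def mult.commute)
  have n: "n > 0" using ij by simp
  define m where "m = (if i = j then real n else 2 * real n)"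
  have sq: "complex_of_real (sqrt m) * complex_of_real (sqrt m) = of_real m"
    "complex_of_real (sqrt (2 * real n)) * complex_of_real (sqrt (2 * real n)) = of_real (2 * real n)"
    by (simp_all add: m_def flip: of_real_mult)
  define e :: complex where "e = (if i < j then \<i> else if j < i then - \<i> else 0)"
  have l: "gue_basis n (Inl p) i j = 1 / of_real (sqrt m)" "gue_basis n (Inl p) j i = 1 / of_real (sqrt m)"
    by (simp_all add: gue_basis_def p_def m_def min.commute max.commute)
  have r: "gue_basis n (Inr p) i j = e / of_real (sqrt (2 * real n))" "gue_basis n (Inr p) j i = - e / of_real (sqrt (2 * real n))"
    by (simp_all add: gue_basis_def p_def e_def min.commute max.commute)
  have "k = i \<and> l = j \<or> k = j \<and> l = i" if "p = q"
    using that unfolding p_def q_def by (cases "i \<le> j"; cases "k \<le> l") (simp_all add: min_def max_def)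
  then consider "p \<noteq> q" | "k = i" "l = j" | "k = j" "l = i" by blast
  then show ?thesis
    unfolding *
  proof cases
    case 1
    then have "\<not> (i = l \<and> j = k)" using min.commute max.commute unfolding p_def q_def by metis
    moreover have "gue_basis n (Inl p) k l = 0" "gue_basis n (Inr p) k l = 0"
      using 1 by (simp_all add: gue_basis_def q_def)
    ultimately show "gue_basis n (Inl p) i j * gue_basis n (Inl p) k l + gue_basis n (Inr p) i j * gue_basis n (Inr p) k l
      = (if i = l \<and> j = k then 1 / of_nat n else 0)" by auto
  next
    case 2
    have "gue_basis n (Inl p) i j * gue_basis n (Inl p) k l + gue_basis n (Inr p) i j * gue_basis n (Inr p) k l
       = 1 / of_real m + e * e / of_real (2 * real n)"
      unfolding 2 l r times_divide_times_eq sq by simp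
    also have "\<dots> = (if i = l \<and> j = k then 1 / of_nat n else 0)"
      unfolding 2 by (cases i j rule: linorder_cases) (use n in \<open>simp_all add: m_def e_def\<close>)
    finally show "gue_basis n (Inl p) i j * gue_basis n (Inl p) k l + gue_basis n (Inr p) i j * gue_basis n (Inr p) k l
      = (if i = l \<and> j = k then 1 / of_nat n else 0)" .
  next
    case 3
    have "gue_basis n (Inl p) i j * gue_basis n (Inl p) k l + gue_basis n (Inr p) i j * gue_basis n (Inr p) k l
       = 1 / of_real m - e * e / of_real (2 * real n)"
      unfolding 3 l r times_divide_times_eq sq by simp
    also have "\<dots> = (if i = l \<and> j = k then 1 / of_nat n else 0)"
      unfolding 3 by (cases i j rule: linorder_cases) (use n in \<open>simp_all add: m_def e_def\<close>)
    finally show "gue_basis n (Inl p) i j * gue_basis n (Inl p) k l + gue_basis n (Inr p) i j * gue_basis n (Inr p) k l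
      = (if i = l \<and> j = k then 1 / of_nat n else 0)" .
  qed
qed

section \<open>The resolvent at the subordinated point\<close>

definition deformed_gue :: "nat \<Rightarrow> (nat \<Rightarrow> real) \<Rightarrow> (gue_index \<Rightarrow> real) \<Rightarrow> cmatrix" where
  "deformed_gue n a \<xi> i j = of_real (a i) * id_matrix i j + gue n \<xi> i j"

lemma deformed_gue_hermitian: "hermitian n (deformed_gue n a \<xi>)"
  unfolding hermitian_def
proof (intro allI impI)
  fix i j
  have "gue n \<xi> j i = cnj (gue n \<xi> i j)" by (rule gue_hermitian)
  then show "deformed_gue n a \<xi> j i = cnj (deformed_gue n a \<xi> i j)" by (simp add: deformed_gue_def id_matrix_def)
qed

lemma gue_update:
  assumes "\<alpha> \<in> gue_indices n"
  shows "gue n (\<xi>(\<alpha> := s')) i j - gue n (\<xi>(\<alpha> := s)) i j = of_real (s' - s) * gue_basis n \<alpha> i j"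
proof -
  have "gue n (\<xi>(\<alpha> := r)) i j = of_real r * gue_basis n \<alpha> i j + (\<Sum>\<beta>\<in>gue_indices n - {\<alpha>}. of_real (\<xi> \<beta>) * gue_basis n \<beta> i j)" for r
    unfolding gue_def by (subst sum.remove[OF finite_gue_indices assms]) (auto intro!: sum.cong)
  then show ?thesis by (simp add: algebra_simps)
qed

lemma integral_double_sum:
  fixes f :: "nat \<Rightarrow> nat \<Rightarrow> 'b \<Rightarrow> complex"
  assumes "\<And>i j. i < n \<Longrightarrow> j < n \<Longrightarrow> integrable M (f i j)"
  shows "integrable M (\<lambda>\<xi>. \<Sum>i<n. \<Sum>j<n. f i j \<xi>)"
    and "(\<integral>\<xi>. (\<Sum>i<n. \<Sum>j<n. f i j \<xi>) \<partial>M) = (\<Sum>i<n. \<Sum>j<n. (\<integral>\<xi>. f i j \<xi> \<partial>M))"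
proof -
  show "integrable M (\<lambda>\<xi>. \<Sum>i<n. \<Sum>j<n. f i j \<xi>)"
    by (intro Bochner_Integration.integrable_sum assms) auto
  have "(\<integral>\<xi>. (\<Sum>i<n. \<Sum>j<n. f i j \<xi>) \<partial>M) = (\<Sum>i<n. (\<integral>\<xi>. (\<Sum>j<n. f i j \<xi>) \<partial>M))"
    by (intro Bochner_Integration.integral_sum Bochner_Integration.integrable_sum assms) auto
  also have "\<dots> = (\<Sum>i<n. \<Sum>j<n. (\<integral>\<xi>. f i j \<xi> \<partial>M))"
    by (intro sum.cong refl Bochner_Integration.integral_sum assms) auto
  finally show "(\<integral>\<xi>. (\<Sum>i<n. \<Sum>j<n. f i j \<xi>) \<partial>M) = (\<Sum>i<n. \<Sum>j<n. (\<integral>\<xi>. f i j \<xi> \<partial>M))" .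
qed

text \<open>
  The height \<open>2 \<surd>t\<close> enters only through the strict inequality \<open>4 t < \<gamma>\<^sup>2\<close>.
\<close>

lemma strip_height:
  fixes t \<gamma> :: real
  assumes t: "t > 0" and \<gamma>: "\<gamma> > 2 * sqrt t"
  shows "\<gamma> > 0" "4 * t < \<gamma>\<^sup>2"
proof -
  have "sqrt t > 0" using t by simp
  then show "\<gamma> > 0" using \<gamma> by linarith
  have "(2 * sqrt t)\<^sup>2 < \<gamma>\<^sup>2" using \<gamma> t by (intro power_strict_mono) auto
  then show "4 * t < \<gamma>\<^sup>2" using t by (simp add: power_mult_distrib)
qed

text \<open>
  The eigenvalues \<open>a\<close> of the initial matrix are frozen here and only the noise is random. The shift \<open>b\<close>
  stands for \<open>t G(z)\<close>; of \<open>G\<close> only the bound \<open>|G(z)| \<le> 1/\<gamma>\<close> is kept. In the notation of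
  the introduction, \<open>R\<close> is the resolvent at \<open>w = z + b\<close>, \<open>q\<close> the diagonal of \<open>Q\<close>, and \<open>g\<close>, \<open>u\<close>
  are the normalised traces of \<open>R\<close> and \<open>QR\<close>; the factor \<open>1\<close> in \<open>g\<close> makes both of them weighted
  traces of the same form. The noise term \<open>N\<close> is written without \<open>H\<close>, which
  shows that it is a bounded function.
\<close>

locale subordinated_resolvent =
  fixes n :: nat and a :: "nat \<Rightarrow> real" and t \<gamma> :: real and z b :: complex
  assumes n: "n > 0" and t: "t > 0" and \<gamma>: "\<gamma> > 2 * sqrt t" and z: "Im z = \<gamma>" and b: "cmod b \<le> t / \<gamma>"
begin

definition P :: "(gue_index \<Rightarrow> real) measure" where "P = Pi\<^sub>M (gue_indices n) (\<lambda>_. gaussian (sqrt t))"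
definition w :: complex where "w = z + b"
definition R :: "(gue_index \<Rightarrow> real) \<Rightarrow> cmatrix" where "R \<xi> = resolvent n (deformed_gue n a \<xi>) w"
definition q :: "nat \<Rightarrow> complex" where "q i = 1 / (z - of_real (a i))"
definition g :: "(gue_index \<Rightarrow> real) \<Rightarrow> complex" where "g \<xi> = (\<Sum>i<n. 1 * R \<xi> i i) * inverse (of_nat n)"
definition u :: "(gue_index \<Rightarrow> real) \<Rightarrow> complex" where "u \<xi> = (\<Sum>i<n. q i * R \<xi> i i) * inverse (of_nat n)"
definition N :: "(gue_index \<Rightarrow> real) \<Rightarrow> complex" where
  "N \<xi> = g \<xi> - (\<Sum>i<n. q i) * inverse (of_nat n) - (of_real t * g \<xi> - b) * u \<xi>"

lemmas \<gamma>_pos = strip_height(1)[OF t \<gamma>] and t_less = strip_height(2)[OF t \<gamma>]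

lemma t_div_\<gamma>: "t / \<gamma> \<le> \<gamma> / 4"
  using t_less \<gamma>_pos by (simp add: field_simps power2_eq_square)

lemma Im_w: "Im w \<ge> \<gamma> / 2" "Im w > 0"
proof -
  have "\<bar>Im b\<bar> \<le> \<gamma> / 4" using t_div_\<gamma> b abs_Im_le_cmod[of b] by linarith
  moreover have "Im w = \<gamma> + Im b" using z by (simp add: w_def)
  ultimately show "Im w \<ge> \<gamma> / 2" "Im w > 0" using \<gamma>_pos by linarith+
qed

lemma norm_q: "cmod (q i) \<le> 1 / \<gamma>"
proof -
  have "\<gamma> \<le> cmod (z - of_real (a i))" using abs_Im_le_cmod[of "z - of_real (a i)"] z by simp
  then show ?thesis using \<gamma>_pos by (simp add: q_def norm_divide frac_le)
qed

lemma pencil_R: "i < n \<Longrightarrow> j < n \<Longrightarrow> mmul n (pencil (deformed_gue n a \<xi>) w) (R \<xi>) i j = id_matrix i j"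
  unfolding R_def by (rule resolvent_inverse(1)[OF deformed_gue_hermitian]) (use Im_w in auto)

lemma hs_R_mmul: "hs_norm n (mmul n (R \<xi>) M) \<le> 2 / \<gamma> * hs_norm n M"
proof -
  have "\<gamma> / 2 * hs_norm n (mmul n (R \<xi>) M) \<le> \<bar>Im w\<bar> * hs_norm n (mmul n (R \<xi>) M)"
    using Im_w by (intro mult_right_mono) auto
  also have "\<dots> \<le> hs_norm n M"
    unfolding R_def by (rule hs_resolvent_mmul_le[OF deformed_gue_hermitian]) (use Im_w in auto)
  finally show ?thesis using \<gamma>_pos by (simp add: field_simps)
qed

lemma hs_R: "hs_norm n (R \<xi>) \<le> 2 / \<gamma> * sqrt (real n)"
proof -
  have "\<gamma> / 2 * hs_norm n (R \<xi>) \<le> \<bar>Im w\<bar> * hs_norm n (R \<xi>)"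
    using Im_w by (intro mult_right_mono) auto
  also have "\<dots> \<le> sqrt (real n)"
    unfolding R_def by (rule hs_resolvent_le[OF deformed_gue_hermitian]) (use Im_w in auto)
  finally show ?thesis using \<gamma>_pos by (simp add: field_simps)
qed

lemma hs_q_mult: "hs_norm n (\<lambda>i j. q i * M i j) \<le> 1 / \<gamma> * hs_norm n M" "hs_norm n (\<lambda>i j. q j * M i j) \<le> 1 / \<gamma> * hs_norm n M"
proof -
  have eq: "hs_norm n (\<lambda>i j. of_real (1 / \<gamma>) * M i j) = 1 / \<gamma> * hs_norm n M"
    unfolding hs_scale using \<gamma>_pos by (simp add: norm_divide)
  have le: "cmod (q k * M i j) \<le> cmod (of_real (1 / \<gamma>) * M i j)" for i j k
    unfolding norm_mult using norm_q[of k] \<gamma>_pos by (intro mult_right_mono) (auto simp: norm_divide)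
  show "hs_norm n (\<lambda>i j. q i * M i j) \<le> 1 / \<gamma> * hs_norm n M"
    unfolding eq[symmetric] unfolding hs_norm_def by (rule L2_set_mono) (auto simp only: le split_beta norm_ge_zero)
  show "hs_norm n (\<lambda>i j. q j * M i j) \<le> 1 / \<gamma> * hs_norm n M"
    unfolding eq[symmetric] unfolding hs_norm_def by (rule L2_set_mono) (auto simp only: le split_beta norm_ge_zero)
qed

lemma norm_g: "cmod (g \<xi>) \<le> 2 / \<gamma>"
proof -
  have "cmod (mat_trace n (R \<xi>)) \<le> sqrt (real n) * (2 / \<gamma> * sqrt (real n))"
    by (rule order_trans[OF norm_tr_le mult_left_mono[OF hs_R]]) simp
  also have "\<dots> = 2 / \<gamma> * real n" by simp
  finally show ?thesis using n by (simp add: g_def mat_trace_def norm_mult norm_divide divide_inverse[symmetric] field_simps)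
qed

lemma norm_u: "cmod (u \<xi>) \<le> 2 / \<gamma>\<^sup>2"
proof -
  have "cmod (mat_trace n (\<lambda>i j. q i * R \<xi> i j)) \<le> sqrt (real n) * (1 / \<gamma> * (2 / \<gamma> * sqrt (real n)))"
    by (rule order_trans[OF norm_tr_le mult_left_mono[OF order_trans[OF hs_q_mult(1) mult_left_mono[OF hs_R]]]])
      (use \<gamma>_pos in auto)
  also have "\<dots> = 2 / \<gamma>\<^sup>2 * real n" by (simp add: power2_eq_square)
  finally show ?thesis using n by (simp add: u_def mat_trace_def norm_mult norm_divide divide_inverse[symmetric] field_simps)
qed

text \<open>
  The diagonal of \<open>(w - A - H) R = 1\<close> reads \<open>(HR)\<^sub>i\<^sub>i = (w - a\<^sub>i) R\<^sub>i\<^sub>i - 1\<close>, and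
  \<open>q\<^sub>i (w - a\<^sub>i) = 1 + b q\<^sub>i\<close>. In this form \<open>N\<close> contains the factor \<open>H\<close> on which
  integration by parts can act.
\<close>

lemma N_eq_centered_product:
  "N \<xi> = (\<Sum>i<n. q i * (\<Sum>j<n. gue n \<xi> i j * R \<xi> j i)) * inverse (of_nat n) - of_real t * g \<xi> * u \<xi>"
proof -
  have "q i * (\<Sum>j<n. gue n \<xi> i j * R \<xi> j i) = 1 * R \<xi> i i + b * (q i * R \<xi> i i) - q i" if i: "i < n" for i
  proof -
    have "mmul n (deformed_gue n a \<xi>) (R \<xi>) i i = mmul n (\<lambda>i j. of_real (a i) * id_matrix i j) (R \<xi>) i i + (\<Sum>j<n. gue n \<xi> i j * R \<xi> j i)"
      by (simp add: mmul_def deformed_gue_def distrib_right sum.distrib)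
    also have "mmul n (\<lambda>i j. of_real (a i) * id_matrix i j) (R \<xi>) i i = of_real (a i) * mmul n id_matrix (R \<xi>) i i"
      by (simp add: mmul_def sum_distrib_left mult.assoc)
    finally have e: "(\<Sum>j<n. gue n \<xi> i j * R \<xi> j i) = (z - of_real (a i) + b) * R \<xi> i i - 1"
      using pencil_R[OF i i, of \<xi>] i by (simp add: mmul_pencil mmul_idm id_matrix_def w_def algebra_simps)
    have "z - of_real (a i) \<noteq> 0" using z \<gamma>_pos by (auto simp: complex_eq_iff)
    then have q: "q i * (z - of_real (a i)) = 1" by (simp add: q_def)
    have "q i * ((z - of_real (a i) + b) * R \<xi> i i - 1) = (q i * (z - of_real (a i))) * R \<xi> i i + b * (q i * R \<xi> i i) - q i"
      by (simp add: algebra_simps)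
    then show ?thesis unfolding e q .
  qed
  then have "(\<Sum>i<n. q i * (\<Sum>j<n. gue n \<xi> i j * R \<xi> j i)) = (\<Sum>i<n. 1 * R \<xi> i i + b * (q i * R \<xi> i i) - q i)"
    by (intro sum.cong) auto
  also have "\<dots> = (\<Sum>i<n. 1 * R \<xi> i i) + b * (\<Sum>i<n. q i * R \<xi> i i) - (\<Sum>i<n. q i)"
    by (simp add: sum.distrib sum_subtractf sum_distrib_left)
  finally have "(\<Sum>i<n. q i * (\<Sum>j<n. gue n \<xi> i j * R \<xi> j i)) * inverse (of_nat n) 
     = g \<xi> + b * u \<xi> - (\<Sum>i<n. q i) * inverse (of_nat n)"
    unfolding g_def u_def by (simp only: left_diff_distrib distrib_right mult.assoc)
  then show ?thesis unfolding N_def by (simp add: algebra_simps)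
qed

lemma prob_space_P: "prob_space P"
  unfolding P_def by (rule prob_space_PiM, rule prob_space_normal_density) (use t in auto)

lemma bounded_measurable_R:
  assumes "i < n" "j < n"
  shows "bounded_measurable P (\<lambda>\<xi>. R \<xi> i j)"
  unfolding bounded_measurable_def
proof
  show "\<exists>C. \<forall>\<xi>. cmod (R \<xi> i j) \<le> C"
    using order_trans[OF entry_le_hs[OF assms] hs_R] by blast
  have "(\<lambda>\<xi>. \<xi> \<alpha>) \<in> borel_measurable P" if "\<alpha> \<in> gue_indices n" for \<alpha>
    using measurable_component_singleton[OF that, of "\<lambda>_. gaussian (sqrt t)"] by (simp add: P_def)
  then have "(\<lambda>\<xi>. deformed_gue n a \<xi> k l) \<in> borel_measurable P" for k l
    unfolding deformed_gue_def gue_def by measurable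
  then show "(\<lambda>\<xi>. R \<xi> i j) \<in> borel_measurable P"
    unfolding R_def by (intro borel_measurable_resolvent assms) auto
qed

lemma bounded_measurable_g: "bounded_measurable P g"
  unfolding g_def[abs_def] by (intro bounded_measurable_intros bounded_measurable_R) auto

lemma bounded_measurable_u: "bounded_measurable P u"
  unfolding u_def[abs_def] by (intro bounded_measurable_intros bounded_measurable_R) auto

lemma bounded_measurable_N: "bounded_measurable P N"
  unfolding N_def[abs_def] by (intro bounded_measurable_intros bounded_measurable_g bounded_measurable_u)

text \<open>
  Derivatives along the coordinate \<open>\<alpha>\<close>: of the resolvent, of its weighted traces, and of \<open>N\<close>.
\<close>

definition DR :: "gue_index \<Rightarrow> (gue_index \<Rightarrow> real) \<Rightarrow> cmatrix" where
  "DR \<alpha> \<xi> = mmul n (R \<xi>) (mmul n (gue_basis n \<alpha>) (R \<xi>))"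
definition Dtr :: "(nat \<Rightarrow> complex) \<Rightarrow> gue_index \<Rightarrow> (gue_index \<Rightarrow> real) \<Rightarrow> complex" where
  "Dtr c \<alpha> \<xi> = (\<Sum>i<n. c i * DR \<alpha> \<xi> i i) * inverse (of_nat n)"
definition DN :: "gue_index \<Rightarrow> (gue_index \<Rightarrow> real) \<Rightarrow> complex" where
  "DN \<alpha> \<xi> = Dtr (\<lambda>_. 1) \<alpha> \<xi> - ((of_real t * g \<xi> - b) * Dtr q \<alpha> \<xi> + of_real t * Dtr (\<lambda>_. 1) \<alpha> \<xi> * u \<xi>)"

lemma R_deriv:
  assumes "\<alpha> \<in> gue_indices n" "i < n" "j < n"
  shows "((\<lambda>s. R (\<xi>(\<alpha> := s)) i j) has_vector_derivative DR \<alpha> (\<xi>(\<alpha> := s)) i j) (at s)"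
  unfolding R_def DR_def
proof (rule resolvent_has_derivative[where X = "\<lambda>s. deformed_gue n a (\<xi>(\<alpha> := s))"])
  show "deformed_gue n a (\<xi>(\<alpha> := s')) i j - deformed_gue n a (\<xi>(\<alpha> := s)) i j = of_real (s' - s) * gue_basis n \<alpha> i j" for s s' i j
    using gue_update[OF assms(1), of \<xi> s' i j s] by (simp add: deformed_gue_def)
qed (use assms Im_w deformed_gue_hermitian in auto)

lemma weighted_trace_deriv:
  assumes \<alpha>: "\<alpha> \<in> gue_indices n"
  shows "((\<lambda>s. (\<Sum>i<n. c i * R (\<xi>(\<alpha> := s)) i i) * inverse (of_nat n)) has_vector_derivative Dtr c \<alpha> (\<xi>(\<alpha> := s))) (at s)"
  unfolding Dtr_def
  by (intro bounded_linear.has_vector_derivative[OF bounded_linear_mult_left] has_vector_derivative_sum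
      bounded_linear.has_vector_derivative[OF bounded_linear_mult_right] R_deriv \<alpha>) auto

lemma g_deriv: "\<alpha> \<in> gue_indices n \<Longrightarrow> ((\<lambda>s. g (\<xi>(\<alpha> := s))) has_vector_derivative Dtr (\<lambda>_. 1) \<alpha> (\<xi>(\<alpha> := s))) (at s)"
  unfolding g_def by (rule weighted_trace_deriv)

lemma u_deriv: "\<alpha> \<in> gue_indices n \<Longrightarrow> ((\<lambda>s. u (\<xi>(\<alpha> := s))) has_vector_derivative Dtr q \<alpha> (\<xi>(\<alpha> := s))) (at s)"
  unfolding u_def by (rule weighted_trace_deriv)

lemma N_deriv:
  assumes \<alpha>: "\<alpha> \<in> gue_indices n"
  shows "((\<lambda>s. N (\<xi>(\<alpha> := s))) has_vector_derivative DN \<alpha> (\<xi>(\<alpha> := s))) (at s)"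
proof -
  have "((\<lambda>s. of_real t * g (\<xi>(\<alpha> := s)) - b) has_vector_derivative of_real t * Dtr (\<lambda>_. 1) \<alpha> (\<xi>(\<alpha> := s)) - 0) (at s)"
    by (intro has_vector_derivative_diff has_vector_derivative_const
      bounded_linear.has_vector_derivative[OF bounded_linear_mult_right] g_deriv \<alpha>)
  then have "((\<lambda>s. (of_real t * g (\<xi>(\<alpha> := s)) - b) * u (\<xi>(\<alpha> := s))) has_vector_derivative
     (of_real t * g (\<xi>(\<alpha> := s)) - b) * Dtr q \<alpha> (\<xi>(\<alpha> := s)) + (of_real t * Dtr (\<lambda>_. 1) \<alpha> (\<xi>(\<alpha> := s)) - 0) * u (\<xi>(\<alpha> := s))) (at s)"
    by (intro has_vector_derivative_mult u_deriv \<alpha>)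
  moreover have "((\<lambda>s. g (\<xi>(\<alpha> := s)) - (\<Sum>i<n. q i) * inverse (of_nat n)) has_vector_derivative Dtr (\<lambda>_. 1) \<alpha> (\<xi>(\<alpha> := s)) - 0) (at s)"
    by (intro has_vector_derivative_diff has_vector_derivative_const g_deriv \<alpha>)
  ultimately show ?thesis
    unfolding N_def DN_def using has_vector_derivative_diff by fastforce
qed

lemma isCont_line:
  assumes \<alpha>: "\<alpha> \<in> gue_indices n"
  shows "i < n \<Longrightarrow> j < n \<Longrightarrow> isCont (\<lambda>s. R (\<xi>(\<alpha> := s)) i j) s"
    "i < n \<Longrightarrow> j < n \<Longrightarrow> isCont (\<lambda>s. DR \<alpha> (\<xi>(\<alpha> := s)) i j) s"
    "isCont (\<lambda>s. g (\<xi>(\<alpha> := s))) s" "isCont (\<lambda>s. u (\<xi>(\<alpha> := s))) s" "isCont (\<lambda>s. N (\<xi>(\<alpha> := s))) s"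
    "isCont (\<lambda>s. DN \<alpha> (\<xi>(\<alpha> := s))) s"
proof -
  show R: "isCont (\<lambda>s. R (\<xi>(\<alpha> := s)) i j) s" if "i < n" "j < n" for i j
    by (rule has_vector_derivative_continuous[OF R_deriv[OF \<alpha> that]])
  show DR: "isCont (\<lambda>s. DR \<alpha> (\<xi>(\<alpha> := s)) i j) s" if "i < n" "j < n" for i j
    unfolding DR_def mmul_def by (intro continuous_intros R that) auto
  have D: "isCont (\<lambda>s. Dtr c \<alpha> (\<xi>(\<alpha> := s))) s" for c
    unfolding Dtr_def by (intro continuous_intros DR) auto
  show g: "isCont (\<lambda>s. g (\<xi>(\<alpha> := s))) s" by (rule has_vector_derivative_continuous[OF g_deriv[OF \<alpha>]])
  show u: "isCont (\<lambda>s. u (\<xi>(\<alpha> := s))) s" by (rule has_vector_derivative_continuous[OF u_deriv[OF \<alpha>]])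
  show N: "isCont (\<lambda>s. N (\<xi>(\<alpha> := s))) s" by (rule has_vector_derivative_continuous[OF N_deriv[OF \<alpha>]])
  show "isCont (\<lambda>s. DN \<alpha> (\<xi>(\<alpha> := s))) s"
    unfolding DN_def by (intro continuous_intros D g u)
qed

lemma bounded_measurable_DR:
  "i < n \<Longrightarrow> j < n \<Longrightarrow> bounded_measurable P (\<lambda>\<xi>. DR \<alpha> \<xi> i j)"
  unfolding DR_def mmul_def by (intro bounded_measurable_intros bounded_measurable_R) auto

lemma bounded_measurable_DN: "bounded_measurable P (DN \<alpha>)"
  unfolding DN_def[abs_def] Dtr_def
  by (intro bounded_measurable_intros bounded_measurable_DR bounded_measurable_g bounded_measurable_u) auto

text \<open>
  The gradient of \<open>N\<close> arranged as a matrix: its derivative along a basis matrix \<open>E\<close> is the trace of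
  \<open>E\<close> times this matrix. It is \<open>((1 - t u) R R - (t g - b) R Q R) / n\<close>.
\<close>

definition grad :: "(gue_index \<Rightarrow> real) \<Rightarrow> cmatrix" where
  "grad \<xi> l k = inverse (of_nat n) * ((1 - of_real t * u \<xi>) * mmul n (R \<xi>) (R \<xi>) l k
     + (- (of_real t * g \<xi> - b)) * mmul n (R \<xi>) (\<lambda>i j. q i * R \<xi> i j) l k)"

lemma Dtr_eq: "Dtr c \<alpha> \<xi> = inverse (of_nat n) * (\<Sum>k<n. \<Sum>l<n. gue_basis n \<alpha> k l * mmul n (R \<xi>) (\<lambda>i j. c i * R \<xi> i j) l k)"
proof -
  have "(\<Sum>i<n. c i * DR \<alpha> \<xi> i i) = (\<Sum>i<n. \<Sum>k<n. \<Sum>l<n. gue_basis n \<alpha> k l * (R \<xi> l i * (c i * R \<xi> i k)))"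
    unfolding DR_def mmul_def sum_distrib_left by (intro sum.cong refl) (simp only: mult_ac)
  also have "\<dots> = (\<Sum>k<n. \<Sum>i<n. \<Sum>l<n. gue_basis n \<alpha> k l * (R \<xi> l i * (c i * R \<xi> i k)))"
    by (rule sum.swap)
  also have "\<dots> = (\<Sum>k<n. \<Sum>l<n. \<Sum>i<n. gue_basis n \<alpha> k l * (R \<xi> l i * (c i * R \<xi> i k)))"
    by (intro sum.cong refl sum.swap)
  also have "\<dots> = (\<Sum>k<n. \<Sum>l<n. gue_basis n \<alpha> k l * mmul n (R \<xi>) (\<lambda>i j. c i * R \<xi> i j) l k)"
    unfolding mmul_def sum_distrib_left ..
  finally show ?thesis by (simp add: Dtr_def mult.commute)
qed

lemma DN_eq: "DN \<alpha> \<xi> = (\<Sum>k<n. \<Sum>l<n. gue_basis n \<alpha> k l * grad \<xi> l k)"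
proof -
  let ?S = "\<lambda>c. (\<Sum>k<n. \<Sum>l<n. gue_basis n \<alpha> k l * mmul n (R \<xi>) (\<lambda>i j. c i * R \<xi> i j) l k)"
  define \<nu> where "\<nu> = inverse (complex_of_nat n)"
  have "DN \<alpha> \<xi> = \<nu> * (1 - of_real t * u \<xi>) * ?S (\<lambda>_. 1) + \<nu> * (- (of_real t * g \<xi> - b)) * ?S q"
    unfolding DN_def Dtr_eq \<nu>_def[symmetric] by (simp add: algebra_simps)
  also have "\<dots> = (\<Sum>k<n. \<Sum>l<n. gue_basis n \<alpha> k l * grad \<xi> l k)"
    unfolding grad_def \<nu>_def[symmetric] sum_distrib_left sum.distrib[symmetric]
    by (intro sum.cong refl) (simp add: algebra_simps)
  finally show ?thesis .
qed

text \<open>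
  Every factor except one resolvent is bounded in operator norm by a power of \<open>1/\<gamma>\<close>; the remaining one is
  kept in Hilbert-Schmidt norm, because that norm has an integrable square in \<open>x\<close>.
\<close>

lemma hs_grad: "hs_norm n (grad \<xi>) \<le> 6 / \<gamma> / real n * hs_norm n (R \<xi>)"
proof -
  let ?A = "mmul n (R \<xi>) (R \<xi>)" and ?B = "mmul n (R \<xi>) (\<lambda>i j. q i * R \<xi> i j)"
  have t': "t * (2 / \<gamma>\<^sup>2) \<le> 1" using t_less t \<gamma>_pos by (simp add: field_simps)
  have "cmod (1 - of_real t * u \<xi>) \<le> 1 + t * (2 / \<gamma>\<^sup>2)"
    using t mult_left_mono[OF norm_u[of \<xi>], of t]
    by (intro order_trans[OF norm_triangle_ineq4]) (simp add: norm_mult)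
  then have 1: "cmod (1 - of_real t * u \<xi>) \<le> 2" using t' by linarith
  have "cmod (- (of_real t * g \<xi> - b)) \<le> t * (2 / \<gamma>) + t / \<gamma>"
    unfolding norm_minus_cancel using t mult_left_mono[OF norm_g[of \<xi>], of t] b
    by (intro order_trans[OF norm_triangle_ineq4] add_mono) (simp_all add: norm_mult)
  also have "\<dots> = 3 * (t / \<gamma>)" by simp
  also have "\<dots> \<le> \<gamma>" using t_div_\<gamma> \<gamma>_pos by linarith
  finally have 2: "cmod (- (of_real t * g \<xi> - b)) \<le> \<gamma>" .
  have 3: "hs_norm n ?A \<le> 2 / \<gamma> * hs_norm n (R \<xi>)" by (rule hs_R_mmul)
  have 4: "hs_norm n ?B \<le> 2 / \<gamma> * (1 / \<gamma> * hs_norm n (R \<xi>))"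
    by (rule order_trans[OF hs_R_mmul mult_left_mono[OF hs_q_mult(1)]]) (use \<gamma>_pos in auto)
  have "hs_norm n (grad \<xi>) = inverse (real n) * hs_norm n (\<lambda>l k. (1 - of_real t * u \<xi>) * ?A l k + (- (of_real t * g \<xi> - b)) * ?B l k)"
    unfolding grad_def hs_scale by (simp add: norm_inverse)
  also have "\<dots> \<le> inverse (real n) * (2 * (2 / \<gamma> * hs_norm n (R \<xi>)) + \<gamma> * (2 / \<gamma> * (1 / \<gamma> * hs_norm n (R \<xi>))))"
    by (intro mult_left_mono order_trans[OF hs_add] add_mono, unfold hs_scale)
      (intro mult_mono 1 2 3 4 hs_nonneg norm_ge_zero | use \<gamma>_pos in simp)+
  also have "\<dots> = 6 / \<gamma> / real n * hs_norm n (R \<xi>)" using \<gamma>_pos n by (simp add: field_simps)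
  finally show ?thesis .
qed

text \<open>
  Integration by parts in all coordinates at once. The derivative of \<open>R\<^sub>j\<^sub>i\<close> produces the diagonal product
  \<open>R\<^sub>j\<^sub>j R\<^sub>i\<^sub>i\<close>, and that of the conjugate of \<open>N\<close> its gradient, both by the completeness relation.
\<close>

lemma stein_entry:
  assumes ij: "i < n" "j < n"
  shows "(\<integral>\<xi>. gue n \<xi> i j * (R \<xi> j i * cnj (N \<xi>)) \<partial>P)
     = of_real t * (\<integral>\<xi>. inverse (of_nat n) * (R \<xi> j j * R \<xi> i i * cnj (N \<xi>) + R \<xi> j i * cnj (grad \<xi> j i)) \<partial>P)"
    and "integrable P (\<lambda>\<xi>. gue n \<xi> i j * (R \<xi> j i * cnj (N \<xi>)))"
proof -
  interpret P: prob_space P by (rule prob_space_P)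
  let ?E = "gue_basis n"
  define F where "F \<xi> = R \<xi> j i * cnj (N \<xi>)" for \<xi>
  define F' where "F' \<alpha> \<xi> = R \<xi> j i * cnj (DN \<alpha> \<xi>) + DR \<alpha> \<xi> j i * cnj (N \<xi>)" for \<alpha> \<xi>
  have bF: "bounded_measurable P F"
    unfolding F_def[abs_def] by (intro bounded_measurable_intros bounded_measurable_R bounded_measurable_N ij)
  have bF': "bounded_measurable P (F' \<alpha>)" for \<alpha>
    unfolding F'_def[abs_def]
    by (intro bounded_measurable_intros bounded_measurable_R bounded_measurable_N bounded_measurable_DR bounded_measurable_DN ij)
  have st: "(\<integral>\<xi>. of_real (\<xi> \<alpha>) * F \<xi> \<partial>P) = of_real t * (\<integral>\<xi>. F' \<alpha> \<xi> \<partial>P)" if \<alpha>: "\<alpha> \<in> gue_indices n" for \<alpha>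
  proof -
    have "((\<lambda>s. F (\<xi>(\<alpha> := s))) has_vector_derivative F' \<alpha> (\<xi>(\<alpha> := s))) (at s)" for \<xi> s
      unfolding F_def F'_def
      by (intro has_vector_derivative_mult bounded_linear.has_vector_derivative[OF bounded_linear_cnj] R_deriv N_deriv \<alpha> ij)
    moreover have "isCont (\<lambda>s. F' \<alpha> (\<xi>(\<alpha> := s))) s" for \<xi> s
      unfolding F'_def by (intro continuous_intros isCont_line \<alpha> ij)
    ultimately show ?thesis
      using stein_product[OF _ finite_gue_indices \<alpha>, of "sqrt t" F "F' \<alpha>"] bF bF' t by (simp add: P_def)
  qed
  have int\<alpha>: "integrable P (\<lambda>\<xi>. of_real (\<xi> \<alpha>) * F \<xi>)" if "\<alpha> \<in> gue_indices n" for \<alpha>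
    using gaussian_product_coordinate_integrable[OF _ finite_gue_indices that, of "sqrt t" F] bF t by (simp add: P_def)
  have exp: "gue n \<xi> i j * F \<xi> = (\<Sum>\<alpha>\<in>gue_indices n. ?E \<alpha> i j * (of_real (\<xi> \<alpha>) * F \<xi>))" for \<xi>
    unfolding gue_def sum_distrib_right by (intro sum.cong refl) (simp only: mult_ac)
  show "integrable P (\<lambda>\<xi>. gue n \<xi> i j * (R \<xi> j i * cnj (N \<xi>)))"
    unfolding F_def[symmetric] exp by (intro Bochner_Integration.integrable_sum integrable_mult_right int\<alpha>)
  have sum1: "(\<Sum>\<alpha>\<in>gue_indices n. ?E \<alpha> i j * DR \<alpha> \<xi> j i) = inverse (of_nat n) * (R \<xi> j j * R \<xi> i i)" for \<xi>
  proof -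
    have "(\<Sum>\<alpha>\<in>gue_indices n. ?E \<alpha> i j * DR \<alpha> \<xi> j i)
       = (\<Sum>\<alpha>\<in>gue_indices n. \<Sum>k<n. \<Sum>l<n. (?E \<alpha> i j * ?E \<alpha> k l) * (R \<xi> j k * R \<xi> l i))"
      unfolding DR_def mmul_def sum_distrib_left by (intro sum.cong refl) (simp only: mult_ac)
    also have "\<dots> = (\<Sum>k<n. \<Sum>l<n. \<Sum>\<alpha>\<in>gue_indices n. (?E \<alpha> i j * ?E \<alpha> k l) * (R \<xi> j k * R \<xi> l i))"
      by (subst sum.swap, intro sum.cong refl, rule sum.swap)
    also have "\<dots> = (\<Sum>k<n. \<Sum>l<n. (if i = l \<and> j = k then 1 / of_nat n else 0) * (R \<xi> j k * R \<xi> l i))"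
      unfolding sum_distrib_right[symmetric] using gue_basis_completeness[OF ij]
      by (intro sum.cong refl arg_cong2[where f = "(*)"]) auto
    also have "\<dots> = (\<Sum>k<n. if j = k then \<Sum>l<n. if i = l then 1 / of_nat n * (R \<xi> j k * R \<xi> l i) else 0 else 0)"
      by (intro sum.cong refl) (auto intro!: sum.cong simp del: sum.delta sum.delta')
    finally show ?thesis
      using ij by (simp only: sum.delta' finite_lessThan lessThan_iff if_True inverse_eq_divide)
  qed
  have sum2: "(\<Sum>\<alpha>\<in>gue_indices n. ?E \<alpha> i j * cnj (DN \<alpha> \<xi>)) = inverse (of_nat n) * cnj (grad \<xi> j i)" for \<xi>
  proof -
    have "cnj (?E \<alpha> k l) = ?E \<alpha> l k" for \<alpha> k l by (rule gue_basis_hermitian[symmetric])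
    then have "(\<Sum>\<alpha>\<in>gue_indices n. ?E \<alpha> i j * cnj (DN \<alpha> \<xi>))
       = (\<Sum>\<alpha>\<in>gue_indices n. \<Sum>k<n. \<Sum>l<n. (?E \<alpha> i j * ?E \<alpha> l k) * cnj (grad \<xi> l k))"
      unfolding DN_eq sum_distrib_left cnj_sum complex_cnj_mult by (intro sum.cong refl) (simp only: mult_ac)
    also have "\<dots> = (\<Sum>k<n. \<Sum>l<n. \<Sum>\<alpha>\<in>gue_indices n. (?E \<alpha> i j * ?E \<alpha> l k) * cnj (grad \<xi> l k))"
      by (subst sum.swap, intro sum.cong refl, rule sum.swap)
    also have "\<dots> = (\<Sum>k<n. \<Sum>l<n. (if i = k \<and> j = l then 1 / of_nat n else 0) * cnj (grad \<xi> l k))"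
      unfolding sum_distrib_right[symmetric] using gue_basis_completeness[OF ij]
      by (intro sum.cong refl arg_cong2[where f = "(*)"]) auto
    also have "\<dots> = (\<Sum>k<n. if i = k then \<Sum>l<n. if j = l then 1 / of_nat n * cnj (grad \<xi> l k) else 0 else 0)"
      by (intro sum.cong refl) (auto intro!: sum.cong simp del: sum.delta sum.delta')
    finally show ?thesis
      using ij by (simp only: sum.delta' finite_lessThan lessThan_iff if_True inverse_eq_divide)
  qed
  have "(\<integral>\<xi>. gue n \<xi> i j * F \<xi> \<partial>P) = (\<Sum>\<alpha>\<in>gue_indices n. ?E \<alpha> i j * (\<integral>\<xi>. of_real (\<xi> \<alpha>) * F \<xi> \<partial>P))"
    unfolding exp by (subst Bochner_Integration.integral_sum) (auto intro!: integrable_mult_right int\<alpha>)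
  also have "\<dots> = (\<Sum>\<alpha>\<in>gue_indices n. of_real t * (\<integral>\<xi>. ?E \<alpha> i j * F' \<alpha> \<xi> \<partial>P))"
    by (intro sum.cong refl) (simp only: st integral_mult_right_zero mult.left_commute)
  also have "\<dots> = of_real t * (\<integral>\<xi>. (\<Sum>\<alpha>\<in>gue_indices n. ?E \<alpha> i j * F' \<alpha> \<xi>) \<partial>P)"
    unfolding sum_distrib_left[symmetric]
    by (subst Bochner_Integration.integral_sum) (auto intro!: bounded_measurable_intros P.bounded_measurable_integrable bF')
  also have "(\<lambda>\<xi>. (\<Sum>\<alpha>\<in>gue_indices n. ?E \<alpha> i j * F' \<alpha> \<xi>)) = (\<lambda>\<xi>. inverse (of_nat n) * (R \<xi> j j * R \<xi> i i * cnj (N \<xi>) + R \<xi> j i * cnj (grad \<xi> j i)))"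
  proof
    fix \<xi>
    have "(\<Sum>\<alpha>\<in>gue_indices n. ?E \<alpha> i j * F' \<alpha> \<xi>)
       = R \<xi> j i * (\<Sum>\<alpha>\<in>gue_indices n. ?E \<alpha> i j * cnj (DN \<alpha> \<xi>)) + (\<Sum>\<alpha>\<in>gue_indices n. ?E \<alpha> i j * DR \<alpha> \<xi> j i) * cnj (N \<xi>)"
      unfolding F'_def sum_distrib_left sum_distrib_right sum.distrib[symmetric]
      by (intro sum.cong refl) (simp add: algebra_simps)
    then show "(\<Sum>\<alpha>\<in>gue_indices n. ?E \<alpha> i j * F' \<alpha> \<xi>) = inverse (of_nat n) * (R \<xi> j j * R \<xi> i i * cnj (N \<xi>) + R \<xi> j i * cnj (grad \<xi> j i))"
      unfolding sum1 sum2 by (simp add: algebra_simps)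
  qed
  finally show "(\<integral>\<xi>. gue n \<xi> i j * (R \<xi> j i * cnj (N \<xi>)) \<partial>P)
     = of_real t * (\<integral>\<xi>. inverse (of_nat n) * (R \<xi> j j * R \<xi> i i * cnj (N \<xi>) + R \<xi> j i * cnj (grad \<xi> j i)) \<partial>P)"
    unfolding F_def .
qed

lemma bounded_measurable_grad: "i < n \<Longrightarrow> j < n \<Longrightarrow> bounded_measurable P (\<lambda>\<xi>. grad \<xi> i j)"
  unfolding grad_def mmul_def minus_diff_eq
  by (intro bounded_measurable_intros bounded_measurable_R bounded_measurable_g bounded_measurable_u) auto

text \<open>
  Summed with the weights \<open>q\<^sub>i\<close>, the diagonal products from integration by parts give exactly
  \<open>t g u\<close> times the conjugate of \<open>N\<close>, which is the term subtracted in \<open>N\<close>. Only the gradient survives.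
\<close>

lemma N_second_moment_identity:
  "(\<integral>\<xi>. N \<xi> * cnj (N \<xi>) \<partial>P)
   = of_real t * inverse (of_nat n) * inverse (of_nat n) * (\<integral>\<xi>. (\<Sum>i<n. \<Sum>j<n. (q i * R \<xi> j i) * cnj (grad \<xi> j i)) \<partial>P)"
proof -
  interpret P: prob_space P by (rule prob_space_P)
  define \<nu> where "\<nu> = inverse (complex_of_nat n)"
  define A where "A i j \<xi> = q i * (R \<xi> j j * R \<xi> i i) * cnj (N \<xi>)" for i j \<xi>
  define B where "B i j \<xi> = (q i * R \<xi> j i) * cnj (grad \<xi> j i)" for i j \<xi>
  have iA: "integrable P (A i j)" if "i < n" "j < n" for i j
    unfolding A_def by (intro P.bounded_measurable_integrable bounded_measurable_intros bounded_measurable_R bounded_measurable_N that)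
  have iB: "integrable P (B i j)" if "i < n" "j < n" for i j
    unfolding B_def by (intro P.bounded_measurable_integrable bounded_measurable_intros bounded_measurable_R bounded_measurable_grad that)
  have iC: "integrable P (\<lambda>\<xi>. of_real t * g \<xi> * u \<xi> * cnj (N \<xi>))"
    by (intro P.bounded_measurable_integrable bounded_measurable_intros bounded_measurable_g bounded_measurable_u bounded_measurable_N)
  have gu: "(\<Sum>i<n. \<Sum>j<n. A i j \<xi>) * (\<nu> * \<nu>) = g \<xi> * u \<xi> * cnj (N \<xi>)" for \<xi>
  proof -
    have "(\<Sum>i<n. \<Sum>j<n. A i j \<xi>) = (\<Sum>i<n. q i * R \<xi> i i) * (\<Sum>j<n. 1 * R \<xi> j j) * cnj (N \<xi>)"
      by (subst sum_product, unfold sum_distrib_right A_def) (intro sum.cong refl, simp add: mult_ac)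
    then show ?thesis by (simp add: g_def u_def \<nu>_def mult_ac)
  qed
  have "(\<integral>\<xi>. N \<xi> * cnj (N \<xi>) \<partial>P) = (\<integral>\<xi>. (\<Sum>i<n. \<Sum>j<n. (q i * \<nu>) * (gue n \<xi> i j * (R \<xi> j i * cnj (N \<xi>)))) - of_real t * g \<xi> * u \<xi> * cnj (N \<xi>) \<partial>P)"
  proof (rule Bochner_Integration.integral_cong[OF refl])
    fix \<xi>
    have "(\<Sum>i<n. q i * (\<Sum>j<n. gue n \<xi> i j * R \<xi> j i)) * \<nu> * cnj (N \<xi>) = (\<Sum>i<n. \<Sum>j<n. (q i * \<nu>) * (gue n \<xi> i j * (R \<xi> j i * cnj (N \<xi>))))"
      unfolding sum_distrib_left sum_distrib_right by (intro sum.cong refl) (simp only: mult_ac)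
    then show "N \<xi> * cnj (N \<xi>) = (\<Sum>i<n. \<Sum>j<n. (q i * \<nu>) * (gue n \<xi> i j * (R \<xi> j i * cnj (N \<xi>)))) - of_real t * g \<xi> * u \<xi> * cnj (N \<xi>)"
      by (subst N_eq_centered_product) (simp add: left_diff_distrib \<nu>_def)
  qed
  also have "\<dots> = (\<Sum>i<n. \<Sum>j<n. (q i * \<nu>) * (\<integral>\<xi>. gue n \<xi> i j * (R \<xi> j i * cnj (N \<xi>)) \<partial>P)) - (\<integral>\<xi>. of_real t * g \<xi> * u \<xi> * cnj (N \<xi>) \<partial>P)"
  proof -
    have iS: "integrable P (\<lambda>\<xi>. (q i * \<nu>) * (gue n \<xi> i j * (R \<xi> j i * cnj (N \<xi>))))" if "i < n" "j < n" for i j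
      by (intro integrable_mult_right stein_entry(2) that)
    show ?thesis
      by (simp only: Bochner_Integration.integral_diff[OF integral_double_sum(1)[OF iS] iC]
          integral_double_sum(2)[OF iS] integral_mult_right_zero)
  qed
  also have "(\<Sum>i<n. \<Sum>j<n. (q i * \<nu>) * (\<integral>\<xi>. gue n \<xi> i j * (R \<xi> j i * cnj (N \<xi>)) \<partial>P))
     = (\<Sum>i<n. \<Sum>j<n. of_real t * (\<nu> * \<nu>) * ((\<integral>\<xi>. A i j \<xi> \<partial>P) + (\<integral>\<xi>. B i j \<xi> \<partial>P)))"
  proof (intro sum.cong refl)
    fix i j assume "i \<in> {..<n}" "j \<in> {..<n}"
    then have ij: "i < n" "j < n" by auto
    have "(q i * \<nu>) * (\<integral>\<xi>. gue n \<xi> i j * (R \<xi> j i * cnj (N \<xi>)) \<partial>P)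
       = of_real t * (\<nu> * \<nu>) * (q i * (\<integral>\<xi>. R \<xi> j j * R \<xi> i i * cnj (N \<xi>) + R \<xi> j i * cnj (grad \<xi> j i) \<partial>P))"
      unfolding stein_entry(1)[OF ij] \<nu>_def[symmetric] integral_mult_right_zero by (simp only: mult_ac)
    also have "q i * (\<integral>\<xi>. R \<xi> j j * R \<xi> i i * cnj (N \<xi>) + R \<xi> j i * cnj (grad \<xi> j i) \<partial>P) = (\<integral>\<xi>. A i j \<xi> + B i j \<xi> \<partial>P)"
      unfolding A_def B_def integral_mult_right_zero[symmetric] by (simp only: distrib_left mult.assoc)
    also have "\<dots> = (\<integral>\<xi>. A i j \<xi> \<partial>P) + (\<integral>\<xi>. B i j \<xi> \<partial>P)"
      by (rule Bochner_Integration.integral_add[OF iA[OF ij] iB[OF ij]])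
    finally show "(q i * \<nu>) * (\<integral>\<xi>. gue n \<xi> i j * (R \<xi> j i * cnj (N \<xi>)) \<partial>P)
      = of_real t * (\<nu> * \<nu>) * ((\<integral>\<xi>. A i j \<xi> \<partial>P) + (\<integral>\<xi>. B i j \<xi> \<partial>P))" .
  qed
  also have "\<dots> = of_real t * (\<nu> * \<nu>) * ((\<integral>\<xi>. (\<Sum>i<n. \<Sum>j<n. A i j \<xi>) \<partial>P) + (\<integral>\<xi>. (\<Sum>i<n. \<Sum>j<n. B i j \<xi>) \<partial>P))"
  proof -
    have "(\<integral>\<xi>. (\<Sum>i<n. \<Sum>j<n. A i j \<xi>) \<partial>P) = (\<Sum>i<n. \<Sum>j<n. (\<integral>\<xi>. A i j \<xi> \<partial>P))"
      "(\<integral>\<xi>. (\<Sum>i<n. \<Sum>j<n. B i j \<xi>) \<partial>P) = (\<Sum>i<n. \<Sum>j<n. (\<integral>\<xi>. B i j \<xi> \<partial>P))"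
      by (rule integral_double_sum(2)[OF iA] integral_double_sum(2)[OF iB]; assumption)+
    then show ?thesis by (simp only: sum_distrib_left[symmetric] sum.distrib)
  qed
  also have "of_real t * (\<nu> * \<nu>) * ((\<integral>\<xi>. (\<Sum>i<n. \<Sum>j<n. A i j \<xi>) \<partial>P) + (\<integral>\<xi>. (\<Sum>i<n. \<Sum>j<n. B i j \<xi>) \<partial>P))
     - (\<integral>\<xi>. of_real t * g \<xi> * u \<xi> * cnj (N \<xi>) \<partial>P) = of_real t * (\<nu> * \<nu>) * (\<integral>\<xi>. (\<Sum>i<n. \<Sum>j<n. B i j \<xi>) \<partial>P)"
  proof -
    have "(\<integral>\<xi>. of_real t * g \<xi> * u \<xi> * cnj (N \<xi>) \<partial>P) = (\<integral>\<xi>. of_real t * (\<nu> * \<nu>) * (\<Sum>i<n. \<Sum>j<n. A i j \<xi>) \<partial>P)"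
    proof (rule Bochner_Integration.integral_cong[OF refl])
      fix \<xi>
      have "of_real t * g \<xi> * u \<xi> * cnj (N \<xi>) = of_real t * (g \<xi> * u \<xi> * cnj (N \<xi>))" by (simp only: mult.assoc)
      then show "of_real t * g \<xi> * u \<xi> * cnj (N \<xi>) = of_real t * (\<nu> * \<nu>) * (\<Sum>i<n. \<Sum>j<n. A i j \<xi>)"
        unfolding gu[symmetric] by (simp only: mult_ac)
    qed
    also have "\<dots> = of_real t * (\<nu> * \<nu>) * (\<integral>\<xi>. (\<Sum>i<n. \<Sum>j<n. A i j \<xi>) \<partial>P)"
      by (rule integral_mult_right_zero)
    finally show ?thesis by (simp add: distrib_left)
  qed
  finally show ?thesis unfolding B_def \<nu>_def by (simp only: mult.assoc)
qed

lemma hs_R_measurable [measurable]: "(\<lambda>\<xi>. hs_norm n (R \<xi>)) \<in> borel_measurable P"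
proof -
  have "(\<lambda>\<xi>. R \<xi> i j) \<in> borel_measurable P" if "i < n" "j < n" for i j
    using bounded_measurable_R[OF that] by (simp add: bounded_measurable_def)
  then have [measurable]: "(\<lambda>\<xi>. \<Sum>i<n. \<Sum>j<n. (cmod (R \<xi> i j))\<^sup>2) \<in> borel_measurable P"
    by (auto intro!: borel_measurable_sum borel_measurable_power borel_measurable_norm)
  have "(\<lambda>\<xi>. sqrt (\<Sum>i<n. \<Sum>j<n. (cmod (R \<xi> i j))\<^sup>2)) \<in> borel_measurable P" by measurable
  moreover have "sqrt (\<Sum>i<n. \<Sum>j<n. (cmod (R \<xi> i j))\<^sup>2) = hs_norm n (R \<xi>)" for \<xi>
    unfolding hs_square[symmetric] by simp
  ultimately show ?thesis by simp
qed

text \<open>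
  Cauchy-Schwarz in the previous identity, with \<open>|q\<^sub>i| \<le> 1/\<gamma>\<close> and the bound on the gradient. Since
  \<open>6 t / \<gamma>\<^sup>2 \<le> 2\<close> the constant does not depend on \<open>t\<close> or \<open>\<gamma>\<close>.
\<close>

lemma noise_second_moment:
  "(\<integral>\<^sup>+\<xi>. ennreal ((cmod (N \<xi>))\<^sup>2) \<partial>P) \<le> ennreal (2 / real n ^ 3) * (\<integral>\<^sup>+\<xi>. ennreal ((hs_norm n (R \<xi>))\<^sup>2) \<partial>P)"
proof -
  interpret P: prob_space P by (rule prob_space_P)
  have iN: "integrable P (\<lambda>\<xi>. (cmod (N \<xi>))\<^sup>2)"
  proof -
    have "integrable P (\<lambda>\<xi>. N \<xi> * cnj (N \<xi>))"
      by (intro P.bounded_measurable_integrable bounded_measurable_intros bounded_measurable_N)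
    then show ?thesis by (simp only: complex_norm_square[symmetric] complex_of_real_integrable_eq)
  qed
  have hs_bd: "(hs_norm n (R \<xi>))\<^sup>2 \<le> (2 / \<gamma> * sqrt (real n))\<^sup>2" for \<xi>
    by (intro power_mono hs_R) simp
  have ihs: "integrable P (\<lambda>\<xi>. (hs_norm n (R \<xi>))\<^sup>2)"
    by (rule P.integrable_const_bound[where B = "(2 / \<gamma> * sqrt (real n))\<^sup>2"]) (use hs_bd in auto)
  let ?T = "\<lambda>\<xi>. (\<Sum>i<n. \<Sum>j<n. (q i * R \<xi> j i) * cnj (grad \<xi> j i))"
  have T: "cmod (?T \<xi>) \<le> 6 / \<gamma>\<^sup>2 / real n * (hs_norm n (R \<xi>))\<^sup>2" for \<xi>
  proof -
    have "cmod (?T \<xi>) \<le> hs_norm n (\<lambda>i j. q i * R \<xi> j i) * hs_norm n (\<lambda>i j. cnj (grad \<xi> j i))"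
      by (rule hs_cauchy_schwarz)
    also have "hs_norm n (\<lambda>i j. cnj (grad \<xi> j i)) = hs_norm n (\<lambda>i j. grad \<xi> j i)" by (simp add: hs_norm_def)
    also have "\<dots> = hs_norm n (grad \<xi>)" by (rule hs_transpose)
    also have "hs_norm n (\<lambda>i j. q i * R \<xi> j i) = hs_norm n (\<lambda>i j. q j * R \<xi> i j)"
      by (rule hs_transpose)
    also have "hs_norm n (\<lambda>i j. q j * R \<xi> i j) * hs_norm n (grad \<xi>) \<le> (1 / \<gamma> * hs_norm n (R \<xi>)) * (6 / \<gamma> / real n * hs_norm n (R \<xi>))"
      by (rule mult_mono[OF hs_q_mult(2) hs_grad]) (use \<gamma>_pos in auto)
    also have "\<dots> = 6 / \<gamma>\<^sup>2 / real n * (hs_norm n (R \<xi>))\<^sup>2" by (simp add: power2_eq_square mult_ac)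
    finally show ?thesis .
  qed
  have "(\<integral>\<xi>. (cmod (N \<xi>))\<^sup>2 \<partial>P) = cmod (complex_of_real (\<integral>\<xi>. (cmod (N \<xi>))\<^sup>2 \<partial>P))"
    by (simp add: abs_of_nonneg)
  also have "complex_of_real (\<integral>\<xi>. (cmod (N \<xi>))\<^sup>2 \<partial>P) = (\<integral>\<xi>. N \<xi> * cnj (N \<xi>) \<partial>P)"
    by (simp only: complex_norm_square[symmetric] integral_complex_of_real)
  also have "cmod \<dots> = t / real n / real n * cmod (\<integral>\<xi>. ?T \<xi> \<partial>P)"
    unfolding N_second_moment_identity using t by (simp add: norm_mult norm_inverse divide_inverse)
  also have "\<dots> \<le> t / real n / real n * (\<integral>\<xi>. 6 / \<gamma>\<^sup>2 / real n * (hs_norm n (R \<xi>))\<^sup>2 \<partial>P)"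
  proof (intro mult_left_mono)
    have iT: "integrable P ?T"
      by (intro P.bounded_measurable_integrable bounded_measurable_intros bounded_measurable_R bounded_measurable_grad) auto
    have "cmod (\<integral>\<xi>. ?T \<xi> \<partial>P) \<le> (\<integral>\<xi>. cmod (?T \<xi>) \<partial>P)" by (rule integral_norm_bound)
    also have "\<dots> \<le> (\<integral>\<xi>. 6 / \<gamma>\<^sup>2 / real n * (hs_norm n (R \<xi>))\<^sup>2 \<partial>P)"
      by (rule integral_mono[OF integrable_norm[OF iT] integrable_mult_right T]) (use ihs in auto)
    finally show "cmod (\<integral>\<xi>. ?T \<xi> \<partial>P) \<le> (\<integral>\<xi>. 6 / \<gamma>\<^sup>2 / real n * (hs_norm n (R \<xi>))\<^sup>2 \<partial>P)" .
  qed (use t in auto)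
  also have "\<dots> = (6 * t / \<gamma>\<^sup>2) / real n ^ 3 * (\<integral>\<xi>. (hs_norm n (R \<xi>))\<^sup>2 \<partial>P)"
    by (simp add: power3_eq_cube mult_ac)
  also have "\<dots> \<le> 2 / real n ^ 3 * (\<integral>\<xi>. (hs_norm n (R \<xi>))\<^sup>2 \<partial>P)"
  proof (intro mult_right_mono divide_right_mono)
    have "6 * t \<le> 2 * \<gamma>\<^sup>2" using t_less t by linarith
    then show "6 * t / \<gamma>\<^sup>2 \<le> 2" using \<gamma>_pos by (simp add: pos_divide_le_eq)
  qed auto
  finally have "(\<integral>\<xi>. (cmod (N \<xi>))\<^sup>2 \<partial>P) \<le> 2 / real n ^ 3 * (\<integral>\<xi>. (hs_norm n (R \<xi>))\<^sup>2 \<partial>P)" .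
  then show ?thesis
    by (subst (1 2) nn_integral_eq_integral) (auto simp: iN ihs ennreal_mult'[symmetric] intro!: ennreal_leI)
qed

end

context subordinated_resolvent
begin

text \<open>
  The identity \<open>D = (tr Q / n - c) + N + t u D\<close> with \<open>|t u| \<le> 1/2\<close>; the constant \<open>8\<close> is
  \<open>2\<^sup>2\<close> from absorbing the last term, doubled by \<open>(x + y)\<^sup>2 \<le> 2 x\<^sup>2 + 2 y\<^sup>2\<close>.
\<close>

lemma error_decomposition:
  assumes c: "b = of_real t * c"
  shows "(cmod (mat_trace n (R \<xi>) / of_nat n - c))\<^sup>2
    \<le> 8 * (cmod ((\<Sum>i<n. q i) / of_nat n - c))\<^sup>2 + 8 * (cmod (N \<xi>))\<^sup>2"
proof -
  define D where "D = mat_trace n (R \<xi>) / of_nat n - c"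
  define e where "e = (\<Sum>i<n. q i) / of_nat n - c"
  have g: "g \<xi> = D + c" by (simp add: g_def D_def mat_trace_def divide_inverse)
  have "D = e + N \<xi> + of_real t * u \<xi> * D"
  proof -
    have tD: "of_real t * (D + c) - b = of_real t * D" unfolding c by (simp add: algebra_simps)
    show ?thesis unfolding N_def g tD e_def divide_inverse by (simp add: algebra_simps)
  qed
  then have "cmod D \<le> cmod e + cmod (N \<xi>) + cmod (of_real t * u \<xi> * D)"
    by (metis norm_triangle_mono norm_triangle_ineq order_refl)
  also have "cmod (of_real t * u \<xi> * D) \<le> 1 / 2 * cmod D"
  proof -
    have "t * cmod (u \<xi>) \<le> t * (2 / \<gamma>\<^sup>2)" using t norm_u by (intro mult_left_mono) auto
    also have "\<dots> \<le> 1 / 2" using t_less \<gamma>_pos by (simp add: field_simps)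
    finally have "t * cmod (u \<xi>) * cmod D \<le> 1 / 2 * cmod D" by (intro mult_right_mono) auto
    then show ?thesis using t by (simp add: norm_mult)
  qed
  finally have "cmod D \<le> 2 * (cmod e + cmod (N \<xi>))" by simp
  then have "(cmod D)\<^sup>2 \<le> (2 * (cmod e + cmod (N \<xi>)))\<^sup>2" by (intro power_mono) auto
  also have "\<dots> \<le> 8 * (cmod e)\<^sup>2 + 8 * (cmod (N \<xi>))\<^sup>2"
    using sum_squares_bound[of "cmod e" "cmod (N \<xi>)"] by (simp add: power2_eq_square algebra_simps)
  finally show ?thesis by (simp add: D_def e_def)
qed

lemma conditional_error_bound:
  assumes c: "b = of_real t * c"
  shows "(\<integral>\<^sup>+\<xi>. ennreal ((cmod (mat_trace n (resolvent n (deformed_gue n a \<xi>) (z + b)) / of_nat n - c))\<^sup>2) \<partial>P)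
    \<le> ennreal 8 * ennreal ((cmod ((\<Sum>i<n. 1 / (z - of_real (a i))) / of_nat n - c))\<^sup>2)
     + ennreal (16 / real n ^ 3) * (\<integral>\<^sup>+\<xi>. ennreal ((hs_norm n (resolvent n (deformed_gue n a \<xi>) (z + b)))\<^sup>2) \<partial>P)"
proof -
  interpret P: prob_space P by (rule prob_space_P)
  let ?e = "ennreal ((cmod ((\<Sum>i<n. q i) / of_nat n - c))\<^sup>2)"
  have [measurable]: "N \<in> borel_measurable P"
    using bounded_measurable_N by (simp add: bounded_measurable_def)
  have "(\<integral>\<^sup>+\<xi>. ennreal ((cmod (mat_trace n (R \<xi>) / of_nat n - c))\<^sup>2) \<partial>P) \<le> (\<integral>\<^sup>+\<xi>. ennreal 8 * ?e + ennreal 8 * ennreal ((cmod (N \<xi>))\<^sup>2) \<partial>P)"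
  proof (rule nn_integral_mono)
    fix \<xi>
    have "ennreal ((cmod (mat_trace n (R \<xi>) / of_nat n - c))\<^sup>2) \<le> ennreal (8 * (cmod ((\<Sum>i<n. q i) / of_nat n - c))\<^sup>2 + 8 * (cmod (N \<xi>))\<^sup>2)"
      by (rule ennreal_leI[OF error_decomposition[OF c]])
    also have "\<dots> = ennreal 8 * ?e + ennreal 8 * ennreal ((cmod (N \<xi>))\<^sup>2)"
      by (subst ennreal_plus) (auto simp: ennreal_mult'[symmetric] simp del: ennreal_numeral)
    finally show "ennreal ((cmod (mat_trace n (R \<xi>) / of_nat n - c))\<^sup>2) \<le> \<dots>" .
  qed
  also have "\<dots> = ennreal 8 * ?e + ennreal 8 * (\<integral>\<^sup>+\<xi>. ennreal ((cmod (N \<xi>))\<^sup>2) \<partial>P)"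
    by (subst nn_integral_add) (auto simp: nn_integral_cmult P.emeasure_space_1 simp del: ennreal_numeral)
  also have "ennreal 8 * (\<integral>\<^sup>+\<xi>. ennreal ((cmod (N \<xi>))\<^sup>2) \<partial>P) \<le> ennreal 8 * (ennreal (2 / real n ^ 3) * (\<integral>\<^sup>+\<xi>. ennreal ((hs_norm n (R \<xi>))\<^sup>2) \<partial>P))"
    by (intro mult_left_mono noise_second_moment) simp
  also have "\<dots> = ennreal (16 / real n ^ 3) * (\<integral>\<^sup>+\<xi>. ennreal ((hs_norm n (R \<xi>))\<^sup>2) \<partial>P)"
    by (subst mult.assoc[symmetric], subst ennreal_mult'[symmetric]) auto
  finally show ?thesis by (simp add: R_def w_def q_def add_left_mono del: ennreal_numeral)
qed

end

section \<open>The empirical fixed point\<close>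

definition stieltjes :: "nat \<Rightarrow> (nat \<Rightarrow> real) \<Rightarrow> complex \<Rightarrow> complex" where
  "stieltjes n lam w = (\<Sum>i<n. 1 / (w - of_real (lam i))) / of_nat n"

lemma hermitian_cauchy_transform:
  assumes X: "hermitian n X"
  obtains lam where "\<And>w. spectral_cauchy_transform (mat n n (\<lambda>(i, j). X i j)) w = stieltjes n lam w"
proof -
  let ?A = "mat n n (\<lambda>(i, j). X i j)"
  have A: "?A \<in> carrier_mat n n" by simp
  obtain xs where xs: "mset xs = proots (char_poly ?A)" using ex_mset by blast
  have "length xs = size (proots (char_poly ?A))" unfolding xs[symmetric] by simp
  also have "\<dots> = n" using degree_monic_char_poly[OF A] by (simp add: size_proots_complex)
  finally have len: "length xs = n" .
  have re: "of_real (Re (xs ! i)) = xs ! i" if "i < n" for i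
  proof -
    have "xs ! i \<in># proots (char_poly ?A)" unfolding xs[symmetric] using that len by simp
    then have "Im (xs ! i) = 0" by (rule hermitian_eigenvalue_real[OF X])
    then show ?thesis by (simp add: complex_eq_iff)
  qed
  have "spectral_cauchy_transform ?A w = stieltjes n (\<lambda>i. Re (xs ! i)) w" for w
  proof -
    have "(\<Sum>a\<in>#proots (char_poly ?A). 1 / (w - a)) = sum_list (map (\<lambda>a. 1 / (w - a)) xs)"
      unfolding xs[symmetric] by (simp flip: sum_mset_sum_list mset_map)
    also have "\<dots> = (\<Sum>i<n. 1 / (w - xs ! i))"
      by (simp add: sum_list_sum_nth len atLeast0LessThan)
    also have "\<dots> = (\<Sum>i<n. 1 / (w - of_real (Re (xs ! i))))"
      by (intro sum.cong refl) (simp add: re)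
    finally show ?thesis by (simp add: spectral_cauchy_transform_def stieltjes_def)
  qed
  then show ?thesis by (rule that)
qed

lemma norm_minus_real_ge: "cmod (w - of_real r) \<ge> \<bar>Im w\<bar>"
  using abs_Im_le_cmod[of "w - of_real r"] by simp

lemma norm_stieltjes_le:
  assumes n: "n > 0" and w: "Im w \<ge> c" and c: "c > 0"
  shows "cmod (stieltjes n lam w) \<le> 1 / c"
proof -
  have "cmod (\<Sum>i<n. 1 / (w - of_real (lam i))) \<le> (\<Sum>i<n. 1 / c)"
  proof (intro order_trans[OF norm_sum] sum_mono)
    fix i
    have "c \<le> cmod (w - of_real (lam i))" using norm_minus_real_ge[of w "lam i"] w c by linarith
    then show "cmod (1 / (w - of_real (lam i))) \<le> 1 / c" using c by (simp add: norm_divide frac_le)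
  qed
  then show ?thesis using n by (simp add: stieltjes_def norm_divide divide_le_eq)
qed

lemma stieltjes_lipschitz:
  assumes n: "n > 0" and w: "Im w \<ge> c" "Im w' \<ge> c" and c: "c > 0"
  shows "cmod (stieltjes n lam w - stieltjes n lam w') \<le> 1 / c\<^sup>2 * cmod (w - w')"
proof -
  have "cmod (\<Sum>i<n. 1 / (w - of_real (lam i)) - 1 / (w' - of_real (lam i))) \<le> (\<Sum>i<n. 1 / c\<^sup>2 * cmod (w - w'))"
  proof (intro order_trans[OF norm_sum] sum_mono)
    fix i
    let ?a = "w - of_real (lam i)" and ?b = "w' - of_real (lam i)"
    have ab: "c \<le> cmod ?a" "c \<le> cmod ?b"
      using norm_minus_real_ge[of w "lam i"] norm_minus_real_ge[of w' "lam i"] w c by linarith+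
    then have "?a \<noteq> 0" "?b \<noteq> 0" using c by auto
    then have "1 / ?a - 1 / ?b = (w' - w) / (?a * ?b)" by (simp add: field_simps)
    then have "cmod (1 / ?a - 1 / ?b) = cmod (w - w') / (cmod ?a * cmod ?b)"
      by (simp add: norm_divide norm_mult norm_minus_commute)
    also have "\<dots> \<le> cmod (w - w') / (c * c)"
    proof (intro divide_left_mono mult_mono mult_pos_pos)
      show "0 < cmod ?a" "0 < cmod ?b" using ab c by linarith+
    qed (use ab c in auto)
    finally show "cmod (1 / ?a - 1 / ?b) \<le> 1 / c\<^sup>2 * cmod (w - w')" by (simp add: power2_eq_square)
  qed
  then have "cmod (\<Sum>i<n. 1 / (w - of_real (lam i)) - 1 / (w' - of_real (lam i))) \<le> real n * (1 / c\<^sup>2 * cmod (w - w'))" by simp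
  moreover have "stieltjes n lam w - stieltjes n lam w' = (\<Sum>i<n. 1 / (w - of_real (lam i)) - 1 / (w' - of_real (lam i))) / of_nat n"
    by (simp add: stieltjes_def diff_divide_distrib sum_subtractf)
  ultimately show ?thesis using n by (simp add: norm_divide divide_le_eq mult.commute)
qed

lemma Im_stieltjes:
  "- Im (stieltjes n lam w) = (\<Sum>i<n. Im w / (cmod (w - of_real (lam i)))\<^sup>2) / real n"
proof -
  have "Im (1 / (w - of_real (lam i))) = - (Im w / (cmod (w - of_real (lam i)))\<^sup>2)" for i
    by (simp add: Im_divide cmod_power2)
  then show ?thesis by (simp add: stieltjes_def sum_negf)
qed

text \<open>
  The point \<open>w\<close> is at distance at least \<open>\<gamma>/2\<close> from the real axis and at most \<open>\<gamma>/2\<close> from \<open>z\<close>, so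
  \<open>|z - r| \<le> 2 |w - r|\<close> for real \<open>r\<close>. This replaces the moving point \<open>w\<close> by a point on a
  horizontal line.
\<close>

lemma resolvent_shift_bound:
  assumes \<gamma>_pos: "\<gamma> > 0" and z: "Im z = \<gamma>" and w: "Im w \<ge> \<gamma> / 2" and zw: "cmod (w - z) \<le> \<gamma> / 2"
  shows "1 / (cmod (w - of_real r))\<^sup>2 \<le> 4 / ((Re z - r)\<^sup>2 + \<gamma>\<^sup>2)"
proof -
  have w0: "\<gamma> / 2 \<le> cmod (w - of_real r)" using norm_minus_real_ge[of w r] w by linarith
  have "cmod (z - of_real r) \<le> cmod (w - of_real r) + cmod (z - w)"
    using norm_triangle_ineq[of "w - of_real r" "z - w"] by simp
  also have "\<dots> \<le> 2 * cmod (w - of_real r)" using w0 zw by (simp add: norm_minus_commute)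
  finally have "(cmod (z - of_real r))\<^sup>2 \<le> (2 * cmod (w - of_real r))\<^sup>2" by (intro power_mono) auto
  moreover have "(cmod (z - of_real r))\<^sup>2 = (Re z - r)\<^sup>2 + \<gamma>\<^sup>2" using z by (simp add: cmod_power2)
  ultimately have "(Re z - r)\<^sup>2 + \<gamma>\<^sup>2 \<le> 4 * (cmod (w - of_real r))\<^sup>2" by (simp add: power_mult_distrib)
  moreover have "(cmod (w - of_real r))\<^sup>2 > 0" "(Re z - r)\<^sup>2 + \<gamma>\<^sup>2 > 0" using w0 \<gamma>_pos
    by (auto intro: add_nonneg_pos)
  ultimately show ?thesis by (simp add: field_simps)
qed

locale empirical_fixed_point =
  fixes n :: nat and lam :: "nat \<Rightarrow> real" and t \<gamma> :: real and A :: "complex mat"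
  assumes n: "n > 0" and t: "t > 0" and \<gamma>: "\<gamma> > 2 * sqrt t"
    and A: "\<And>w. spectral_cauchy_transform A w = stieltjes n lam w"
begin

abbreviation "S \<equiv> stieltjes n lam"
definition \<kappa> :: real where "\<kappa> = 4 * t / \<gamma>\<^sup>2"

lemmas \<gamma>_pos = strip_height(1)[OF t \<gamma>] and t_less = strip_height(2)[OF t \<gamma>]

lemma t_div_\<gamma>: "t * (2 / \<gamma>) < \<gamma> / 2"
  using t_less \<gamma>_pos by (simp add: field_simps power2_eq_square)

lemma \<kappa>: "0 < \<kappa>" "\<kappa> < 1"
  using t_less t \<gamma>_pos by (auto simp: \<kappa>_def)

lemma norm_S: "Im w \<ge> \<gamma> / 2 \<Longrightarrow> cmod (S w) \<le> 2 / \<gamma>"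
  using norm_stieltjes_le[OF n, of "\<gamma> / 2" w lam] \<gamma>_pos by simp

lemma contraction:
  assumes "Im w \<ge> \<gamma> / 2" "Im w' \<ge> \<gamma> / 2"
  shows "cmod (of_real t * S w - of_real t * S w') \<le> \<kappa> * cmod (w - w')"
proof -
  have "cmod (of_real t * S w - of_real t * S w') = t * cmod (S w - S w')"
    using t by (simp add: norm_mult flip: right_diff_distrib)
  also have "\<dots> \<le> t * (1 / (\<gamma> / 2)\<^sup>2 * cmod (w - w'))"
    using t \<gamma>_pos assms by (intro mult_left_mono stieltjes_lipschitz n) auto
  finally show ?thesis by (simp add: \<kappa>_def power_divide mult_ac)
qed

lemma Im_map:
  assumes "Im z = \<gamma>" "Im w \<ge> \<gamma> / 2"
  shows "Im (z + of_real t * S w) > \<gamma> / 2"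
proof -
  have "\<bar>Im (of_real t * S w)\<bar> \<le> t * (2 / \<gamma>)"
    using t norm_S[OF assms(2)] by (intro order_trans[OF abs_Im_le_cmod]) (auto simp: norm_mult simp del: times_divide_eq_right)
  then show ?thesis using t_div_\<gamma> assms(1) by simp
qed

text \<open>
  A fixed point with \<open>Im w > Im z / 2\<close> lies in the closed half-plane \<open>Im w \<ge> \<gamma>/2\<close>, and Banach's theorem
  applies there because the map sends this half-plane into its interior.
\<close>

lemma fixed_point_unique:
  assumes z: "Im z = \<gamma>"
  shows "\<exists>!w. Im w > Im z / 2 \<and> 1 / of_real t * (w - z) = spectral_cauchy_transform A w"
proof -
  let ?H = "{w. Im w \<ge> \<gamma> / 2}"
  let ?f = "\<lambda>w. z + of_real t * S w"
  have iff: "1 / of_real t * (w - z) = spectral_cauchy_transform A w \<longleftrightarrow> ?f w = w" for w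
    unfolding A using t by (auto simp: field_simps)
  have "\<exists>!w\<in>?H. ?f w = w"
  proof (rule Banach_fix[OF iffD2[OF complete_eq_closed], where c = \<kappa>])
    show "closed ?H" by (rule closed_halfspace_Im_ge)
    have "\<i> * of_real \<gamma> \<in> ?H" using \<gamma>_pos by simp
    then show "?H \<noteq> {}" by blast
    show "?f ` ?H \<subseteq> ?H" using Im_map[OF z] by (auto intro: less_imp_le)
    show "dist (?f w) (?f w') \<le> \<kappa> * dist w w'" if "w \<in> ?H" "w' \<in> ?H" for w w'
      using contraction[of w w'] that by (simp add: dist_norm)
  qed (use \<kappa> in auto)
  then obtain w where w: "Im w \<ge> \<gamma> / 2" "?f w = w" and uniq: "\<And>v. Im v \<ge> \<gamma> / 2 \<Longrightarrow> ?f v = v \<Longrightarrow> v = w"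
    unfolding mem_Collect_eq by blast
  show ?thesis
  proof (rule ex1I[of _ w])
    show "Im w > Im z / 2 \<and> 1 / of_real t * (w - z) = spectral_cauchy_transform A w"
      using w Im_map[OF z w(1)] z iff by simp
    show "v = w" if "Im v > Im z / 2 \<and> 1 / of_real t * (v - z) = spectral_cauchy_transform A v" for v
      by (rule uniq) (use that z iff in auto)
  qed
qed

lemma w_fp:
  assumes z: "Im z = \<gamma>"
  shows "Im (w_fp t A z) > \<gamma> / 2" "w_fp t A z = z + of_real t * S (w_fp t A z)"
proof -
  have *: "Im (w_fp t A z) > Im z / 2 \<and> 1 / of_real t * (w_fp t A z - z) = spectral_cauchy_transform A (w_fp t A z)"
    unfolding w_fp_def by (rule theI'[OF fixed_point_unique[OF z]])
  then show "Im (w_fp t A z) > \<gamma> / 2" using z by simp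
  from * have "w_fp t A z - z = of_real t * S (w_fp t A z)" unfolding A using t by (auto simp: field_simps)
  then show "w_fp t A z = z + of_real t * S (w_fp t A z)" by (simp add: algebra_simps)
qed

text \<open>
  The distance to the fixed point of a contraction is controlled by the defect. It is used twice: with the
  fixed point of a neighbouring \<open>z\<close> it gives continuity, and with the population value it gives the
  error bound.
\<close>

lemma w_fp_stable:
  assumes z: "Im z = \<gamma>" and w: "Im w \<ge> \<gamma> / 2"
  shows "(1 - \<kappa>) * cmod (w_fp t A z - w) \<le> cmod (z + of_real t * S w - w)"
proof -
  let ?v = "w_fp t A z"
  have "?v - w = (z + of_real t * S w - w) + (of_real t * S ?v - of_real t * S w)"
    by (subst (1) w_fp(2)[OF z]) simp
  then have "cmod (?v - w) \<le> cmod (z + of_real t * S w - w) + cmod (of_real t * S ?v - of_real t * S w)"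
    by (metis norm_triangle_ineq)
  also have "cmod (of_real t * S ?v - of_real t * S w) \<le> \<kappa> * cmod (?v - w)"
    using contraction[of ?v w] w_fp(1)[OF z] w by simp
  finally show ?thesis by (simp add: algebra_simps)
qed

lemma w_fp_continuous: "continuous_on UNIV (\<lambda>x. w_fp t A (Complex x \<gamma>))"
proof -
  have "dist (w_fp t A (Complex x \<gamma>)) (w_fp t A (Complex y \<gamma>)) \<le> 1 / (1 - \<kappa>) * dist x y" for x y
  proof -
    have "(1 - \<kappa>) * cmod (w_fp t A (Complex x \<gamma>) - w_fp t A (Complex y \<gamma>))
      \<le> cmod (Complex x \<gamma> + of_real t * S (w_fp t A (Complex y \<gamma>)) - w_fp t A (Complex y \<gamma>))"
      by (rule w_fp_stable) (use w_fp(1)[of "Complex y \<gamma>"] in auto)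
    also have "Complex x \<gamma> + of_real t * S (w_fp t A (Complex y \<gamma>)) - w_fp t A (Complex y \<gamma>) = Complex x \<gamma> - Complex y \<gamma>"
      by (subst (2) w_fp(2)) simp_all
    also have "cmod (Complex x \<gamma> - Complex y \<gamma>) = \<bar>x - y\<bar>" by (simp add: cmod_def)
    finally show ?thesis using \<kappa> by (simp add: dist_norm field_simps)
  qed
  then have "(1 / (1 - \<kappa>))-lipschitz_on UNIV (\<lambda>x. w_fp t A (Complex x \<gamma>))"
    using \<kappa> by (intro lipschitz_onI) auto
  then show ?thesis by (rule lipschitz_on_continuous_on)
qed

lemma g_est_measurable [measurable]: "g_est t \<gamma> A \<in> borel_measurable borel"
  unfolding g_est_def[abs_def]
  by (intro borel_measurable_continuous_onI continuous_intros w_fp_continuous)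

lemma g_est_integrable: "integrable lborel (g_est t \<gamma> A)"
proof -
  let ?k = "\<lambda>x. (\<Sum>i<n. 6 * t / real n * (\<gamma> / ((x - lam i)\<^sup>2 + \<gamma>\<^sup>2)))"
  have "integrable lborel ?k"
    by (intro Bochner_Integration.integrable_sum integrable_mult_right cauchy_kernel_integrable(1) \<gamma>_pos)
  then show ?thesis
  proof (rule Bochner_Integration.integrable_bound)
    show "g_est t \<gamma> A \<in> borel_measurable lborel" by measurable
    have "\<bar>g_est t \<gamma> A x\<bar> \<le> ?k x" for x
    proof -
      let ?z = "Complex x \<gamma>"
      let ?w = "w_fp t A ?z"
      have z: "Im ?z = \<gamma>" by simp
      have w: "Im ?w \<ge> \<gamma> / 2" using w_fp(1)[OF z] by simp
      have "cmod (?w - ?z) = t * cmod (S ?w)" using t by (subst w_fp(2)[OF z]) (simp add: norm_mult)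
      also have "\<dots> \<le> t * (2 / \<gamma>)" using norm_S[OF w] t by (intro mult_left_mono) auto
      finally have wz: "cmod (?w - ?z) \<le> \<gamma> / 2" using t_div_\<gamma> by linarith
      have Imw: "Im ?w \<le> 3 / 2 * \<gamma>" using wz abs_Im_le_cmod[of "?w - ?z"] by simp
      have "Im ?w = Im (?z + of_real t * S ?w)" by (subst w_fp(2)[OF z]) rule
      then have "g_est t \<gamma> A x = t * (- Im (S ?w))" by (simp add: g_est_def)
      also have "\<dots> = (\<Sum>i<n. t / real n * (Im ?w * (1 / (cmod (?w - of_real (lam i)))\<^sup>2)))"
        unfolding Im_stieltjes by (simp add: sum_distrib_left sum_divide_distrib mult_ac)
      finally have eq: "g_est t \<gamma> A x = (\<Sum>i<n. t / real n * (Im ?w * (1 / (cmod (?w - of_real (lam i)))\<^sup>2)))" .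
      have "0 \<le> g_est t \<gamma> A x" unfolding eq using t w \<gamma>_pos by (intro sum_nonneg) auto
      moreover have "g_est t \<gamma> A x \<le> (\<Sum>i<n. t / real n * (3 / 2 * \<gamma> * (4 / ((Re ?z - lam i)\<^sup>2 + \<gamma>\<^sup>2))))"
        unfolding eq using t w \<gamma>_pos Imw
        by (intro sum_mono mult_left_mono mult_mono resolvent_shift_bound[OF \<gamma>_pos z w wz]) auto
      ultimately show ?thesis by (simp add: abs_of_nonneg mult_ac)
    qed
    then show "AE x in lborel. norm (g_est t \<gamma> A x) \<le> norm (?k x)"
      unfolding real_norm_def by (intro AE_I2 order_trans[OF _ abs_ge_self])
  qed
qed

end

section \<open>From the risk to the resolvent\<close>

definition cauchy_transform :: "real measure \<Rightarrow> complex \<Rightarrow> complex" where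
  "cauchy_transform \<mu> z = (\<integral>y. 1 / (z - of_real y) \<partial>\<mu>)"

lemma norm_resolvent_kernel_le: "Im z \<ge> c \<Longrightarrow> c > 0 \<Longrightarrow> cmod (1 / (z - of_real y)) \<le> 1 / c"
  using norm_minus_real_ge[of z y] by (simp add: norm_divide frac_le)

lemma cauchy_transform_integrable:
  assumes "prob_space \<mu>" "sets \<mu> = sets borel" "Im z > 0"
  shows "integrable \<mu> (\<lambda>y. 1 / (z - of_real y))"
proof -
  interpret prob_space \<mu> by fact
  note [measurable_cong] = assms(2)
  show ?thesis
  proof (rule integrable_const_bound[where B = "1 / Im z"])
    show "AE y in \<mu>. cmod (1 / (z - of_real y)) \<le> 1 / Im z"
      using assms(3) by (intro AE_I2 norm_resolvent_kernel_le) auto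
  qed measurable
qed

lemma norm_cauchy_transform_le:
  assumes "prob_space \<mu>" "sets \<mu> = sets borel" "Im z > 0"
  shows "cmod (cauchy_transform \<mu> z) \<le> 1 / Im z"
proof -
  interpret prob_space \<mu> by fact
  have "cmod (cauchy_transform \<mu> z) \<le> (\<integral>y. cmod (1 / (z - of_real y)) \<partial>\<mu>)"
    unfolding cauchy_transform_def by (rule integral_norm_bound)
  also have "\<dots> \<le> 1 / Im z"
    using assms by (intro integral_le_const integrable_norm cauchy_transform_integrable AE_I2 norm_resolvent_kernel_le) auto
  finally show ?thesis .
qed

lemma borel_measurable_cauchy_transform:
  assumes "prob_space \<mu>" "sets \<mu> = sets borel"
  shows "(\<lambda>x. cauchy_transform \<mu> (Complex x \<gamma>)) \<in> borel_measurable borel"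
proof -
  interpret prob_space \<mu> by fact
  note [measurable_cong] = assms(2)
  have [measurable]: "(\<lambda>x. Complex x \<gamma>) \<in> borel_measurable borel"
    unfolding Complex_eq by measurable
  show ?thesis unfolding cauchy_transform_def by measurable
qed

lemma Im_cauchy_transform_density:
  assumes \<mu>: "prob_space \<mu>" "\<mu> = density lborel (\<lambda>x. ennreal (p x))"
    and p: "p \<in> borel_measurable borel" "\<And>x. 0 \<le> p x" and \<gamma>: "\<gamma> > 0"
  shows "- Im (cauchy_transform \<mu> (Complex x \<gamma>)) = (\<integral>y. \<gamma> / ((x - y)\<^sup>2 + \<gamma>\<^sup>2) * p y \<partial>lborel)"
proof -
  have [measurable]: "p \<in> borel_measurable borel" by fact
  have s: "sets \<mu> = sets borel" by (simp add: \<mu>(2))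
  have "- Im (cauchy_transform \<mu> (Complex x \<gamma>)) = (\<integral>y. - Im (1 / (Complex x \<gamma> - of_real y)) \<partial>\<mu>)"
    unfolding cauchy_transform_def using cauchy_transform_integrable[OF \<mu>(1) s, of "Complex x \<gamma>"] \<gamma>
    by simp
  also have "\<dots> = (\<integral>y. \<gamma> / ((x - y)\<^sup>2 + \<gamma>\<^sup>2) \<partial>\<mu>)"
    by (simp add: Im_divide)
  also have "\<dots> = (\<integral>y. p y * (\<gamma> / ((x - y)\<^sup>2 + \<gamma>\<^sup>2)) \<partial>lborel)"
    unfolding \<mu>(2) using p by (subst integral_density) auto
  finally show ?thesis by (simp add: mult.commute)
qed

lemma density_integrable:
  assumes "prob_space \<mu>" "\<mu> = density lborel (\<lambda>x. ennreal (p x))" "p \<in> borel_measurable borel" "\<And>x. 0 \<le> p x"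
  shows "integrable lborel p"
proof -
  interpret prob_space \<mu> by fact
  have "integrable (density lborel (\<lambda>x. ennreal (p x))) (\<lambda>_. 1 :: real)"
    unfolding assms(2)[symmetric] by simp
  then show ?thesis using assms by (subst (asm) integrable_density) auto
qed

text \<open>
  The transform of \<open>- t Im G(x + i\<gamma>) = \<gamma> - Im w\<close> is \<open>\<pi> t exp(-\<gamma>|\<xi>|) p\<^sub>0\<^sup>\<star>(\<xi>)\<close>, so the error
  of the estimator is the weighted transform of the integrable function \<open>f = Im (w - w\<^sub>f\<^sub>p)\<close>.
\<close>

lemma variance_term_le:
  fixes X :: cmatrix
  assumes n: "n > 0" and t: "t > 0" and \<gamma>: "\<gamma> > 2 * sqrt t" and X: "hermitian n X"
    and \<mu>: "prob_space \<mu>" "\<mu> = density lborel (\<lambda>x. ennreal (p x))"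
    and p: "p \<in> borel_measurable borel" "\<And>x. 0 \<le> p x"
    and K: "\<And>\<xi>. cmod (Kstar \<xi>) \<le> C" "\<And>\<xi>. \<xi> \<notin> {-1..1} \<Longrightarrow> Kstar \<xi> = 0" and h: "h > 0"
  defines "G \<equiv> \<lambda>x. cauchy_transform \<mu> (Complex x \<gamma>)"
  defines "w \<equiv> \<lambda>x. Complex x \<gamma> + of_real t * G x"
  defines "L \<equiv> C / pi / (1 - 4 * t / \<gamma>\<^sup>2)"
  shows "variance_term t \<gamma> p Kstar h (mat n n (\<lambda>(i, j). X i j))
    \<le> ennreal (exp (2 * \<gamma> / h)) * ennreal (2 * pi * exp (1/2) * L\<^sup>2)
       * (\<integral>\<^sup>+x. ennreal ((cmod (mat_trace n (resolvent n X (w x)) / of_nat n - G x))\<^sup>2) \<partial>lborel)"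
proof -
  let ?A = "mat n n (\<lambda>(i, j). X i j)"
  have s\<mu>: "sets \<mu> = sets borel" by (simp add: \<mu>(2))
  obtain lam where lam: "\<And>w. spectral_cauchy_transform ?A w = stieltjes n lam w"
    by (rule hermitian_cauchy_transform[OF X]) blast
  interpret empirical_fixed_point n lam t \<gamma> ?A by unfold_locales (use n t \<gamma> lam in auto)
  have pint: "integrable lborel p" by (rule density_integrable[OF \<mu> p])
  define gt where "gt x = t * (\<integral>y. \<gamma> / ((x - y)\<^sup>2 + \<gamma>\<^sup>2) * p y \<partial>lborel)" for x
  have gt: "gt x = - Im (of_real t * G x)" for x
    using Im_cauchy_transform_density[OF \<mu> p \<gamma>_pos, of x] by (simp add: gt_def G_def flip: mult_minus_right)
  have gt_int: "integrable lborel (\<lambda>x. complex_of_real (gt x))"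
    unfolding gt_def by (intro integrable_of_real integrable_mult_right fourier_poisson_smoothing(1) \<gamma>_pos pint)
  have g_int: "integrable lborel (\<lambda>x. complex_of_real (g_est t \<gamma> ?A x))"
    by (intro integrable_of_real g_est_integrable)
  define f where "f x = complex_of_real (g_est t \<gamma> ?A x) - of_real (gt x)" for x
  have f_int: "integrable lborel f" unfolding f_def by (intro Bochner_Integration.integrable_diff g_int gt_int)
  have ft_gt: "fourier (\<lambda>x. of_real (gt x)) \<xi> = of_real (t * (pi * exp (- \<gamma> * \<bar>\<xi>\<bar>))) * fourier (\<lambda>x. of_real (p x)) \<xi>" for \<xi>
  proof -
    have "fourier (\<lambda>x. of_real (gt x)) \<xi> = of_real t * fourier (\<lambda>x. of_real (\<integral>y. \<gamma> / ((x - y)\<^sup>2 + \<gamma>\<^sup>2) * p y \<partial>lborel)) \<xi>"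
      unfolding fourier_def gt_def of_real_mult mult.assoc by (rule integral_mult_right_zero)
    then show ?thesis unfolding fourier_poisson_smoothing(2)[OF \<gamma>_pos pint] by simp
  qed
  have Gbd: "cmod (G x) \<le> 1 / \<gamma>" for x
    using norm_cauchy_transform_le[OF \<mu>(1) s\<mu>, of "Complex x \<gamma>"] \<gamma>_pos by (simp add: G_def)
  have Imw: "Im (w x) \<ge> \<gamma> / 2" for x
  proof -
    have "\<bar>Im (of_real t * G x)\<bar> \<le> t * (1 / \<gamma>)"
      using t Gbd[of x] by (intro order_trans[OF abs_Im_le_cmod]) (auto simp: norm_mult simp del: times_divide_eq_right)
    moreover have "t * (1 / \<gamma>) \<le> t * (2 / \<gamma>)" using t \<gamma>_pos by (intro mult_left_mono divide_right_mono) auto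
    moreover have "Im (w x) = \<gamma> + Im (of_real t * G x)" by (simp add: w_def)
    ultimately show ?thesis using t_div_\<gamma> by linarith
  qed
  define D where "D x = cmod (mat_trace n (resolvent n X (w x)) / of_nat n - G x)" for x
  have SD: "cmod (stieltjes n lam (w x) - G x) = D x" for x
  proof -
    have "Im (w x) \<noteq> 0" using Imw[of x] \<gamma>_pos by auto
    then show ?thesis using spectral_cauchy_transform_resolvent[OF X] lam by (simp add: D_def)
  qed
  have \<kappa>L: "L = C / pi / (1 - \<kappa>)" by (simp add: L_def \<kappa>_def)
  have C0: "0 \<le> C" using K(1)[of 0] norm_ge_zero order_trans by blast
  have f_le: "cmod (f x) \<le> t / (1 - \<kappa>) * D x" for x
  proof -
    let ?v = "w_fp t ?A (Complex x \<gamma>)"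
    have "f x = of_real (Im (w x - ?v))"
      by (simp add: f_def gt g_est_def w_def)
    then have "cmod (f x) \<le> cmod (?v - w x)"
      using abs_Im_le_cmod[of "w x - ?v"] by (simp add: norm_minus_commute del: minus_complex.sel)
    moreover have "(1 - \<kappa>) * cmod (?v - w x) \<le> cmod (Complex x \<gamma> + of_real t * S (w x) - w x)"
      by (rule w_fp_stable) (use Imw in auto)
    moreover have "Complex x \<gamma> + of_real t * S (w x) - w x = of_real t * (S (w x) - G x)"
      by (simp add: w_def algebra_simps)
    ultimately have "(1 - \<kappa>) * cmod (f x) \<le> t * D x"
      using \<kappa> t SD[of x] by (smt (verit) mult_left_mono norm_mult norm_of_real)
    then show ?thesis using \<kappa> by (simp add: field_simps)
  qed
  have pointwise: "ennreal ((cmod (estimator_fourier t \<gamma> Kstar h ?A \<xi> - Kstar (h * \<xi>) * fourier (\<lambda>x. of_real (p x)) \<xi>))\<^sup>2)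
     \<le> ennreal (exp (2 * \<gamma> / h) * (C / (pi * t))\<^sup>2) * (indicator {-(1/h)..1/h} \<xi> * ennreal ((cmod (fourier f \<xi>))\<^sup>2))" for \<xi>
  proof -
    have ee: "complex_of_real (exp (\<gamma> * \<bar>\<xi>\<bar>)) * of_real (1 / (pi * t)) * of_real (t * (pi * exp (- \<gamma> * \<bar>\<xi>\<bar>))) = 1"
      using t unfolding of_real_mult[symmetric] by (simp add: exp_minus)
    have "estimator_fourier t \<gamma> Kstar h ?A \<xi> - Kstar (h * \<xi>) * fourier (\<lambda>x. of_real (p x)) \<xi>
      = estimator_fourier t \<gamma> Kstar h ?A \<xi> - (complex_of_real (exp (\<gamma> * \<bar>\<xi>\<bar>)) * of_real (1 / (pi * t)) * of_real (t * (pi * exp (- \<gamma> * \<bar>\<xi>\<bar>))))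
         * (Kstar (h * \<xi>) * fourier (\<lambda>x. of_real (p x)) \<xi>)"
      unfolding ee by simp
    also have "\<dots> = of_real (exp (\<gamma> * \<bar>\<xi>\<bar>)) * Kstar (h * \<xi>) * of_real (1 / (pi * t)) *
        (fourier (\<lambda>x. of_real (g_est t \<gamma> ?A x)) \<xi> - fourier (\<lambda>x. of_real (gt x)) \<xi>)"
      unfolding estimator_fourier_def ft_gt by (simp only: right_diff_distrib mult_ac)
    also have "\<dots> = of_real (exp (\<gamma> * \<bar>\<xi>\<bar>)) * Kstar (h * \<xi>) * of_real (1 / (pi * t)) * fourier f \<xi>"
      unfolding f_def by (subst fourier_diff[OF g_int gt_int]) rule
    finally have "cmod (estimator_fourier t \<gamma> Kstar h ?A \<xi> - Kstar (h * \<xi>) * fourier (\<lambda>x. of_real (p x)) \<xi>)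
      = exp (\<gamma> * \<bar>\<xi>\<bar>) * cmod (Kstar (h * \<xi>)) * (1 / (pi * t)) * cmod (fourier f \<xi>)" (is "?lhs = ?rhs")
      using t by (simp add: norm_mult norm_divide)
    show ?thesis
    proof (cases "\<xi> \<in> {-(1/h)..1/h}")
      case True
      then have "\<bar>\<xi>\<bar> \<le> 1 / h" by auto
      then have "\<gamma> * \<bar>\<xi>\<bar> \<le> \<gamma> / h" using \<gamma>_pos by (metis mult.right_neutral mult_left_mono less_imp_le times_divide_eq_right)
      then have "?rhs \<le> exp (\<gamma> / h) * C * (1 / (pi * t)) * cmod (fourier f \<xi>)"
        using K(1)[of "h * \<xi>"] t C0 by (intro mult_mono) auto
      then have "?lhs\<^sup>2 \<le> (exp (\<gamma> / h) * C * (1 / (pi * t)) * cmod (fourier f \<xi>))\<^sup>2"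
        unfolding \<open>?lhs = ?rhs\<close>[symmetric] by (rule power_mono[OF _ norm_ge_zero])
      also have "\<dots> = (exp (\<gamma> / h))\<^sup>2 * (C / (pi * t))\<^sup>2 * (cmod (fourier f \<xi>))\<^sup>2"
        by (simp add: power_mult_distrib power_divide)
      also have "(exp (\<gamma> / h))\<^sup>2 = exp (2 * \<gamma> / h)" by (simp add: exp_double[symmetric])
      finally show ?thesis using True by (simp add: ennreal_mult'[symmetric] ennreal_leI)
    next
      case False
      then have "h * \<xi> \<notin> {-1..1}" using h by (auto simp: field_simps)
      then have "Kstar (h * \<xi>) = 0" by (rule K(2))
      then show ?thesis by (simp add: estimator_fourier_def)
    qed
  qed
  have [measurable]: "fourier f \<in> borel_measurable borel"
    by (rule borel_measurable_fourier) (use f_int in simp)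
  have "(\<integral>\<^sup>+x. ennreal ((cmod (f x))\<^sup>2) \<partial>lborel) \<le> (\<integral>\<^sup>+x. ennreal ((t / (1 - \<kappa>))\<^sup>2) * ennreal ((D x)\<^sup>2) \<partial>lborel)"
  proof (rule nn_integral_mono)
    fix x
    have "(cmod (f x))\<^sup>2 \<le> (t / (1 - \<kappa>))\<^sup>2 * (D x)\<^sup>2"
      using power_mono[OF f_le norm_ge_zero, of x 2] unfolding power_mult_distrib .
    then show "ennreal ((cmod (f x))\<^sup>2) \<le> ennreal ((t / (1 - \<kappa>))\<^sup>2) * ennreal ((D x)\<^sup>2)"
      unfolding ennreal_mult'[OF zero_le_power2, symmetric] by (rule ennreal_leI)
  qed
  also have "\<dots> = ennreal ((t / (1 - \<kappa>))\<^sup>2) * (\<integral>\<^sup>+x. ennreal ((D x)\<^sup>2) \<partial>lborel)"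
  proof (rule nn_integral_cmult)
    have G[measurable]: "G \<in> borel_measurable borel"
      unfolding G_def by (rule borel_measurable_cauchy_transform[OF \<mu>(1) s\<mu>])
    have "(\<lambda>x. Complex x \<gamma>) \<in> borel_measurable borel" unfolding Complex_eq by measurable
    then have w: "w \<in> borel_measurable borel" unfolding w_def by measurable
    have "(\<lambda>x. resolvent n X (w x) i i) \<in> borel_measurable borel" if "i < n" for i
      by (rule borel_measurable_resolvent) (use w that in auto)
    then have [measurable]: "(\<lambda>x. mat_trace n (resolvent n X (w x))) \<in> borel_measurable borel"
      unfolding mat_trace_def by (intro borel_measurable_sum) auto
    show "(\<lambda>x. ennreal ((D x)\<^sup>2)) \<in> borel_measurable lborel" unfolding D_def by measurable
  qed
  finally have fD: "(\<integral>\<^sup>+x. ennreal ((cmod (f x))\<^sup>2) \<partial>lborel) \<le> ennreal ((t / (1 - \<kappa>))\<^sup>2) * (\<integral>\<^sup>+x. ennreal ((D x)\<^sup>2) \<partial>lborel)" .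
  have "variance_term t \<gamma> p Kstar h ?A
    \<le> (\<integral>\<^sup>+\<xi>. ennreal (exp (2 * \<gamma> / h) * (C / (pi * t))\<^sup>2) * (indicator {-(1/h)..1/h} \<xi> * ennreal ((cmod (fourier f \<xi>))\<^sup>2)) \<partial>lborel)"
    unfolding variance_term_def by (intro nn_integral_mono pointwise)
  also have "\<dots> = ennreal (exp (2 * \<gamma> / h) * (C / (pi * t))\<^sup>2) * (\<integral>\<^sup>+\<xi>. indicator {-(1/h)..1/h} \<xi> * ennreal ((cmod (fourier f \<xi>))\<^sup>2) \<partial>lborel)"
    by (rule nn_integral_cmult) measurable
  also have "\<dots> \<le> ennreal (exp (2 * \<gamma> / h) * (C / (pi * t))\<^sup>2) * (ennreal (2 * pi * exp (1/2)) * (\<integral>\<^sup>+x. ennreal ((cmod (f x))\<^sup>2) \<partial>lborel))"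
    using h by (intro mult_left_mono band_limited_plancherel f_int) auto
  also have "\<dots> \<le> ennreal (exp (2 * \<gamma> / h) * (C / (pi * t))\<^sup>2) * (ennreal (2 * pi * exp (1/2)) *
       (ennreal ((t / (1 - \<kappa>))\<^sup>2) * (\<integral>\<^sup>+x. ennreal ((D x)\<^sup>2) \<partial>lborel)))"
    by (intro mult_left_mono fD) auto
  also have "\<dots> = ennreal (exp (2 * \<gamma> / h)) * ennreal (2 * pi * exp (1/2) * L\<^sup>2) * (\<integral>\<^sup>+x. ennreal ((D x)\<^sup>2) \<partial>lborel)"
  proof -
    have eq: "exp (2 * \<gamma> / h) * (C / (pi * t))\<^sup>2 * (2 * pi * exp (1/2)) * (t / (1 - \<kappa>))\<^sup>2 = exp (2 * \<gamma> / h) * (2 * pi * exp (1/2) * L\<^sup>2)"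
      using t unfolding \<kappa>L by (simp add: power_divide power_mult_distrib)
    have m: "ennreal a * (ennreal b * (ennreal c * I)) = ennreal (a * b * c) * I"
      "ennreal a * ennreal b * I = ennreal (a * b) * I" if "0 \<le> a" "0 \<le> b" for a b c I
      using that by (simp_all add: ennreal_mult' mult.assoc)
    show ?thesis
      by (subst m(1), simp, simp, subst m(2), simp, simp, simp only: eq)
  qed
  finally show ?thesis unfolding D_def .
qed

section \<open>Horizontal integrals and the sampling error\<close>

lemma cauchy_kernel_nn_integral:
  assumes "\<gamma> > 0"
  shows "(\<integral>\<^sup>+x. ennreal (1 / ((x - r)\<^sup>2 + \<gamma>\<^sup>2)) \<partial>lborel) = ennreal (pi / \<gamma>)"
proof -
  have "integrable lborel (\<lambda>x. (1 / \<gamma>) * (\<gamma> / ((x - r)\<^sup>2 + \<gamma>\<^sup>2)))"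
    by (intro integrable_mult_right cauchy_kernel_integrable(1) assms)
  moreover have eq: "(1 / \<gamma>) * (\<gamma> / ((x - r)\<^sup>2 + \<gamma>\<^sup>2)) = 1 / ((x - r)\<^sup>2 + \<gamma>\<^sup>2)" for x using assms by simp
  ultimately have int: "integrable lborel (\<lambda>x. 1 / ((x - r)\<^sup>2 + \<gamma>\<^sup>2))" by (simp only: eq)
  have "(\<integral>x. 1 / ((x - r)\<^sup>2 + \<gamma>\<^sup>2) \<partial>lborel) = (\<integral>x. (1 / \<gamma>) * (\<gamma> / ((x - r)\<^sup>2 + \<gamma>\<^sup>2)) \<partial>lborel)" by (simp only: eq)
  also have "\<dots> = pi / \<gamma>"
    unfolding integral_mult_right_zero cauchy_kernel_integrable(2)[OF assms] by simp
  finally show ?thesis using int by (subst nn_integral_eq_integral) auto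
qed

text \<open>
  A bound for each fixed matrix, uniform over all spectra, because each eigenvalue contributes a Cauchy kernel of
  total mass \<open>\<pi>/\<gamma>\<close>.
\<close>

lemma hs_resolvent_horizontal_integral:
  assumes n: "n > 0" and X: "hermitian n X" and \<gamma>: "\<gamma> > 0"
    and w: "\<And>x. Im (w x) \<ge> \<gamma> / 2" "\<And>x. cmod (w x - Complex x \<gamma>) \<le> \<gamma> / 2"
  shows "(\<integral>\<^sup>+x. ennreal ((hs_norm n (resolvent n X (w x)))\<^sup>2) \<partial>lborel) \<le> ennreal (4 * pi / \<gamma> * real n)"
proof -
  obtain lam where lam: "\<And>w. spectral_cauchy_transform (mat n n (\<lambda>(i, j). X i j)) w = stieltjes n lam w"
    by (rule hermitian_cauchy_transform[OF X]) blast
  have bound: "(hs_norm n (resolvent n X (w x)))\<^sup>2 \<le> (\<Sum>i<n. 4 * (1 / ((x - lam i)\<^sup>2 + \<gamma>\<^sup>2)))" for x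
  proof -
    have Im: "Im (w x) > 0" using w(1)[of x] \<gamma> by linarith
    have "Im (w x) * (hs_norm n (resolvent n X (w x)))\<^sup>2 = real n * (- Im (stieltjes n lam (w x)))"
      using ward_identity[OF X, of "w x"] spectral_cauchy_transform_resolvent[OF X, of "w x"] Im n by (simp add: lam)
    also have "\<dots> = Im (w x) * (\<Sum>i<n. 1 / (cmod (w x - of_real (lam i)))\<^sup>2)"
    proof -
      have "real n * (s / real n) = s" for s using n by simp
      then show ?thesis unfolding Im_stieltjes sum_distrib_left by simp
    qed
    finally have "(hs_norm n (resolvent n X (w x)))\<^sup>2 = (\<Sum>i<n. 1 / (cmod (w x - of_real (lam i)))\<^sup>2)" using Im by simp
    also have "\<dots> \<le> (\<Sum>i<n. 4 * (1 / ((x - lam i)\<^sup>2 + \<gamma>\<^sup>2)))"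
      using resolvent_shift_bound[OF \<gamma>, of "Complex x \<gamma>" "w x"] w[of x] by (intro sum_mono) simp
    finally show ?thesis .
  qed
  have "(\<integral>\<^sup>+x. ennreal ((hs_norm n (resolvent n X (w x)))\<^sup>2) \<partial>lborel) \<le> (\<integral>\<^sup>+x. (\<Sum>i<n. ennreal 4 * ennreal (1 / ((x - lam i)\<^sup>2 + \<gamma>\<^sup>2))) \<partial>lborel)"
    using bound by (intro nn_integral_mono) (simp only: ennreal_mult'[symmetric] sum_ennreal zero_le_numeral zero_le_divide_1_iff sum_power2_ge_zero mult_nonneg_nonneg ennreal_leI)
  also have "\<dots> = (\<Sum>i<n. ennreal 4 * ennreal (pi / \<gamma>))"
    by (subst nn_integral_sum) (simp_all add: nn_integral_cmult cauchy_kernel_nn_integral[OF \<gamma>])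
  also have "\<dots> = ennreal (4 * pi / \<gamma> * real n)"
    using \<gamma> by (simp add: ennreal_mult'[symmetric] ennreal_of_nat_eq_real_of_nat mult_ac del: ennreal_numeral)
  finally show ?thesis .
qed

text \<open>
  The variance of an average; the cross terms vanish by independence and each variance is at most the
  second moment.
\<close>

lemma (in prob_space) iid_average_second_moment:
  fixes f :: "real \<Rightarrow> complex"
  assumes d: "indep_vars (\<lambda>_. borel) d {..<n}" "\<And>j. j < n \<Longrightarrow> distr M borel (d j) = \<mu>" and n: "n > 0"
    and f: "f \<in> borel_measurable borel" "\<And>y. cmod (f y) \<le> C"
  shows "(\<integral>\<^sup>+\<omega>. ennreal ((cmod ((\<Sum>j<n. f (d j \<omega>)) / of_nat n - (\<integral>y. f y \<partial>\<mu>)))\<^sup>2) \<partial>M)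
    \<le> ennreal (1 / real n) * (\<integral>\<^sup>+y. ennreal ((cmod (f y))\<^sup>2) \<partial>\<mu>)"
proof -
  have [measurable]: "f \<in> borel_measurable borel" by fact
  have dm[measurable]: "d j \<in> borel_measurable M" if "j < n" for j
    using d(1) that by (auto simp: indep_vars_def)
  define m where "m = (\<integral>y. f y \<partial>\<mu>)"
  define Z where "Z j \<omega> = f (d j \<omega>) - m" for j \<omega>
  have C0: "0 \<le> C" using f(2)[of 0] norm_ge_zero order_trans by blast
  have fint: "integrable M (\<lambda>\<omega>. f (d j \<omega>))" if "j < n" for j
    by (rule integrable_const_bound[where B = C]) (use f(2) that in auto)
  have fE: "(\<integral>\<omega>. f (d j \<omega>) \<partial>M) = m" if "j < n" for j
    unfolding m_def d(2)[OF that, symmetric] using that by (subst integral_distr) auto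
  have Zm[measurable]: "Z j \<in> borel_measurable M" if "j < n" for j
    unfolding Z_def using that by measurable
  have Zb: "cmod (Z j \<omega>) \<le> C + cmod m" for j \<omega>
    unfolding Z_def by (intro order_trans[OF norm_triangle_ineq4] add_mono f) simp
  have ZE: "(\<integral>\<omega>. Z j \<omega> \<partial>M) = 0" if "j < n" for j
    unfolding Z_def using fint[OF that] fE[OF that] by (simp add: prob_space)
  have ZZint: "integrable M (\<lambda>\<omega>. Z j \<omega> * cnj (Z k \<omega>))" if "j < n" "k < n" for j k
  proof (rule integrable_const_bound[where B = "(C + cmod m) * (C + cmod m)"])
    show "AE \<omega> in M. cmod (Z j \<omega> * cnj (Z k \<omega>)) \<le> (C + cmod m) * (C + cmod m)"
      using Zb C0 by (intro AE_I2) (auto simp: norm_mult intro!: mult_mono)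
    show "(\<lambda>\<omega>. Z j \<omega> * cnj (Z k \<omega>)) \<in> borel_measurable M"
      using that by measurable
  qed
  have cross: "(\<integral>\<omega>. Z j \<omega> * cnj (Z k \<omega>) \<partial>M) = 0" if jk: "j < n" "k < n" "j \<noteq> k" for j k
  proof -
    \<comment> \<open>conjugation only on the second index, so that the product rule for independent variables applies\<close>
    define Y where "Y i y = (if i = j then f y - m else cnj (f y - m))" for i y
    have "indep_vars (\<lambda>_. borel) (\<lambda>i \<omega>. Y i (d i \<omega>)) {j, k}"
    proof (rule indep_vars_compose2[where X = d and Y = Y and M' = "\<lambda>_. borel"])
      show "indep_vars (\<lambda>_. borel) d {j, k}" by (rule indep_vars_subset[OF d(1)]) (use jk in auto)
      fix i show "Y i \<in> borel_measurable borel" unfolding Y_def by measurable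
    qed
    moreover have "integrable M (\<lambda>\<omega>. Y i (d i \<omega>))" if "i \<in> {j, k}" for i
      using fint[of i] that jk by (auto simp: Y_def)
    ultimately have "(\<integral>\<omega>. (\<Prod>i\<in>{j, k}. Y i (d i \<omega>)) \<partial>M) = (\<Prod>i\<in>{j, k}. (\<integral>\<omega>. Y i (d i \<omega>) \<partial>M))"
      by (intro indep_vars_lebesgue_integral) auto
    then have "(\<integral>\<omega>. Z j \<omega> * cnj (Z k \<omega>) \<partial>M) = (\<integral>\<omega>. Z j \<omega> \<partial>M) * (\<integral>\<omega>. cnj (Z k \<omega>) \<partial>M)"
      using jk by (simp add: Y_def Z_def)
    then show ?thesis using ZE[OF jk(1)] by simp
  qed
  have diag: "(\<integral>\<^sup>+\<omega>. ennreal ((cmod (Z j \<omega>))\<^sup>2) \<partial>M) \<le> (\<integral>\<^sup>+y. ennreal ((cmod (f y))\<^sup>2) \<partial>\<mu>)" if j: "j < n" for j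
  proof -
    have fi2: "integrable M (\<lambda>\<omega>. (cmod (f (d j \<omega>)))\<^sup>2)"
      by (rule integrable_const_bound[where B = "C\<^sup>2"]) (use f(2) j in \<open>auto intro!: power_mono\<close>)
    have eq: "(cmod (Z j \<omega>))\<^sup>2 = (cmod (f (d j \<omega>)))\<^sup>2 - 2 * Re (cnj m * f (d j \<omega>)) + (cmod m)\<^sup>2" for \<omega>
      unfolding Z_def cmod_power2 by (simp add: power2_eq_square algebra_simps)
    have i1: "integrable M (\<lambda>\<omega>. 2 * Re (cnj m * f (d j \<omega>)))"
      using fint[OF j] by (intro integrable_mult_right integrable_Re) auto
    have "(\<integral>\<omega>. 2 * Re (cnj m * f (d j \<omega>)) \<partial>M) = 2 * Re (cnj m * m)"
      using fint[OF j] by (simp add: fE[OF j] integral_Re[symmetric] del: times_complex.sel)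
    then have "(\<integral>\<omega>. (cmod (Z j \<omega>))\<^sup>2 \<partial>M) = (\<integral>\<omega>. (cmod (f (d j \<omega>)))\<^sup>2 \<partial>M) - 2 * Re (cnj m * m) + (cmod m)\<^sup>2"
      unfolding eq using fi2 i1 by (simp add: prob_space del: times_complex.sel)
    also have "Re (cnj m * m) = (cmod m)\<^sup>2" by (simp add: cmod_power2 flip: power2_eq_square)
    finally have le: "(\<integral>\<omega>. (cmod (Z j \<omega>))\<^sup>2 \<partial>M) \<le> (\<integral>\<omega>. (cmod (f (d j \<omega>)))\<^sup>2 \<partial>M)" by simp
    have "integrable M (\<lambda>\<omega>. (cmod (Z j \<omega>))\<^sup>2)" unfolding eq using fi2 i1 by simp
    then have "(\<integral>\<^sup>+\<omega>. ennreal ((cmod (Z j \<omega>))\<^sup>2) \<partial>M) \<le> (\<integral>\<^sup>+\<omega>. ennreal ((cmod (f (d j \<omega>)))\<^sup>2) \<partial>M)"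
      using le fi2 by (simp add: nn_integral_eq_integral ennreal_leI)
    also have "\<dots> = (\<integral>\<^sup>+y. ennreal ((cmod (f y))\<^sup>2) \<partial>\<mu>)"
      unfolding d(2)[OF j, symmetric] using j by (subst nn_integral_distr) auto
    finally show ?thesis .
  qed
  let ?I = "(\<integral>\<^sup>+y. ennreal ((cmod (f y))\<^sup>2) \<partial>\<mu>)"
  define W where "W \<omega> = (\<Sum>j<n. Z j \<omega>)" for \<omega>
  have WW: "W \<omega> * cnj (W \<omega>) = (\<Sum>j<n. \<Sum>k<n. Z j \<omega> * cnj (Z k \<omega>))" for \<omega>
    by (simp add: W_def sum_product)
  have Zi2: "integrable M (\<lambda>\<omega>. (cmod (Z j \<omega>))\<^sup>2)" if "j < n" for j
    using ZZint[OF that that] by (simp only: complex_norm_square[symmetric] complex_of_real_integrable_eq)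
  have Wi: "integrable M (\<lambda>\<omega>. (cmod (W \<omega>))\<^sup>2)"
    using integral_double_sum(1)[where n = n and f = "\<lambda>j k \<omega>. Z j \<omega> * cnj (Z k \<omega>)", OF ZZint]
    by (simp only: WW[symmetric] complex_norm_square[symmetric] complex_of_real_integrable_eq)
  have "complex_of_real (\<integral>\<omega>. (cmod (W \<omega>))\<^sup>2 \<partial>M) = (\<integral>\<omega>. W \<omega> * cnj (W \<omega>) \<partial>M)"
    by (simp only: complex_norm_square[symmetric] integral_complex_of_real)
  also have "\<dots> = (\<Sum>j<n. \<Sum>k<n. (\<integral>\<omega>. Z j \<omega> * cnj (Z k \<omega>) \<partial>M))"
    unfolding WW by (rule integral_double_sum(2)[where n = n and f = "\<lambda>j k \<omega>. Z j \<omega> * cnj (Z k \<omega>)", OF ZZint])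
  also have "\<dots> = (\<Sum>j<n. \<Sum>k<n. if j = k then (\<integral>\<omega>. Z j \<omega> * cnj (Z j \<omega>) \<partial>M) else 0)"
    by (intro sum.cong refl) (auto simp: cross)
  also have "\<dots> = (\<Sum>j<n. (\<integral>\<omega>. Z j \<omega> * cnj (Z j \<omega>) \<partial>M))" by simp
  also have "\<dots> = complex_of_real (\<Sum>j<n. (\<integral>\<omega>. (cmod (Z j \<omega>))\<^sup>2 \<partial>M))"
    by (simp only: complex_norm_square[symmetric] integral_complex_of_real of_real_sum)
  finally have var: "(\<integral>\<omega>. (cmod (W \<omega>))\<^sup>2 \<partial>M) = (\<Sum>j<n. (\<integral>\<omega>. (cmod (Z j \<omega>))\<^sup>2 \<partial>M))"
    by (simp only: of_real_eq_iff)
  have Wm[measurable]: "W \<in> borel_measurable M" unfolding W_def[abs_def] by measurable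
  have "(\<integral>\<^sup>+\<omega>. ennreal ((cmod (W \<omega>))\<^sup>2) \<partial>M) = ennreal (\<Sum>j<n. (\<integral>\<omega>. (cmod (Z j \<omega>))\<^sup>2 \<partial>M))"
    using Wi by (simp add: nn_integral_eq_integral var)
  also have "\<dots> = (\<Sum>j<n. (\<integral>\<^sup>+\<omega>. ennreal ((cmod (Z j \<omega>))\<^sup>2) \<partial>M))"
    by (subst sum_ennreal[symmetric]) (auto intro!: sum.cong simp: nn_integral_eq_integral Zi2)
  also have "\<dots> \<le> (\<Sum>j<n. ?I)" by (intro sum_mono diag) auto
  finally have Wle: "(\<integral>\<^sup>+\<omega>. ennreal ((cmod (W \<omega>))\<^sup>2) \<partial>M) \<le> of_nat n * ?I" by simp
  have "(\<Sum>j<n. f (d j \<omega>)) / of_nat n - m = W \<omega> / of_nat n" for \<omega>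
    using n by (simp add: W_def Z_def sum_subtractf diff_divide_distrib)
  then have "(\<integral>\<^sup>+\<omega>. ennreal ((cmod ((\<Sum>j<n. f (d j \<omega>)) / of_nat n - m))\<^sup>2) \<partial>M) = (\<integral>\<^sup>+\<omega>. ennreal (1 / (real n)\<^sup>2) * ennreal ((cmod (W \<omega>))\<^sup>2) \<partial>M)"
    by (intro nn_integral_cong) (simp add: norm_divide power_divide ennreal_mult'[symmetric])
  also have "\<dots> = ennreal (1 / (real n)\<^sup>2) * (\<integral>\<^sup>+\<omega>. ennreal ((cmod (W \<omega>))\<^sup>2) \<partial>M)"
    by (rule nn_integral_cmult) measurable
  also have "\<dots> \<le> ennreal (1 / (real n)\<^sup>2) * (of_nat n * ?I)"
    by (intro mult_left_mono Wle) auto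
  also have "\<dots> = ennreal (1 / real n) * ?I"
    using n by (simp add: mult.assoc[symmetric] ennreal_of_nat_eq_real_of_nat ennreal_mult'[symmetric] power2_eq_square)
  finally show ?thesis unfolding m_def .
qed

section \<open>The law of the matrix model\<close>

definition noise_coordinates ::
  "(nat \<times> nat \<Rightarrow> real \<Rightarrow> 'a \<Rightarrow> real) \<Rightarrow> (nat \<times> nat \<Rightarrow> real \<Rightarrow> 'a \<Rightarrow> real) \<Rightarrow> real \<Rightarrow> 'a \<Rightarrow> gue_index \<Rightarrow> real" where
  "noise_coordinates B B' t \<omega> \<alpha> = case_sum B B' \<alpha> t \<omega>"

lemma gue_eq:
  assumes ij: "i < n" "j < n"
  shows "gue n \<xi> i j = of_real (\<xi> (Inl (min i j, max i j))) / of_real (sqrt (if i = j then real n else 2 * real n))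
    + of_real (\<xi> (Inr (min i j, max i j))) * ((if i < j then \<i> else if j < i then - \<i> else 0) / of_real (sqrt (2 * real n)))"
  unfolding gue_def sum_gue_basis[OF ij] by (simp add: gue_basis_def)

lemma observed_matrix_eq:
  "observed_matrix n d B B' t \<omega> = mat n n (\<lambda>(i, j). deformed_gue n (order_statistic n d \<omega>) (noise_coordinates B B' t \<omega>) i j)"
proof (rule eq_matI)
  fix i j
  assume "i < dim_row (mat n n (\<lambda>(i, j). deformed_gue n (order_statistic n d \<omega>) (noise_coordinates B B' t \<omega>) i j))"
    "j < dim_col (mat n n (\<lambda>(i, j). deformed_gue n (order_statistic n d \<omega>) (noise_coordinates B B' t \<omega>) i j))"
  then have ij: "i < n" "j < n" by simp_all
  have "hermitian_process n B B' t \<omega> $$ (i, j) = gue n (noise_coordinates B B' t \<omega>) i j"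
    using ij unfolding gue_eq[OF ij]
    by (cases i j rule: linorder_cases)
      (simp_all add: hermitian_process_def noise_coordinates_def Complex_eq add_divide_distrib diff_divide_distrib)
  then show "observed_matrix n d B B' t \<omega> $$ (i, j)
     = mat n n (\<lambda>(i, j). deformed_gue n (order_statistic n d \<omega>) (noise_coordinates B B' t \<omega>) i j) $$ (i, j)"
    using ij by (simp add: observed_matrix_def initial_matrix_def mat_diag_def deformed_gue_def id_matrix_def hermitian_process_def)
qed (simp_all add: observed_matrix_def hermitian_process_def)

lemma resolvent_cong: "(\<And>i j. i < n \<Longrightarrow> j < n \<Longrightarrow> X i j = Y i j) \<Longrightarrow> resolvent n X w = resolvent n Y w"
proof -
  assume eq: "\<And>i j. i < n \<Longrightarrow> j < n \<Longrightarrow> X i j = Y i j"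
  have "mat n n (\<lambda>(i, j). pencil X w i j) = mat n n (\<lambda>(i, j). pencil Y w i j)"
    by (rule cong_mat) (auto simp: pencil_def eq)
  then show ?thesis unfolding resolvent_def[abs_def] by simp
qed

lemma deformed_gue_restrict:
  assumes "i < n" "j < n"
  shows "deformed_gue n (restrict a {..<n}) (restrict \<xi> (gue_indices n)) i j = deformed_gue n a \<xi> i j"
proof -
  have "gue n (restrict \<xi> (gue_indices n)) i j = gue n \<xi> i j"
    unfolding gue_def by (intro sum.cong refl) simp
  then show ?thesis using assms by (simp add: deformed_gue_def)
qed

lemma brownian_marginal:
  assumes W: "standard_brownian_motion M W" and t: "t > 0"
  shows "distr M borel (W t) = gaussian (sqrt t)" "W t \<in> borel_measurable M"
proof -
  have m: "W t \<in> borel_measurable M" "W 0 \<in> borel_measurable M"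
    using W t by (auto simp: standard_brownian_motion_def)
  have "AE \<omega> in M. W 0 \<omega> = 0" using W by (simp add: standard_brownian_motion_def)
  then have ae: "AE \<omega> in M. W t \<omega> = W t \<omega> - W 0 \<omega>" by eventually_elim simp
  have "distributed M lborel (\<lambda>\<omega>. W t \<omega> - W 0 \<omega>) (normal_density 0 (sqrt (t - 0)))"
    using W t unfolding standard_brownian_motion_def by blast
  then have "distr M lborel (\<lambda>\<omega>. W t \<omega> - W 0 \<omega>) = gaussian (sqrt t)"
    by (simp add: distributed_distr_eq_density)
  moreover have "distr M borel (W t) = distr M lborel (\<lambda>\<omega>. W t \<omega> - W 0 \<omega>)"
    by (rule distr_cong_AE) (use ae m in auto)
  ultimately show "distr M borel (W t) = gaussian (sqrt t)" by simp
  show "W t \<in> borel_measurable M" by fact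
qed

text \<open>
  Stated for random elements of two different types, the eigenvalue vector and the family of noise coordinates.
\<close>

lemma (in prob_space) joint_distr_eq_product:
  assumes X: "X \<in> measurable M S" and Y: "Y \<in> measurable M T"
    and prod: "\<And>A B. A \<in> sets S \<Longrightarrow> B \<in> sets T \<Longrightarrow>
      prob ((X -` A \<inter> space M) \<inter> (Y -` B \<inter> space M)) = prob (X -` A \<inter> space M) * prob (Y -` B \<inter> space M)"
  shows "distr M (S \<Otimes>\<^sub>M T) (\<lambda>\<omega>. (X \<omega>, Y \<omega>)) = distr M S X \<Otimes>\<^sub>M distr M T Y"
proof (rule pair_measure_eqI[symmetric])
  interpret X: prob_space "distr M S X" by (rule prob_space_distr[OF X])
  interpret Y: prob_space "distr M T Y" by (rule prob_space_distr[OF Y])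
  show "sigma_finite_measure (distr M S X)" "sigma_finite_measure (distr M T Y)"
    by (rule X.sigma_finite_measure_axioms Y.sigma_finite_measure_axioms)+
  show "sets (distr M S X \<Otimes>\<^sub>M distr M T Y) = sets (distr M (S \<Otimes>\<^sub>M T) (\<lambda>\<omega>. (X \<omega>, Y \<omega>)))"
    by (simp cong: sets_pair_measure_cong)
  fix A B assume "A \<in> sets (distr M S X)" "B \<in> sets (distr M T Y)"
  then have AB: "A \<in> sets S" "B \<in> sets T" by auto
  have XY: "(\<lambda>\<omega>. (X \<omega>, Y \<omega>)) \<in> measurable M (S \<Otimes>\<^sub>M T)" using X Y by simp
  have "emeasure (distr M (S \<Otimes>\<^sub>M T) (\<lambda>\<omega>. (X \<omega>, Y \<omega>))) (A \<times> B) = emeasure M ((\<lambda>\<omega>. (X \<omega>, Y \<omega>)) -` (A \<times> B) \<inter> space M)"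
    using AB by (intro emeasure_distr[OF XY]) auto
  also have "(\<lambda>\<omega>. (X \<omega>, Y \<omega>)) -` (A \<times> B) \<inter> space M = (X -` A \<inter> space M) \<inter> (Y -` B \<inter> space M)" by auto
  finally show "emeasure (distr M S X) A * emeasure (distr M T Y) B = emeasure (distr M (S \<Otimes>\<^sub>M T) (\<lambda>\<omega>. (X \<omega>, Y \<omega>))) (A \<times> B)"
    by (simp add: emeasure_distr X Y AB emeasure_eq_measure prod ennreal_mult')
qed

text \<open>
  The model asserts independence of the \<open>\<sigma>\<close>-algebras generated by the matrix entries. The order statistics
  are the diagonal entries of the initial matrix, and the Brownian motions at time \<open>t\<close> can be recovered
  from the entries of the noise matrix, so both are measurable for the respective \<open>\<sigma>\<close>-algebra.
\<close>

lemma model_joint_law: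
  assumes model: "matrix_model M \<mu> n d B B'" and n: "n \<ge> 1" and t: "t > 0"
  defines "a \<equiv> \<lambda>\<omega>. \<lambda>i\<in>{..<n}. order_statistic n d \<omega> i"
  defines "x \<equiv> \<lambda>\<omega>. \<lambda>\<alpha>\<in>gue_indices n. noise_coordinates B B' t \<omega> \<alpha>"
  defines "NA \<equiv> Pi\<^sub>M {..<n} (\<lambda>_. borel :: real measure)"
  defines "NX \<equiv> Pi\<^sub>M (gue_indices n) (\<lambda>_. borel :: real measure)"
  shows "a \<in> measurable M NA" "x \<in> measurable M NX"
    "distr M (NA \<Otimes>\<^sub>M NX) (\<lambda>\<omega>. (a \<omega>, x \<omega>)) = distr M NA a \<Otimes>\<^sub>M Pi\<^sub>M (gue_indices n) (\<lambda>_. gaussian (sqrt t))"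
proof -
  interpret prob_space M using model by (simp add: matrix_model_def)
  define I1 where "I1 = {..<n} \<times> {..<n}"
  define I2 where "I2 = I1 \<times> {0::real..}"
  define f1 where "f1 = (\<lambda>\<omega>. \<lambda>kl\<in>I1. initial_matrix n d \<omega> $$ kl)"
  define f2 where "f2 = (\<lambda>\<omega>. restrict (\<lambda>(kl, s). hermitian_process n B B' s \<omega> $$ kl) I2)"
  define N1 where "N1 = Pi\<^sub>M I1 (\<lambda>_. borel :: complex measure)"
  define N2 where "N2 = Pi\<^sub>M I2 (\<lambda>_. borel :: complex measure)"
  have ind: "indep_set (sets (vimage_algebra (space M) f1 N1)) (sets (vimage_algebra (space M) f2 N2))"
    using model unfolding matrix_model_def I1_def I2_def f1_def f2_def N1_def N2_def by blast
  have rv: "random_variable N1 f1" "random_variable N2 f2"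
  proof -
    have "sets (vimage_algebra (space M) f1 N1) \<subseteq> events" "sets (vimage_algebra (space M) f2 N2) \<subseteq> events"
      using ind by (auto simp: indep_sets2_eq)
    moreover have "f1 \<in> space M \<rightarrow> space N1" "f2 \<in> space M \<rightarrow> space N2"
      by (auto simp: f1_def f2_def N1_def N2_def space_PiM)
    ultimately show "random_variable N1 f1" "random_variable N2 f2"
      by (auto intro!: measurableI in_vimage_algebra)
  qed
  \<comment> \<open>the maps that recover eigenvalues and noise coordinates from matrix entries; the factors undo
    the normalisation of the entries\<close>
  define Y1 where "Y1 = (\<lambda>u :: nat \<times> nat \<Rightarrow> complex. \<lambda>i\<in>{..<n}. Re (u (i, i)))"
  define Y2 where "Y2 = (\<lambda>u :: (nat \<times> nat) \<times> real \<Rightarrow> complex. \<lambda>\<alpha>\<in>gue_indices n.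
    (case \<alpha> of Inl (k, l) \<Rightarrow> if k = l then sqrt (real n) * Re (u ((k, l), t)) else sqrt (2 * real n) * Re (u ((k, l), t))
     | Inr (k, l) \<Rightarrow> sqrt (2 * real n) * Im (u ((k, l), t))))"
  have Y1: "Y1 \<in> measurable N1 NA"
    unfolding Y1_def NA_def N1_def by (rule measurable_restrict) (auto simp: I1_def)
  have comp: "(\<lambda>u. u ((k, l), t)) \<in> borel_measurable N2" if "k < n" "l < n" for k l
    unfolding N2_def by (rule measurable_component_singleton) (use that t in \<open>auto simp: I2_def I1_def\<close>)
  have Y2: "Y2 \<in> measurable N2 NX"
    unfolding Y2_def NX_def
  proof (rule measurable_restrict)
    fix \<alpha> assume \<alpha>: "\<alpha> \<in> gue_indices n"
    obtain k l where kl: "(\<alpha> = Inl (k, l) \<or> \<alpha> = Inr (k, l))" "k < n" "l < n"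
      using \<alpha> by (auto simp: gue_indices_def)
    note [measurable] = comp[OF kl(2,3)]
    have "(\<lambda>u. sqrt (real n) * Re (u ((k, l), t))) \<in> borel_measurable N2"
      "(\<lambda>u. sqrt (2 * real n) * Re (u ((k, l), t))) \<in> borel_measurable N2"
      "(\<lambda>u. sqrt (2 * real n) * Im (u ((k, l), t))) \<in> borel_measurable N2"
      by measurable
    then show "(\<lambda>u. case \<alpha> of Inl (k, l) \<Rightarrow> if k = l then sqrt (real n) * Re (u ((k, l), t)) else sqrt (2 * real n) * Re (u ((k, l), t))
     | Inr (k, l) \<Rightarrow> sqrt (2 * real n) * Im (u ((k, l), t))) \<in> borel_measurable N2"
      using kl(1) by (cases "k = l") auto
  qed
  have a: "Y1 \<circ> f1 = a"
    by (auto simp: fun_eq_iff Y1_def f1_def a_def I1_def initial_matrix_def mat_diag_def restrict_def)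
  have x: "Y2 \<circ> f2 = x"
  proof (intro ext)
    fix \<omega> \<alpha>
    show "(Y2 \<circ> f2) \<omega> \<alpha> = x \<omega> \<alpha>"
    proof (cases "\<alpha> \<in> gue_indices n")
      case True
      then consider k where "\<alpha> = Inl (k, k)" "k < n" | k l where "\<alpha> = Inl (k, l)" "k < l" "l < n"
        | k l where "\<alpha> = Inr (k, l)" "k < l" "l < n"
        unfolding gue_indices_def by (auto simp: order_le_less)
      then show ?thesis
        using True n t
        by cases (auto simp: Y2_def f2_def x_def I2_def I1_def noise_coordinates_def hermitian_process_def
            simp flip: of_real_divide)
    qed (simp add: Y2_def x_def)
  qed
  show am: "a \<in> measurable M NA" unfolding a[symmetric] by (rule measurable_comp[OF rv(1) Y1])
  show xm: "x \<in> measurable M NX" unfolding x[symmetric] by (rule measurable_comp[OF rv(2) Y2])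
  have joint: "distr M (NA \<Otimes>\<^sub>M NX) (\<lambda>\<omega>. (a \<omega>, x \<omega>)) = distr M NA a \<Otimes>\<^sub>M distr M NX x"
  proof (rule joint_distr_eq_product[OF am xm])
    fix A C assume A: "A \<in> sets NA" and C: "C \<in> sets NX"
    have "a -` A \<inter> space M = f1 -` (Y1 -` A \<inter> space N1) \<inter> space M"
      using measurable_space[OF rv(1)] unfolding a[symmetric] by auto
    then have 1: "a -` A \<inter> space M \<in> sets (vimage_algebra (space M) f1 N1)"
      using in_vimage_algebra[OF measurable_sets[OF Y1 A]] by simp
    have "x -` C \<inter> space M = f2 -` (Y2 -` C \<inter> space N2) \<inter> space M"
      using measurable_space[OF rv(2)] unfolding x[symmetric] by auto
    then have 2: "x -` C \<inter> space M \<in> sets (vimage_algebra (space M) f2 N2)"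
      using in_vimage_algebra[OF measurable_sets[OF Y2 C]] by simp
    show "prob ((a -` A \<inter> space M) \<inter> (x -` C \<inter> space M)) = prob (a -` A \<inter> space M) * prob (x -` C \<inter> space M)"
      using ind 1 2 unfolding indep_sets2_eq by blast
  qed
  have "distr M NX x = Pi\<^sub>M (gue_indices n) (\<lambda>\<alpha>. distr M borel (\<lambda>\<omega>. noise_coordinates B B' t \<omega> \<alpha>))"
  proof -
    have "indep_vars (\<lambda>_. Pi\<^sub>M {0..} (\<lambda>_. borel)) (\<lambda>\<alpha> \<omega>. \<lambda>s\<in>{0..}. case_sum B B' \<alpha> s \<omega>) (gue_indices n)"
      using model unfolding matrix_model_def gue_indices_def by blast
    then have "indep_vars (\<lambda>_. borel) (\<lambda>\<alpha> \<omega>. (\<lambda>s\<in>{0..}. case_sum B B' \<alpha> s \<omega>) t) (gue_indices n)"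
      by (rule indep_vars_compose2[where Y = "\<lambda>_ u. u t"]) (use t in auto)
    then have iv: "indep_vars (\<lambda>_. borel) (\<lambda>\<alpha> \<omega>. noise_coordinates B B' t \<omega> \<alpha>) (gue_indices n)"
      using t by (simp add: noise_coordinates_def)
    have "Inl (0, 0) \<in> gue_indices n" using n by (auto simp: gue_indices_def)
    then have ne: "gue_indices n \<noteq> {}" by blast
    have "random_variable borel (\<lambda>\<omega>. noise_coordinates B B' t \<omega> \<alpha>)" if "\<alpha> \<in> gue_indices n" for \<alpha>
      using iv that by (auto simp: indep_vars_def)
    from indep_vars_iff_distr_eq_PiM'[OF ne this, THEN iffD1, OF _ iv]
    show ?thesis unfolding NX_def x_def .
  qed
  also have "\<dots> = Pi\<^sub>M (gue_indices n) (\<lambda>_. gaussian (sqrt t))"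
  proof (rule PiM_cong[OF refl])
    fix \<alpha> assume \<alpha>: "\<alpha> \<in> gue_indices n"
    have "standard_brownian_motion M (case_sum B B' \<alpha>)"
      using \<alpha> model unfolding matrix_model_def gue_indices_def by auto
    from brownian_marginal(1)[OF this t]
    show "distr M borel (\<lambda>\<omega>. noise_coordinates B B' t \<omega> \<alpha>) = gaussian (sqrt t)"
      by (simp add: noise_coordinates_def)
  qed
  finally have law: "distr M NX x = Pi\<^sub>M (gue_indices n) (\<lambda>_. gaussian (sqrt t))" .
  show "distr M (NA \<Otimes>\<^sub>M NX) (\<lambda>\<omega>. (a \<omega>, x \<omega>)) = distr M NA a \<Otimes>\<^sub>M Pi\<^sub>M (gue_indices n) (\<lambda>_. gaussian (sqrt t))"
    using joint unfolding law .
qed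

text \<open>
  Symmetric functions do not see the sorting, which gives the i.i.d. sample back.
\<close>

lemma sum_order_statistic: "(\<Sum>i<n. f (order_statistic n d \<omega> i)) = (\<Sum>j<n. f (d j \<omega>) :: complex)"
proof -
  let ?xs = "map (\<lambda>j. d j \<omega>) [0..<n]"
  have "(\<Sum>i<n. f (order_statistic n d \<omega> i)) = sum_list (map f (sort ?xs))"
    by (simp add: order_statistic_def sum_list_sum_nth atLeast0LessThan)
  also have "\<dots> = sum_list (map f ?xs)"
    by (metis mset_map mset_sort sum_mset_sum_list)
  also have "\<dots> = (\<Sum>j<n. f (d j \<omega>))"
    by (simp add: sum_list_sum_nth atLeast0LessThan)
  finally show ?thesis .
qed

section \<open>The expected error\<close>

text \<open>
  Conditionally on the initial eigenvalues the error at each \<open>x\<close> is bounded by \<open>conditional_error_bound\<close>. The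
  two resulting terms are integrated over \<open>x\<close> in opposite orders: for the noise, \<open>x\<close> first for each
  realisation; for the sampling error, the expectation first and then \<open>x\<close>.
\<close>

lemma expected_error_bound:
  fixes \<mu> :: "real measure"
  assumes model: "matrix_model M \<mu> n d B B'" and n: "n \<ge> 1" and t: "t > 0" and \<gamma>: "\<gamma> > 2 * sqrt t"
    and \<mu>: "prob_space \<mu>" "sets \<mu> = sets borel"
  defines "G \<equiv> \<lambda>x. cauchy_transform \<mu> (Complex x \<gamma>)"
  defines "w \<equiv> \<lambda>x. Complex x \<gamma> + of_real t * G x"
  defines "X \<equiv> \<lambda>\<omega>. deformed_gue n (order_statistic n d \<omega>) (noise_coordinates B B' t \<omega>)"
  shows "(\<integral>\<^sup>+\<omega>. (\<integral>\<^sup>+x. ennreal ((cmod (mat_trace n (resolvent n (X \<omega>) (w x)) / of_nat n - G x))\<^sup>2) \<partial>lborel) \<partial>M)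
      \<le> ennreal (72 * pi / \<gamma> / real n)"
    and "(\<lambda>\<omega>. \<integral>\<^sup>+x. ennreal ((cmod (mat_trace n (resolvent n (X \<omega>) (w x)) / of_nat n - G x))\<^sup>2) \<partial>lborel) \<in> borel_measurable M"
proof -
  interpret prob_space M using model by (simp add: matrix_model_def)
  interpret \<mu>: prob_space \<mu> by fact
  note [measurable_cong] = \<mu>(2)
  have n0: "n > 0" using n by simp
  note \<gamma>0 = strip_height(1)[OF t \<gamma>]
  have t_less: "t / \<gamma> \<le> \<gamma> / 4"
    using strip_height(2)[OF t \<gamma>] \<gamma>0 by (simp add: field_simps power2_eq_square)
  have Gbd: "cmod (of_real t * G x) \<le> t / \<gamma>" for x
    using norm_cauchy_transform_le[OF \<mu>, of "Complex x \<gamma>"] \<gamma>0 t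
    by (simp add: G_def norm_mult) (metis mult.right_neutral mult_left_mono less_imp_le times_divide_eq_right)
  have w_close: "cmod (w x - Complex x \<gamma>) \<le> \<gamma> / 2" for x
  proof -
    have eq: "w x - Complex x \<gamma> = of_real t * G x" by (simp add: w_def)
    show ?thesis unfolding eq using Gbd[of x] t_less \<gamma>0 by linarith
  qed
  have w_Im: "Im (w x) \<ge> \<gamma> / 2" for x
    using w_close[of x] abs_Im_le_cmod[of "w x - Complex x \<gamma>"] by simp
  have Gm[measurable]: "G \<in> borel_measurable borel"
    unfolding G_def by (rule borel_measurable_cauchy_transform[OF \<mu>])
  have zm[measurable]: "(\<lambda>x. Complex x \<gamma>) \<in> borel_measurable borel" unfolding Complex_eq by measurable
  have wm[measurable]: "w \<in> borel_measurable borel" unfolding w_def by measurable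
  define a where "a = (\<lambda>\<omega>. \<lambda>i\<in>{..<n}. order_statistic n d \<omega> i)"
  define \<xi> where "\<xi> = (\<lambda>\<omega>. \<lambda>\<alpha>\<in>gue_indices n. noise_coordinates B B' t \<omega> \<alpha>)"
  define NA where "NA = Pi\<^sub>M {..<n} (\<lambda>_. borel :: real measure)"
  define NX where "NX = Pi\<^sub>M (gue_indices n) (\<lambda>_. borel :: real measure)"
  define P where "P = Pi\<^sub>M (gue_indices n) (\<lambda>_. gaussian (sqrt t))"
  have am[measurable]: "a \<in> measurable M NA" and \<xi>m[measurable]: "\<xi> \<in> measurable M NX"
    and law: "distr M (NA \<Otimes>\<^sub>M NX) (\<lambda>\<omega>. (a \<omega>, \<xi> \<omega>)) = distr M NA a \<Otimes>\<^sub>M P"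
    unfolding a_def \<xi>_def NA_def NX_def P_def by (rule model_joint_law[OF model n t])+
  interpret P: prob_space P
    unfolding P_def by (rule prob_space_PiM, rule prob_space_normal_density) (use t in auto)
  interpret LA: prob_space "distr M NA a" by (rule prob_space_distr[OF am])
  have sP[measurable_cong]: "sets P = sets NX" unfolding P_def NX_def by (rule sets_PiM_cong) auto
  have Ym: "(\<lambda>p. deformed_gue n (fst p) (snd p) i j) \<in> borel_measurable (NA \<Otimes>\<^sub>M NX)" if "i < n" "j < n" for i j
  proof -
    have "(\<lambda>p. fst p i) \<in> borel_measurable (NA \<Otimes>\<^sub>M NX)"
      using that unfolding NA_def by (intro measurable_compose[OF measurable_fst measurable_component_singleton]) auto
    moreover have "(\<lambda>p. snd p \<alpha>) \<in> borel_measurable (NA \<Otimes>\<^sub>M NX)" if "\<alpha> \<in> gue_indices n" for \<alpha>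
      using that unfolding NX_def by (intro measurable_compose[OF measurable_snd measurable_component_singleton]) auto
    ultimately show ?thesis unfolding deformed_gue_def gue_def by measurable
  qed
  have X_eq: "resolvent n (X \<omega>) v = resolvent n (deformed_gue n (a \<omega>) (\<xi> \<omega>)) v" for \<omega> v
    unfolding X_def a_def \<xi>_def by (rule resolvent_cong) (simp add: deformed_gue_restrict)
  have Rm: "(\<lambda>p. resolvent n (deformed_gue n (fst (fst p)) (snd (fst p))) (w (snd p)) i j) \<in> borel_measurable ((NA \<Otimes>\<^sub>M NX) \<Otimes>\<^sub>M lborel)"
    if "i < n" "j < n" for i j
    by (rule borel_measurable_resolvent[OF _ _ that])
      (auto intro: measurable_compose[OF measurable_fst Ym] measurable_compose[OF measurable_snd wm])
  \<comment> \<open>squared error, squared Hilbert-Schmidt norm of the resolvent and (below) squared sampling error, as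
    functions of the initial eigenvalues \<open>u\<close>, the noise coordinates and \<open>x\<close>\<close>
  define T where "T u e x = ennreal ((cmod (mat_trace n (resolvent n (deformed_gue n u e) (w x)) / of_nat n - G x))\<^sup>2)" for u e x
  define H where "H u e x = ennreal ((hs_norm n (resolvent n (deformed_gue n u e) (w x)))\<^sup>2)" for u e x
  have Tm: "(\<lambda>p. T (fst (fst p)) (snd (fst p)) (snd p)) \<in> borel_measurable ((NA \<Otimes>\<^sub>M NX) \<Otimes>\<^sub>M lborel)"
  proof -
    have [measurable]: "(\<lambda>p. mat_trace n (resolvent n (deformed_gue n (fst (fst p)) (snd (fst p))) (w (snd p)))) \<in> borel_measurable ((NA \<Otimes>\<^sub>M NX) \<Otimes>\<^sub>M lborel)"
      unfolding mat_trace_def by (intro borel_measurable_sum Rm) auto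
    show ?thesis unfolding T_def by measurable
  qed
  have Hm: "(\<lambda>p. H (fst (fst p)) (snd (fst p)) (snd p)) \<in> borel_measurable ((NA \<Otimes>\<^sub>M NX) \<Otimes>\<^sub>M lborel)"
  proof -
    have [measurable]: "(\<lambda>p. \<Sum>i<n. \<Sum>j<n. (cmod (resolvent n (deformed_gue n (fst (fst p)) (snd (fst p))) (w (snd p)) i j))\<^sup>2) \<in> borel_measurable ((NA \<Otimes>\<^sub>M NX) \<Otimes>\<^sub>M lborel)"
      using Rm by (auto intro!: borel_measurable_sum borel_measurable_power borel_measurable_norm)
    show ?thesis unfolding H_def hs_square by measurable
  qed
  have fixm: "(\<lambda>p. F (fst p) (snd p) x) \<in> borel_measurable (NA \<Otimes>\<^sub>M NX)"
    if "(\<lambda>p. F (fst (fst p)) (snd (fst p)) (snd p)) \<in> borel_measurable ((NA \<Otimes>\<^sub>M NX) \<Otimes>\<^sub>M lborel)"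
    for F :: "(nat \<Rightarrow> real) \<Rightarrow> (gue_index \<Rightarrow> real) \<Rightarrow> real \<Rightarrow> ennreal" and x
    using measurable_compose[OF measurable_Pair2' that, of x] by simp
  have \<omega>m: "(\<lambda>p. F (a (fst p)) (\<xi> (fst p)) (snd p)) \<in> borel_measurable (M \<Otimes>\<^sub>M lborel)"
    if F: "(\<lambda>p. F (fst (fst p)) (snd (fst p)) (snd p)) \<in> borel_measurable ((NA \<Otimes>\<^sub>M NX) \<Otimes>\<^sub>M lborel)"
    for F :: "(nat \<Rightarrow> real) \<Rightarrow> (gue_index \<Rightarrow> real) \<Rightarrow> real \<Rightarrow> ennreal"
  proof -
    have "(\<lambda>p. ((a (fst p), \<xi> (fst p)), snd p)) \<in> measurable (M \<Otimes>\<^sub>M lborel) ((NA \<Otimes>\<^sub>M NX) \<Otimes>\<^sub>M lborel)"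
      by measurable
    from measurable_compose[OF this F] show ?thesis by simp
  qed
  \<comment> \<open>independence of initial matrix and noise: the noise is integrated with the eigenvalues frozen\<close>
  have transfer: "(\<integral>\<^sup>+\<omega>. F (a \<omega>) (\<xi> \<omega>) x \<partial>M) = (\<integral>\<^sup>+u. (\<integral>\<^sup>+e. F u e x \<partial>P) \<partial>distr M NA a)"
    if F: "(\<lambda>p. F (fst (fst p)) (snd (fst p)) (snd p)) \<in> borel_measurable ((NA \<Otimes>\<^sub>M NX) \<Otimes>\<^sub>M lborel)"
    for F :: "(nat \<Rightarrow> real) \<Rightarrow> (gue_index \<Rightarrow> real) \<Rightarrow> real \<Rightarrow> ennreal" and x
  proof -
    have Fx: "(\<lambda>p. F (fst p) (snd p) x) \<in> borel_measurable (NA \<Otimes>\<^sub>M NX)" by (rule fixm[OF F])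
    have "(\<integral>\<^sup>+\<omega>. F (a \<omega>) (\<xi> \<omega>) x \<partial>M) = (\<integral>\<^sup>+p. F (fst p) (snd p) x \<partial>distr M (NA \<Otimes>\<^sub>M NX) (\<lambda>\<omega>. (a \<omega>, \<xi> \<omega>)))"
      using Fx by (subst nn_integral_distr) auto
    also have "\<dots> = (\<integral>\<^sup>+p. F (fst p) (snd p) x \<partial>(distr M NA a \<Otimes>\<^sub>M P))" by (simp only: law)
    also have "\<dots> = (\<integral>\<^sup>+u. (\<integral>\<^sup>+e. F u e x \<partial>P) \<partial>distr M NA a)"
    proof -
      have "sets (distr M NA a \<Otimes>\<^sub>M P) = sets (NA \<Otimes>\<^sub>M NX)" by (rule sets_pair_measure_cong) (auto simp: sP)
      then have "(\<lambda>p. F (fst p) (snd p) x) \<in> borel_measurable (distr M NA a \<Otimes>\<^sub>M P)"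
        using Fx by (simp cong: measurable_cong_sets)
      from P.nn_integral_fst[OF this] show ?thesis by simp
    qed
    finally show ?thesis .
  qed
  define e where "e u x = ennreal ((cmod ((\<Sum>i<n. 1 / (Complex x \<gamma> - of_real (u i))) / of_nat n - G x))\<^sup>2)" for u :: "nat \<Rightarrow> real" and x
  have em: "(\<lambda>p. e (fst (fst p)) (snd p)) \<in> borel_measurable ((NA \<Otimes>\<^sub>M NX) \<Otimes>\<^sub>M lborel)"
  proof -
    have c: "(\<lambda>p. fst (fst p) i) \<in> borel_measurable ((NA \<Otimes>\<^sub>M NX) \<Otimes>\<^sub>M lborel)" if "i < n" for i
    proof -
      have "(\<lambda>u. u i) \<in> borel_measurable NA" unfolding NA_def by (rule measurable_component_singleton) (use that in auto)
      then show ?thesis by measurable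
    qed
    have [measurable]: "(\<lambda>p. \<Sum>i<n. 1 / (Complex (snd p) \<gamma> - of_real (fst (fst p) i))) \<in> borel_measurable ((NA \<Otimes>\<^sub>M NX) \<Otimes>\<^sub>M lborel)"
    proof (intro borel_measurable_sum borel_measurable_divide borel_measurable_diff borel_measurable_const)
      show "(\<lambda>p. Complex (snd p) \<gamma>) \<in> borel_measurable ((NA \<Otimes>\<^sub>M NX) \<Otimes>\<^sub>M lborel)" by measurable
      fix i assume "i \<in> {..<n}"
      then show "(\<lambda>p. complex_of_real (fst (fst p) i)) \<in> borel_measurable ((NA \<Otimes>\<^sub>M NX) \<Otimes>\<^sub>M lborel)"
        using c[of i] by (intro measurable_compose[OF _ borel_measurable_of_real]) auto
    qed
    show ?thesis unfolding e_def by measurable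
  qed
  have pointwise: "(\<integral>\<^sup>+\<omega>. T (a \<omega>) (\<xi> \<omega>) x \<partial>M) \<le> ennreal 8 * (\<integral>\<^sup>+\<omega>. e (a \<omega>) x \<partial>M) + ennreal (16 / real n ^ 3) * (\<integral>\<^sup>+\<omega>. H (a \<omega>) (\<xi> \<omega>) x \<partial>M)" for x
  proof -
    have "(\<integral>\<^sup>+\<omega>. T (a \<omega>) (\<xi> \<omega>) x \<partial>M) = (\<integral>\<^sup>+u. (\<integral>\<^sup>+e. T u e x \<partial>P) \<partial>distr M NA a)" by (rule transfer[OF Tm])
    also have "\<dots> \<le> (\<integral>\<^sup>+u. ennreal 8 * e u x + ennreal (16 / real n ^ 3) * (\<integral>\<^sup>+v. H u v x \<partial>P) \<partial>distr M NA a)"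
    proof (rule nn_integral_mono)
      fix u
      interpret S: subordinated_resolvent n u t \<gamma> "Complex x \<gamma>" "of_real t * G x"
        by unfold_locales (use n0 t \<gamma> Gbd in auto)
      show "(\<integral>\<^sup>+e. T u e x \<partial>P) \<le> ennreal 8 * e u x + ennreal (16 / real n ^ 3) * (\<integral>\<^sup>+v. H u v x \<partial>P)"
        using S.conditional_error_bound[of "G x"] unfolding T_def H_def e_def w_def P_def S.P_def by simp
    qed
    also have "\<dots> = ennreal 8 * (\<integral>\<^sup>+u. e u x \<partial>distr M NA a) + ennreal (16 / real n ^ 3) * (\<integral>\<^sup>+u. (\<integral>\<^sup>+v. H u v x \<partial>P) \<partial>distr M NA a)"
    proof -
      have "(\<lambda>u. e u x) \<in> borel_measurable NA"
      proof -
        have [measurable]: "(\<lambda>u. \<Sum>i<n. 1 / (Complex x \<gamma> - of_real (u i))) \<in> borel_measurable NA"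
        proof (intro borel_measurable_sum borel_measurable_divide borel_measurable_diff borel_measurable_const)
          fix i assume "i \<in> {..<n}"
          then have "(\<lambda>u. u i) \<in> borel_measurable NA" unfolding NA_def by (rule measurable_component_singleton)
          then show "(\<lambda>u. complex_of_real (u i)) \<in> borel_measurable NA"
            by (rule measurable_compose[OF _ borel_measurable_of_real])
        qed
        show ?thesis unfolding e_def by measurable
      qed
      moreover have "(\<lambda>u. \<integral>\<^sup>+v. H u v x \<partial>P) \<in> borel_measurable NA"
      proof -
        have "(\<lambda>p. H (fst p) (snd p) x) \<in> borel_measurable (NA \<Otimes>\<^sub>M P)"
          using fixm[OF Hm, of x] sets_pair_measure_cong[OF refl sP, of NA] by (simp cong: measurable_cong_sets)
        then have "(\<lambda>(u, v). H u v x) \<in> borel_measurable (NA \<Otimes>\<^sub>M P)" by (simp add: case_prod_unfold)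
        then show ?thesis by (rule P.borel_measurable_nn_integral)
      qed
      ultimately show ?thesis by (subst nn_integral_add) (auto simp: nn_integral_cmult simp del: ennreal_numeral)
    qed
    also have "(\<integral>\<^sup>+u. (\<integral>\<^sup>+v. H u v x \<partial>P) \<partial>distr M NA a) = (\<integral>\<^sup>+\<omega>. H (a \<omega>) (\<xi> \<omega>) x \<partial>M)" by (rule transfer[OF Hm, symmetric])
    also have "(\<integral>\<^sup>+u. e u x \<partial>distr M NA a) = (\<integral>\<^sup>+\<omega>. e (a \<omega>) x \<partial>M)"
      using transfer[of "\<lambda>u _ x. e u x" x] em by (simp add: P.emeasure_space_1)
    finally show ?thesis .
  qed
  interpret MX: pair_sigma_finite M lborel ..
  have swap: "(\<integral>\<^sup>+\<omega>. (\<integral>\<^sup>+x. F (a \<omega>) (\<xi> \<omega>) x \<partial>lborel) \<partial>M) = (\<integral>\<^sup>+x. (\<integral>\<^sup>+\<omega>. F (a \<omega>) (\<xi> \<omega>) x \<partial>M) \<partial>lborel)"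
    if F: "(\<lambda>p. F (fst (fst p)) (snd (fst p)) (snd p)) \<in> borel_measurable ((NA \<Otimes>\<^sub>M NX) \<Otimes>\<^sub>M lborel)"
    for F :: "(nat \<Rightarrow> real) \<Rightarrow> (gue_index \<Rightarrow> real) \<Rightarrow> real \<Rightarrow> ennreal"
    using MX.Fubini'[of "\<lambda>\<omega> x. F (a \<omega>) (\<xi> \<omega>) x"] \<omega>m[OF F] by (simp add: case_prod_unfold)
  have xm: "(\<lambda>x. \<integral>\<^sup>+\<omega>. F (a \<omega>) (\<xi> \<omega>) x \<partial>M) \<in> borel_measurable lborel"
    if F: "(\<lambda>p. F (fst (fst p)) (snd (fst p)) (snd p)) \<in> borel_measurable ((NA \<Otimes>\<^sub>M NX) \<Otimes>\<^sub>M lborel)"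
    for F :: "(nat \<Rightarrow> real) \<Rightarrow> (gue_index \<Rightarrow> real) \<Rightarrow> real \<Rightarrow> ennreal"
  proof -
    have "(\<lambda>p. F (a (snd p)) (\<xi> (snd p)) (fst p)) \<in> borel_measurable (lborel \<Otimes>\<^sub>M M)"
      using measurable_compose[OF measurable_pair_swap' \<omega>m[OF F]] by (simp add: case_prod_unfold)
    then show ?thesis using borel_measurable_nn_integral[of "\<lambda>x \<omega>. F (a \<omega>) (\<xi> \<omega>) x" lborel] by (simp add: case_prod_unfold)
  qed
  have "(\<lambda>\<omega>. \<integral>\<^sup>+x. T (a \<omega>) (\<xi> \<omega>) x \<partial>lborel) \<in> borel_measurable M"
    using lborel.borel_measurable_nn_integral[of "\<lambda>\<omega> x. T (a \<omega>) (\<xi> \<omega>) x" M] \<omega>m[OF Tm] by (simp add: case_prod_unfold)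
  then show "(\<lambda>\<omega>. \<integral>\<^sup>+x. ennreal ((cmod (mat_trace n (resolvent n (X \<omega>) (w x)) / of_nat n - G x))\<^sup>2) \<partial>lborel) \<in> borel_measurable M"
    unfolding X_eq T_def .
  have noise: "(\<integral>\<^sup>+x. (\<integral>\<^sup>+\<omega>. H (a \<omega>) (\<xi> \<omega>) x \<partial>M) \<partial>lborel) \<le> ennreal (4 * pi / \<gamma> * real n)"
  proof -
    have "(\<integral>\<^sup>+x. (\<integral>\<^sup>+\<omega>. H (a \<omega>) (\<xi> \<omega>) x \<partial>M) \<partial>lborel) = (\<integral>\<^sup>+\<omega>. (\<integral>\<^sup>+x. H (a \<omega>) (\<xi> \<omega>) x \<partial>lborel) \<partial>M)"
      by (rule swap[OF Hm, symmetric])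
    also have "\<dots> \<le> (\<integral>\<^sup>+\<omega>. ennreal (4 * pi / \<gamma> * real n) \<partial>M)"
      unfolding H_def by (intro nn_integral_mono hs_resolvent_horizontal_integral n0 deformed_gue_hermitian \<gamma>0 w_Im w_close)
    finally show ?thesis by (simp add: emeasure_space_1)
  qed
  have sampling: "(\<integral>\<^sup>+x. (\<integral>\<^sup>+\<omega>. e (a \<omega>) x \<partial>M) \<partial>lborel) \<le> ennreal (pi / \<gamma> / real n)"
  proof -
    have "(\<integral>\<^sup>+\<omega>. e (a \<omega>) x \<partial>M) \<le> ennreal (1 / real n) * (\<integral>\<^sup>+y. ennreal (1 / ((x - y)\<^sup>2 + \<gamma>\<^sup>2)) \<partial>\<mu>)" for x
    proof -
      let ?f = "\<lambda>y. 1 / (Complex x \<gamma> - of_real y)"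
      have "e (a \<omega>) x = ennreal ((cmod ((\<Sum>j<n. ?f (d j \<omega>)) / of_nat n - (\<integral>y. ?f y \<partial>\<mu>)))\<^sup>2)" for \<omega>
      proof -
        have "(\<Sum>i<n. ?f (a \<omega> i)) = (\<Sum>i<n. ?f (order_statistic n d \<omega> i))"
          by (intro sum.cong) (auto simp: a_def)
        then show ?thesis unfolding e_def G_def cauchy_transform_def sum_order_statistic[of ?f] by simp
      qed
      then have "(\<integral>\<^sup>+\<omega>. e (a \<omega>) x \<partial>M) = (\<integral>\<^sup>+\<omega>. ennreal ((cmod ((\<Sum>j<n. ?f (d j \<omega>)) / of_nat n - (\<integral>y. ?f y \<partial>\<mu>)))\<^sup>2) \<partial>M)" by simp
      also have "\<dots> \<le> ennreal (1 / real n) * (\<integral>\<^sup>+y. ennreal ((cmod (?f y))\<^sup>2) \<partial>\<mu>)"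
      proof (rule iid_average_second_moment[where C = "1 / \<gamma>"])
        show "indep_vars (\<lambda>_. borel) d {..<n}" "\<And>j. j < n \<Longrightarrow> distr M borel (d j) = \<mu>"
          using model by (auto simp: matrix_model_def)
        show "cmod (?f y) \<le> 1 / \<gamma>" for y by (rule norm_resolvent_kernel_le) (use \<gamma>0 in auto)
      qed (use n0 in auto)
      also have "(\<integral>\<^sup>+y. ennreal ((cmod (?f y))\<^sup>2) \<partial>\<mu>) = (\<integral>\<^sup>+y. ennreal (1 / ((x - y)\<^sup>2 + \<gamma>\<^sup>2)) \<partial>\<mu>)"
        by (intro nn_integral_cong arg_cong[where f = ennreal]) (simp add: norm_divide power_divide cmod_power2)
      finally show ?thesis .
    qed
    then have "(\<integral>\<^sup>+x. (\<integral>\<^sup>+\<omega>. e (a \<omega>) x \<partial>M) \<partial>lborel) \<le> (\<integral>\<^sup>+x. ennreal (1 / real n) * (\<integral>\<^sup>+y. ennreal (1 / ((x - y)\<^sup>2 + \<gamma>\<^sup>2)) \<partial>\<mu>) \<partial>lborel)"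
      by (intro nn_integral_mono)
    also have "\<dots> = ennreal (1 / real n) * (\<integral>\<^sup>+x. (\<integral>\<^sup>+y. ennreal (1 / ((x - y)\<^sup>2 + \<gamma>\<^sup>2)) \<partial>\<mu>) \<partial>lborel)"
      by (rule nn_integral_cmult) measurable
    also have "(\<integral>\<^sup>+x. (\<integral>\<^sup>+y. ennreal (1 / ((x - y)\<^sup>2 + \<gamma>\<^sup>2)) \<partial>\<mu>) \<partial>lborel) = (\<integral>\<^sup>+y. (\<integral>\<^sup>+x. ennreal (1 / ((x - y)\<^sup>2 + \<gamma>\<^sup>2)) \<partial>lborel) \<partial>\<mu>)"
    proof -
      interpret pair_sigma_finite lborel \<mu> ..
      show ?thesis by (rule Fubini'[symmetric]) measurable
    qed
    also have "\<dots> = ennreal (pi / \<gamma>)"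
      by (simp add: cauchy_kernel_nn_integral[OF \<gamma>0] \<mu>.emeasure_space_1)
    also have "ennreal (1 / real n) * ennreal (pi / \<gamma>) = ennreal (pi / \<gamma> / real n)"
      by (subst ennreal_mult'[symmetric]) (auto simp: mult.commute)
    finally show ?thesis .
  qed
  have "(\<integral>\<^sup>+\<omega>. (\<integral>\<^sup>+x. ennreal ((cmod (mat_trace n (resolvent n (X \<omega>) (w x)) / of_nat n - G x))\<^sup>2) \<partial>lborel) \<partial>M)
     = (\<integral>\<^sup>+\<omega>. (\<integral>\<^sup>+x. T (a \<omega>) (\<xi> \<omega>) x \<partial>lborel) \<partial>M)"
    unfolding X_eq T_def ..
  also have "\<dots> = (\<integral>\<^sup>+x. (\<integral>\<^sup>+\<omega>. T (a \<omega>) (\<xi> \<omega>) x \<partial>M) \<partial>lborel)" by (rule swap[OF Tm])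
  also have "\<dots> \<le> (\<integral>\<^sup>+x. ennreal 8 * (\<integral>\<^sup>+\<omega>. e (a \<omega>) x \<partial>M) + ennreal (16 / real n ^ 3) * (\<integral>\<^sup>+\<omega>. H (a \<omega>) (\<xi> \<omega>) x \<partial>M) \<partial>lborel)"
    by (intro nn_integral_mono pointwise)
  also have "\<dots> = ennreal 8 * (\<integral>\<^sup>+x. (\<integral>\<^sup>+\<omega>. e (a \<omega>) x \<partial>M) \<partial>lborel) + ennreal (16 / real n ^ 3) * (\<integral>\<^sup>+x. (\<integral>\<^sup>+\<omega>. H (a \<omega>) (\<xi> \<omega>) x \<partial>M) \<partial>lborel)"
    using xm[OF Hm] xm[of "\<lambda>u _ x. e u x", OF em]
    by (subst nn_integral_add) (auto simp: nn_integral_cmult simp del: ennreal_numeral)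
  also have "\<dots> \<le> ennreal 8 * ennreal (pi / \<gamma> / real n) + ennreal (16 / real n ^ 3) * ennreal (4 * pi / \<gamma> * real n)"
    by (intro add_mono mult_left_mono sampling noise) auto
  also have "\<dots> = ennreal (8 * (pi / \<gamma> / real n) + 16 / real n ^ 3 * (4 * pi / \<gamma> * real n))"
    using \<gamma>0 by (subst (1 2) ennreal_mult'[symmetric]) auto
  also have "\<dots> \<le> ennreal (72 * pi / \<gamma> / real n)"
  proof (rule ennreal_leI)
    define c where "c = pi / \<gamma>"
    have c0: "c \<ge> 0" using \<gamma>0 by (simp add: c_def)
    have "16 / real n ^ 3 * (4 * c * real n) = 64 * c / real n * (1 / real n)"
      using n0 by (simp add: power3_eq_cube field_simps)
    also have "\<dots> \<le> 64 * c / real n * 1" using n c0 by (intro mult_left_mono) auto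
    finally have "8 * (c / real n) + 16 / real n ^ 3 * (4 * c * real n) \<le> 72 * c / real n" by simp
    then show "8 * (pi / \<gamma> / real n) + 16 / real n ^ 3 * (4 * pi / \<gamma> * real n) \<le> 72 * pi / \<gamma> / real n"
      by (simp add: c_def)
  qed
  finally show "(\<integral>\<^sup>+\<omega>. (\<integral>\<^sup>+x. ennreal ((cmod (mat_trace n (resolvent n (X \<omega>) (w x)) / of_nat n - G x))\<^sup>2) \<partial>lborel) \<partial>M)
      \<le> ennreal (72 * pi / \<gamma> / real n)" .
qed

theorem theorem4p2:
  fixes t \<gamma> C_K :: real
    and \<mu>\<^sub>0 :: "real measure" and p\<^sub>0 :: "real \<Rightarrow> real"
    and K :: "real \<Rightarrow> real" and Kstar :: "real \<Rightarrow> complex"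
  assumes "t > 0"
    and "prob_space \<mu>\<^sub>0"
    and "p\<^sub>0 \<in> borel_measurable borel" and "\<And>x. 0 \<le> p\<^sub>0 x"
    and "\<mu>\<^sub>0 = density lborel (\<lambda>x. ennreal (p\<^sub>0 x))"
    and "has_L2_fourier (\<lambda>x. of_real (K x)) Kstar"
    and "\<And>\<xi>. cmod (Kstar \<xi>) \<le> C_K"
    and "\<And>\<xi>. \<xi> \<notin> {-1..1} \<Longrightarrow> Kstar \<xi> = 0"
    and "\<exists>C>0. eventually (\<lambda>\<kappa>. measure \<mu>\<^sub>0 {\<kappa><..} \<le> C / \<kappa>) at_top"
    and "\<gamma> > 2 * sqrt t"
  shows "\<exists>C_var>0. \<forall>(M :: 'a measure) n d B B' h.
           n \<ge> 1 \<longrightarrow> matrix_model M \<mu>\<^sub>0 n d B B' \<longrightarrow> h > 0 \<longrightarrow>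
             (\<integral>\<^sup>+\<omega>. variance_term t \<gamma> p\<^sub>0 Kstar h (observed_matrix n d B B' t \<omega>) \<partial>M)
               \<le> ennreal (C_var * exp (2 * \<gamma> / h) / real n)"
proof -
  define L where "L = 2 * pi * exp (1/2) * (C_K / pi / (1 - 4 * t / \<gamma>\<^sup>2))\<^sup>2"
  \<comment> \<open>the summand \<open>1\<close> makes the constant positive even if \<open>C_K = 0\<close>\<close>
  define C_var where "C_var = L * (72 * pi / \<gamma>) + 1"
  note \<gamma>0 = strip_height(1)[OF assms(1,10)]
  have L0: "L \<ge> 0" by (simp add: L_def)
  have C0: "C_var > 0" using L0 \<gamma>0 by (simp add: C_var_def add_nonneg_pos)
  have s: "sets \<mu>\<^sub>0 = sets borel" by (simp add: assms(5))
  have "(\<integral>\<^sup>+\<omega>. variance_term t \<gamma> p\<^sub>0 Kstar h (observed_matrix n d B B' t \<omega>) \<partial>M) \<le> ennreal (C_var * exp (2 * \<gamma> / h) / real n)"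
    if n: "n \<ge> 1" and model: "matrix_model M \<mu>\<^sub>0 n d B B'" and h: "h > 0" for M :: "'a measure" and n d B B' h
  proof -
    define G where "G x = cauchy_transform \<mu>\<^sub>0 (Complex x \<gamma>)" for x
    define X where "X \<omega> = deformed_gue n (order_statistic n d \<omega>) (noise_coordinates B B' t \<omega>)" for \<omega>
    define I where "I \<omega> = (\<integral>\<^sup>+x. ennreal ((cmod (mat_trace n (resolvent n (X \<omega>) (Complex x \<gamma> + of_real t * G x)) / of_nat n - G x))\<^sup>2) \<partial>lborel)" for \<omega>
    note err = expected_error_bound[OF model n assms(1,10,2) s, folded G_def X_def, folded I_def]
    have "(\<integral>\<^sup>+\<omega>. variance_term t \<gamma> p\<^sub>0 Kstar h (observed_matrix n d B B' t \<omega>) \<partial>M) \<le> (\<integral>\<^sup>+\<omega>. ennreal (exp (2 * \<gamma> / h)) * ennreal L * I \<omega> \<partial>M)"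
    proof (rule nn_integral_mono)
      fix \<omega>
      show "variance_term t \<gamma> p\<^sub>0 Kstar h (observed_matrix n d B B' t \<omega>) \<le> ennreal (exp (2 * \<gamma> / h)) * ennreal L * I \<omega>"
        unfolding observed_matrix_eq I_def L_def G_def X_def
        by (rule variance_term_le) (use n assms h deformed_gue_hermitian in auto)
    qed
    also have "\<dots> = ennreal (exp (2 * \<gamma> / h)) * ennreal L * (\<integral>\<^sup>+\<omega>. I \<omega> \<partial>M)"
      by (rule nn_integral_cmult) (rule err(2))
    also have "\<dots> \<le> ennreal (exp (2 * \<gamma> / h)) * ennreal L * ennreal (72 * pi / \<gamma> / real n)"
      by (intro mult_left_mono err(1)) simp
    also have "\<dots> = ennreal (exp (2 * \<gamma> / h) * L * (72 * pi / \<gamma> / real n))"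
      using L0 by (simp only: ennreal_mult' mult_nonneg_nonneg exp_ge_zero)
    also have "\<dots> \<le> ennreal (C_var * exp (2 * \<gamma> / h) / real n)"
    proof (rule ennreal_leI)
      have "exp (2 * \<gamma> / h) * L * (72 * pi / \<gamma> / real n) = (L * (72 * pi / \<gamma>)) * exp (2 * \<gamma> / h) / real n" by simp
      also have "\<dots> \<le> C_var * exp (2 * \<gamma> / h) / real n"
        by (intro divide_right_mono mult_right_mono) (auto simp: C_var_def)
      finally show "exp (2 * \<gamma> / h) * L * (72 * pi / \<gamma> / real n) \<le> C_var * exp (2 * \<gamma> / h) / real n" .
    qed
    finally show ?thesis .
  qed
  with C0 show ?thesis by blast
qed

end
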